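(* Suppose that $-2<s<d-3$ and $V(x)=v(\|x\|^2)$, where $v$ is $\mathcal{C}^2$ in the extended sense on $[0,\infty)$. If $\mu_{\mathrm{eq}}=\sigma_{R_*}$ for some $R_*>0$, then the following must hold for $R=R_*$: (i) $\displaystyle R^{s+2}v'(R^2)=\frac{c_{s,d}}{4}$; (ii) $\displaystyle R^2\frac{v''(R^2)}{v'(R^2)}\ge-\frac{(s+2)(d-s-4)}{4(d-s-3)}$; (iii) if $s\neq0$, then $\displaystyle\lim_{r\to0^+}R^s\big(v(r^2)-v(R^2)\big)\ge\frac{c_{s,d}-1}{s}$; if $s=0$, then $\displaystyle\lim_{r\to0^+}v(r^2)-v(R^2)\ge b_d$; (iv) if $s\ne0$, then $\displaystyle v(R^2)+\frac{R^{-s}}{s}c_{s,d}\le\lim_{r\to\infty}\left[\frac{(R+r)^{-s}}{s}+v(r^2)\right]$; if $s=0$, then $\displaystyle-\log(R)+b_d+v(R^2)\le\lim_{r\to\infty}\left[-\log(R+r)+v(r^2)\right]$.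
   Context: $d\ge2$ is an integer. $\|\cdot\|$ is the Euclidean norm on $\mathbb{R}^d$, and $\mathcal{P}(\mathbb{R}^d)$ is the set of Borel probability measures on $\mathbb{R}^d$. The Riesz kernel is $K_s(x)=\frac{1}{s\|x\|^s}$ if $s\ne0$ and $K_0(x)=-\log\|x\|$. The function $v:[0,\infty)\to(-\infty,+\infty]$ is lower semicontinuous, bounded from below, and finite on some interval $(a,b)$. The energy of $\mu\in\mathcal{P}(\mathbb{R}^d)$ is $$I_{s,V}(\mu)=\iint\big(K_s(x-y)+V(x)+V(y)\big)\,\mathrm{d}\mu(x)\,\mathrm{d}\mu(y)\in(-\infty,+\infty],$$ and $\mu_{\mathrm{eq}}$ denotes the equilibrium measure, i.e. the (unique) minimizer of $I_{s,V}$ over $\mathcal{P}(\mathbb{R}^d)$. For $R>0$, $\sigma_R$ is the uniform probability measure on the sphere $\{x\in\mathbb{R}^d:\|x\|=R\}$. The constants are, with $\psi_0$ the digamma function, $$c_{s,d}={}_2\mathrm{F}_1\Big(\tfrac s2,\tfrac{2+s-d}{2};\tfrac d2;1\Big)=\frac{\Gamma(\frac d2)\Gamma(d-s-1)}{\Gamma(\frac{d-s}{2})\Gamma(d-\frac s2-1)},\qquad b_d=-\log 2+\tfrac12\psi_0(d-1)-\tfrac12\psi_0\big(\tfrac{d-1}{2}\big).$$ A function $f:I\to\mathbb{R}\cup\{\pm\infty\}$ on an interval $I$ is $\mathcal{C}^k$ in the extended sense on $I$ when for each $\ell\in\{0,\dots,k\}$ and $y\in I$, $f^{(\ell)}(y)$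 exists as an element of $\mathbb{R}\cup\{\pm\infty\}$ and is finite except at a finite set of values in $I$, and $\lim_{x\to y}f^{(\ell)}(x)=f^{(\ell)}(y)$ (one-sided limits at endpoints of $I$).
   Formalization: For s = -1, part (iv) as printed is false (e.g. d = 3, V the potential of the sphere), and (R+r)^{-s}/s is replaced there by r^{-s}/s; since the limit at infinity in (iv) need not exist, (iv) is stated with the lower limit. *)

theory Defs
  imports "HOL-Probability.Probability"
begin

section \<open>Functions that are k times continuously differentiable in the extended sense\<close>

text \<open>
  Difference quotients are formed in \<open>ereal\<close>, so that derivatives may be infinite, also at points
  where the function is infinite.  Working in \<open>at y within I\<close> yields one-sided
  limits at endpoints of \<open>I\<close>.
\<close>

definition ext_diff_quot :: "(real \<Rightarrow> ereal) \<Rightarrow> real \<Rightarrow> real \<Rightarrow> ereal" where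
  "ext_diff_quot f y x = (f x - f y) / ereal (x - y)"

definition ext_differentiable :: "real set \<Rightarrow> (real \<Rightarrow> ereal) \<Rightarrow> real \<Rightarrow> bool" where
  "ext_differentiable I f y \<longleftrightarrow> (\<exists>L. (ext_diff_quot f y \<longlongrightarrow> L) (at y within I))"

definition ext_deriv :: "real set \<Rightarrow> (real \<Rightarrow> ereal) \<Rightarrow> real \<Rightarrow> ereal" where
  "ext_deriv I f y = Lim (at y within I) (ext_diff_quot f y)"

definition ext_Ck_on :: "nat \<Rightarrow> real set \<Rightarrow> (real \<Rightarrow> ereal) \<Rightarrow> bool" where
  "ext_Ck_on k I f \<longleftrightarrow>
     (\<forall>l<k. \<forall>y\<in>I. ext_differentiable I ((ext_deriv I ^^ l) f) y) \<and>
     (\<forall>l\<le>k. finite {y \<in> I. \<bar>(ext_deriv I ^^ l) f y\<bar> = \<infinity>} \<and>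
       (\<forall>y\<in>I. ((ext_deriv I ^^ l) f \<longlongrightarrow> (ext_deriv I ^^ l) f y) (at y within I)))"

definition lsc_on :: "'a::topological_space set \<Rightarrow> ('a \<Rightarrow> ereal) \<Rightarrow> bool" where
  "lsc_on S f \<longleftrightarrow> (\<forall>x\<in>S. f x \<le> Liminf (at x within S) f)"


section \<open>Riesz energy with an external field\<close>

definition riesz_kernel :: "real \<Rightarrow> 'a::real_normed_vector \<Rightarrow> ereal" where
  "riesz_kernel s x =
     (if x = 0 then (if s < 0 then 0 else \<infinity>)
      else if s = 0 then ereal (- ln (norm x))
      else ereal (1 / (s * norm x powr s)))"

definition borel_prob_measures :: "'a::topological_space measure set" where
  "borel_prob_measures = {\<mu>. sets \<mu> = sets borel \<and> prob_space \<mu>}"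

definition energy_integrand ::
    "real \<Rightarrow> ('a::euclidean_space \<Rightarrow> ereal) \<Rightarrow> 'a \<times> 'a \<Rightarrow> ereal" where
  "energy_integrand s V = (\<lambda>(x, y). riesz_kernel s (x - y) + V x + V y)"

text \<open>
  \<open>e2ennreal\<close> truncates at 0, so the following are the integrals of the
  positive and of the negative part of the integrand.
\<close>

definition energy_pos :: "real \<Rightarrow> ('a::euclidean_space \<Rightarrow> ereal) \<Rightarrow> 'a measure \<Rightarrow> ennreal" where
  "energy_pos s V \<mu> = (\<integral>\<^sup>+ z. e2ennreal (energy_integrand s V z) \<partial>(\<mu> \<Otimes>\<^sub>M \<mu>))"

definition energy_neg :: "real \<Rightarrow> ('a::euclidean_space \<Rightarrow> ereal) \<Rightarrow> 'a measure \<Rightarrow> ennreal" where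
  "energy_neg s V \<mu> = (\<integral>\<^sup>+ z. e2ennreal (- energy_integrand s V z) \<partial>(\<mu> \<Otimes>\<^sub>M \<mu>))"

definition energy :: "real \<Rightarrow> ('a::euclidean_space \<Rightarrow> ereal) \<Rightarrow> 'a measure \<Rightarrow> ereal" where
  "energy s V \<mu> = enn2ereal (energy_pos s V \<mu>) - enn2ereal (energy_neg s V \<mu>)"

text \<open>
  The requirement that the energy integral of every Borel probability measure exists and
  has its value in $(-\infty,+\infty]$.
\<close>

definition energy_well_defined :: "real \<Rightarrow> ('a::euclidean_space \<Rightarrow> ereal) \<Rightarrow> bool" where
  "energy_well_defined s V \<longleftrightarrow> (\<forall>\<mu>\<in>borel_prob_measures. energy_neg s V \<mu> < \<infinity>)"

definition equilibrium_measure ::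
    "real \<Rightarrow> ('a::euclidean_space \<Rightarrow> ereal) \<Rightarrow> 'a measure \<Rightarrow> bool" where
  "equilibrium_measure s V \<mu> \<longleftrightarrow> is_arg_min (energy s V) (\<lambda>\<nu>. \<nu> \<in> borel_prob_measures) \<mu>"


section \<open>The uniform distribution on a sphere\<close>

text \<open>
  The uniform distribution on the unit ball, projected radially onto the sphere. The lemmas
  below confirm that this is a probability measure on the sphere that is invariant under all
  orthogonal transformations (the sort \<open>wellorder\<close> in the last one is inherited
  from the library's change of variables theorems).
\<close>

definition sphere_uniform :: "real \<Rightarrow> 'a::euclidean_space measure" where
  "sphere_uniform R =
     distr (uniform_measure lborel (ball 0 1)) borel (\<lambda>x. (R / norm x) *\<^sub>R x)"

lemma sphere_projection_measurable [measurable]: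
  "(\<lambda>x::'a::euclidean_space. (R / norm x) *\<^sub>R x) \<in> borel_measurable borel"
  by measurable

lemma emeasure_unit_ball_finite_nonzero:
  "emeasure lborel (ball (0::'a::euclidean_space) 1) \<noteq> 0"
  "emeasure lborel (ball (0::'a::euclidean_space) 1) \<noteq> \<infinity>"
  using content_ball_pos[of 1 "0::'a"] emeasure_lborel_ball_finite[of "0::'a" 1]
  by (auto simp: measure_def)

lemma sphere_uniform_in_borel_prob_measures:
  "(sphere_uniform R :: 'a::euclidean_space measure) \<in> borel_prob_measures"
proof -
  interpret prob_space "uniform_measure lborel (ball (0::'a) 1)"
    by (rule prob_space_uniform_measure) (use emeasure_unit_ball_finite_nonzero in auto)
  show ?thesis
    unfolding borel_prob_measures_def sphere_uniform_def
    by (auto intro!: prob_space_distr)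
qed

lemma sphere_uniform_concentrated:
  assumes "R > 0"
  shows "AE x in (sphere_uniform R :: 'a::euclidean_space measure). x \<in> sphere 0 R"
proof -
  have "AE x in lborel. (x::'a) \<noteq> 0"
    by (rule AE_lborel_singleton)
  then have "AE x in uniform_measure lborel (ball (0::'a) 1). (R / norm x) *\<^sub>R x \<in> sphere 0 R"
    using assms by (intro AE_uniform_measureI) auto
  then show ?thesis
    unfolding sphere_uniform_def by (subst AE_distr_iff) auto
qed

lemma sphere_uniform_rotation_invariant:
  fixes f :: "real^'n::{finite,wellorder} \<Rightarrow> real^'n::_"
  assumes f: "orthogonal_transformation f"
  shows "distr (sphere_uniform R) borel f = sphere_uniform R"
proof -
  have [measurable]: "f \<in> borel_measurable borel"
    using f by (intro borel_measurable_continuous_onI linear_continuous_on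
      linear_conv_bounded_linear[THEN iffD1] orthogonal_transformation_linear)
  have nf: "norm (f x) = norm x" for x
    using f by (rule orthogonal_transformation_norm)
  let ?p = "\<lambda>x::real^'n::_. (R / norm x) *\<^sub>R x"
  have fp: "f (?p x) = ?p (f x)" for x
    using f by (simp add: orthogonal_transformation_scaleR nf)
  define g where "g = inv f"
  have g: "orthogonal_transformation g"
    unfolding g_def using f by (rule orthogonal_transformation_inv)
  have gf: "g (f x) = x" "f (g x) = x" for x
    unfolding g_def using orthogonal_transformation_bij[OF f]
    by (simp_all add: bij_is_inj bij_is_surj surj_f_inv_f)
  have inv: "emeasure lborel (ball 0 1 \<inter> f -` B) = emeasure lborel (ball 0 1 \<inter> B)"
    if B [measurable]: "B \<in> sets borel" for B
  proof -
    have eq: "ball 0 1 \<inter> f -` B = g ` (ball 0 1 \<inter> B)"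
    proof (intro equalityI subsetI)
      fix x assume "x \<in> ball 0 1 \<inter> f -` B"
      then have "f x \<in> ball 0 1 \<inter> B" by (simp add: nf)
      then have "g (f x) \<in> g ` (ball 0 1 \<inter> B)" by (rule imageI)
      then show "x \<in> g ` (ball 0 1 \<inter> B)" by (simp add: gf)
    next
      fix x assume "x \<in> g ` (ball 0 1 \<inter> B)"
      then obtain y where "y \<in> ball 0 1 \<inter> B" "x = g y" by auto
      then show "x \<in> ball 0 1 \<inter> f -` B"
        using orthogonal_transformation_norm[OF g, of y] by (simp add: gf)
    qed
    have fin: "emeasure lborel (ball 0 1 \<inter> C) \<noteq> \<infinity>" if "C \<in> sets borel" for C :: "(real^'n::_) set"
      using emeasure_mono[of "ball 0 1 \<inter> C" "ball (0::real^'n::_) 1" lborel]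
        emeasure_unit_ball_finite_nonzero(2)[where 'a = "real^'n::_"]
      by (auto simp: top_unique)
    have [measurable]: "f -` B \<in> sets borel"
      using measurable_sets[of f borel borel B] by simp
    have lm: "ball 0 1 \<inter> B \<in> lmeasurable"
      using fin[OF B] by (intro fmeasurableI) (auto simp: less_top)
    have "measure lebesgue (g ` (ball 0 1 \<inter> B)) = measure lebesgue (ball 0 1 \<inter> B)"
      by (rule measure_orthogonal_image[OF g lm])
    then have "measure lborel (ball 0 1 \<inter> f -` B) = measure lborel (ball 0 1 \<inter> B)"
      unfolding eq[symmetric] by simp
    then show ?thesis
      using fin[OF B] fin[of "f -` B"]
      by (simp add: emeasure_eq_ennreal_measure)
  qed
  show ?thesis
  proof (rule measure_eqI)
    fix A assume "A \<in> sets (distr (sphere_uniform R) borel f)"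
    then have A [measurable]: "A \<in> sets borel" by simp
    have [measurable]: "?p -` A \<in> sets borel" "f -` A \<in> sets borel"
        "?p -` (f -` A) \<in> sets borel"
      using measurable_sets[of f borel borel A] measurable_sets[of ?p borel borel A]
        measurable_sets[of "\<lambda>x. f (?p x)" borel borel A]
      by (simp_all add: vimage_def)
    have "?p -` (f -` A) = f -` (?p -` A)"
      by (auto simp: fp)
    then have "emeasure lborel (ball 0 1 \<inter> ?p -` (f -` A)) = emeasure lborel (ball 0 1 \<inter> ?p -` A)"
      using inv[of "?p -` A"] by simp
    then show "emeasure (distr (sphere_uniform R) borel f) A = emeasure (sphere_uniform R) A"
      by (simp add: sphere_uniform_def emeasure_distr emeasure_uniform_measure)
  qed (simp add: sphere_uniform_def)
qed


section \<open>The constants\<close>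

definition hypergeom_2F1 :: "real \<Rightarrow> real \<Rightarrow> real \<Rightarrow> real \<Rightarrow> real" where
  "hypergeom_2F1 a b c x =
     (\<Sum>n. pochhammer a n * pochhammer b n / (pochhammer c n * fact n) * x ^ n)"

definition c_const :: "real \<Rightarrow> nat \<Rightarrow> real" where
  "c_const s d = hypergeom_2F1 (s/2) ((2 + s - real d)/2) (real d/2) 1"

definition b_const :: "nat \<Rightarrow> real" where
  "b_const d = - ln 2 + Digamma (real d - 1) / 2 - Digamma ((real d - 1)/2) / 2"

subsection \<open>Gauss's summation theorem\<close>

context
  fixes a b :: real
begin

private definition t :: "real \<Rightarrow> nat \<Rightarrow> real" where
  "t c n = pochhammer a n * pochhammer b n / (pochhammer c n * fact n)"

private lemma t_Suc: "c > 0 \<Longrightarrow> (c + n) * (real n + 1) * t c (Suc n) = (a + n) * (b + n) * t c n"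
  using pochhammer_pos[of c n] by (simp add: t_def pochhammer_Suc divide_simps)

private lemma t_asymp:
  assumes c: "c > 0"
  shows "(\<lambda>n. t c (Suc n) * real n powr (c + 1 - a - b)) \<longlonglongrightarrow> rGamma a * rGamma b / rGamma c"
proof -
  have "(\<lambda>n. rGamma_series a n * rGamma_series b n / (rGamma_series c n * rGamma_series 1 n))
      \<longlonglongrightarrow> rGamma a * rGamma b / (rGamma c * rGamma 1)"
    using c by (intro tendsto_intros) (auto simp: rGamma_eq_zero_iff elim!: nonpos_Ints_cases)
  moreover have "\<forall>\<^sub>F n in sequentially.
      rGamma_series a n * rGamma_series b n / (rGamma_series c n * rGamma_series 1 n) =
      t c (Suc n) * real n powr (c + 1 - a - b)"
    using eventually_gt_at_top[of 0]
  proof eventually_elim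
    case (elim n)
    have r: "rGamma_series z n = pochhammer z (Suc n) / (fact n * real n powr z)" for z :: real
      using elim by (simp add: rGamma_series_def powr_def)
    have p: "pochhammer (1::real) (Suc n) = fact (Suc n)"
      by (simp only: pochhammer_fact)
    show ?case
      unfolding r p t_def
      using elim pochhammer_pos[OF c, of "Suc n"]
      by (simp add: powr_add powr_diff divide_simps del: fact_Suc)
  qed
  ultimately show ?thesis
    by (simp add: tendsto_cong)
qed

private lemma summable_t:
  assumes c: "c > 0" "c - a - b > 0"
  shows "summable (\<lambda>n. \<bar>t c n\<bar>)"
proof -
  obtain K where K: "\<And>n. \<bar>t c (Suc n) * real n powr (c + 1 - a - b)\<bar> \<le> K"
    using convergent_imp_Bseq[OF convergentI[OF t_asymp[OF c(1)]]] unfolding Bseq_def by auto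
  have "summable (\<lambda>n. t c (Suc n))"
    and *: "summable (\<lambda>n. \<bar>t c (Suc n)\<bar>)"
  proof -
    have s: "summable (\<lambda>n. K * real n powr - (c + 1 - a - b))"
      using c by (intro summable_mult) (simp add: summable_real_powr_iff)
    have bd: "\<forall>\<^sub>F n in sequentially. \<bar>t c (Suc n)\<bar> \<le> K * real n powr - (c + 1 - a - b)"
      using eventually_gt_at_top[of 0]
    proof eventually_elim
      case (elim n)
      then have "real n powr (c + 1 - a - b) > 0" by simp
      then show ?case using K[of n]
        unfolding powr_minus by (simp add: abs_mult field_simps)
    qed
    show "summable (\<lambda>n. \<bar>t c (Suc n)\<bar>)"
      by (rule summable_comparison_test_ev[OF _ s]) (use bd in simp)
    then show "summable (\<lambda>n. t c (Suc n))"
      by (rule summable_rabs_cancel)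
  qed
  from * show ?thesis by (subst (asm) summable_Suc_iff)
qed

private lemma t_null:
  assumes c: "c > 0" "c - a - b > 0"
  shows "(\<lambda>n. real n * t c n) \<longlonglongrightarrow> 0"
proof -
  have "(\<lambda>n. (t c (Suc n) * real n powr (c + 1 - a - b)) * (real (Suc n) / real n) *
      real n powr - (c - a - b)) \<longlonglongrightarrow> (rGamma a * rGamma b / rGamma c) * 1 * 0"
    using c by (intro tendsto_mult t_asymp LIMSEQ_Suc_n_over_n tendsto_neg_powr
        filterlim_real_sequentially) auto
  moreover have "\<forall>\<^sub>F n in sequentially. (t c (Suc n) * real n powr (c + 1 - a - b)) *
      (real (Suc n) / real n) * real n powr - (c - a - b) = real (Suc n) * t c (Suc n)"
    using eventually_gt_at_top[of 0]
  proof eventually_elim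
    case (elim n)
    have "real n powr (c + 1 - a - b) * real n powr - (c - a - b) = real n"
      using elim by (simp flip: powr_add)
    then show ?case using elim by (simp add: field_simps)
  qed
  ultimately have "(\<lambda>n. real (Suc n) * t c (Suc n)) \<longlonglongrightarrow> 0"
    by (simp add: tendsto_cong)
  then show ?thesis by (subst (asm) filterlim_sequentially_Suc)
qed

private lemma t_shift:
  assumes "c > 0" shows "t (c + 1) n * (c + n) = c * t c n"
  using pochhammer_pos[OF assms, of n] pochhammer_pos[of "c + 1" n] assms
    pochhammer_rec[of c n] pochhammer_Suc[of c n]
  by (simp add: t_def divide_simps) (simp add: algebra_simps)

private lemma Gauss_rec:
  assumes c: "c > 0" "c - a - b > 0"
  shows "c * (c - a - b) * suminf (t c) = (c - a) * (c - b) * suminf (t (c + 1))"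
proof -
  have s: "summable (t c)" "summable (t (c + 1))"
    using summable_t[of c] summable_t[of "c + 1"] c by (auto intro: summable_rabs_cancel)
  have "c * (c - a - b) * t c n - (c - a) * (c - b) * t (c + 1) n
      = - c * (real (Suc n) * t c (Suc n) - real n * t c n)" for n
  proof -
    have "c + n \<noteq> 0" using c by simp
    then have 1: "t (c + 1) n = c * t c n / (c + n)"
      and 2: "real (Suc n) * t c (Suc n) = (a + n) * (b + n) * t c n / (c + n)"
      using t_shift[OF c(1), of n] t_Suc[OF c(1), of n] by (simp_all add: field_simps)
    show ?thesis unfolding 1 2 using \<open>c + n \<noteq> 0\<close> by (simp add: divide_simps) algebra
  qed
  moreover have "(\<lambda>n. - c * (real (Suc n) * t c (Suc n) - real n * t c n)) sums
      (- c * (0 - real 0 * t c 0))"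
    by (intro sums_mult telescope_sums t_null c)
  moreover have "(\<lambda>n. c * (c - a - b) * t c n - (c - a) * (c - b) * t (c + 1) n) sums
      (c * (c - a - b) * suminf (t c) - (c - a) * (c - b) * suminf (t (c + 1)))"
    by (intro sums_diff sums_mult summable_sums s)
  ultimately show ?thesis
    by (auto dest: sums_unique2)
qed

private lemma Gauss_iter:
  assumes c: "c > 0" "c - a - b > 0"
  shows "pochhammer c m * pochhammer (c - a - b) m * suminf (t c) =
    pochhammer (c - a) m * pochhammer (c - b) m * suminf (t (c + m))"
proof (induction m)
  case (Suc m)
  have "(c + m) * (c + m - a - b) * suminf (t (c + m)) =
      (c + m - a) * (c + m - b) * suminf (t (c + m + 1))"
    using c by (intro Gauss_rec) auto
  then have r: "(c + m) * (c - a - b + m) * suminf (t (c + m)) =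
      (c - a + m) * (c - b + m) * suminf (t (c + (1 + m)))"
    by (simp add: algebra_simps)
  have "pochhammer c (Suc m) * pochhammer (c - a - b) (Suc m) * suminf (t c)
      = (c + m) * (c - a - b + m) *
        (pochhammer c m * pochhammer (c - a - b) m * suminf (t c))"
    by (simp add: pochhammer_Suc)
  also have "\<dots> = pochhammer (c - a) m * pochhammer (c - b) m *
      ((c + m) * (c - a - b + m) * suminf (t (c + m)))"
    unfolding Suc.IH by (simp add: mult_ac)
  also have "\<dots> = pochhammer (c - a) (Suc m) * pochhammer (c - b) (Suc m) *
      suminf (t (c + real (Suc m)))"
    unfolding r by (simp add: pochhammer_Suc mult_ac)
  finally show ?case .
qed simp

private lemma Gauss_limit:
  assumes c: "c > 0" "c - a - b > 0"
  shows "(\<lambda>m. suminf (t (c + real m))) \<longlonglongrightarrow> 1"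
proof -
  define S where "S = (\<Sum>n. \<bar>t c (Suc n)\<bar>)"
  have sS: "summable (\<lambda>n. \<bar>t c (Suc n)\<bar>)"
    using summable_t[OF c] by (subst summable_Suc_iff)
  have bound: "\<bar>suminf (t (c + real m)) - 1\<bar> \<le> c / (c + real m) * S" for m
  proof -
    have sm: "summable (\<lambda>n. \<bar>t (c + real m) n\<bar>)"
      using c by (intro summable_t) auto
    then have sm': "summable (\<lambda>n. \<bar>t (c + real m) (Suc n)\<bar>)"
      by (subst summable_Suc_iff)
    have le: "\<bar>t (c + real m) (Suc n)\<bar> \<le> c / (c + real m) * \<bar>t c (Suc n)\<bar>" for n
    proof -
      have p: "pochhammer (c + 1) n \<le> pochhammer (c + real m + 1) n" 
        unfolding pochhammer_prod using c by (intro prod_mono) auto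
      have q: "0 < pochhammer (c + 1) n" "0 < pochhammer (c + real m + 1) n"
        using c by (auto intro!: pochhammer_pos)
      have "\<bar>t (c + real m) (Suc n)\<bar> = \<bar>pochhammer a (Suc n) * pochhammer b (Suc n)\<bar> /
          ((c + real m) * pochhammer (c + real m + 1) n * fact (Suc n))"
        using c q unfolding t_def pochhammer_rec[of "c + real m"] abs_divide abs_mult by simp
      also have "\<dots> \<le> \<bar>pochhammer a (Suc n) * pochhammer b (Suc n)\<bar> /
          ((c + real m) * pochhammer (c + 1) n * fact (Suc n))"
        using p q c by (intro divide_left_mono mult_right_mono mult_left_mono mult_pos_pos) auto
      also have "\<dots> = c / (c + real m) * \<bar>t c (Suc n)\<bar>"
        using c q unfolding t_def pochhammer_rec[of c] abs_divide abs_mult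
        by (simp add: divide_simps)
      finally show ?thesis .
    qed
    have "suminf (t (c + real m)) - 1 = (\<Sum>n. t (c + real m) (Suc n))"
    proof -
      have "t (c + real m) 0 = 1" by (simp add: t_def)
      then show ?thesis using suminf_split_head[OF summable_rabs_cancel[OF sm]] by linarith
    qed
    also have "\<bar>\<dots>\<bar> \<le> (\<Sum>n. \<bar>t (c + real m) (Suc n)\<bar>)"
      by (rule summable_rabs[OF sm'])
    also have "\<dots> \<le> (\<Sum>n. c / (c + real m) * \<bar>t c (Suc n)\<bar>)"
      by (intro suminf_le le sm' summable_mult sS)
    also have "\<dots> = c / (c + real m) * S"
      unfolding S_def by (rule suminf_mult[OF sS])
    finally show ?thesis .
  qed
  have null: "(\<lambda>m. c / (c + real m) * S) \<longlonglongrightarrow> 0"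
    by real_asymp
  have "(\<lambda>m. suminf (t (c + real m)) - 1) \<longlonglongrightarrow> 0"
    by (rule Lim_null_comparison[OF _ null]) (simp only: real_norm_def bound always_eventually simp_thms)
  then show ?thesis by (rule LIM_zero_cancel)
qed

lemma Gauss_hypergeometric:
  assumes c: "c > 0" "c - a - b > 0"
  shows "hypergeom_2F1 a b c 1 = Gamma c * Gamma (c - a - b) * rGamma (c - a) * rGamma (c - b)"
proof -
  have ev: "\<forall>\<^sub>F m in sequentially.
      rGamma_series c m * rGamma_series (c - a - b) m * suminf (t c) =
      rGamma_series (c - a) m * rGamma_series (c - b) m * suminf (t (c + real (Suc m)))"
    using eventually_gt_at_top[of 0]
  proof eventually_elim
    case (elim m)
    have r: "rGamma_series z m = pochhammer z (Suc m) / (fact m * real m powr z)" for z :: real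
      using elim by (simp add: rGamma_series_def powr_def)
    have e: "real m powr c * real m powr (c - a - b) = real m powr (c - a) * real m powr (c - b)"
      by (simp flip: powr_add)
    have "rGamma_series c m * rGamma_series (c - a - b) m * suminf (t c) =
      (pochhammer c (Suc m) * pochhammer (c - a - b) (Suc m) * suminf (t c)) /
        (fact m * fact m * (real m powr c * real m powr (c - a - b)))"
      unfolding r by (simp add: mult_ac)
    also have "\<dots> = rGamma_series (c - a) m * rGamma_series (c - b) m *
        suminf (t (c + real (Suc m)))"
      unfolding Gauss_iter[OF c] e r by (simp add: mult_ac)
    finally show ?case .
  qed
  have "(\<lambda>m. rGamma_series c m * rGamma_series (c - a - b) m * suminf (t c)) \<longlonglongrightarrow>
      rGamma c * rGamma (c - a - b) * suminf (t c)"
    by (intro tendsto_intros)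
  moreover have "(\<lambda>m. rGamma_series (c - a) m * rGamma_series (c - b) m *
      suminf (t (c + real (Suc m)))) \<longlonglongrightarrow> rGamma (c - a) * rGamma (c - b) * 1"
    by (intro tendsto_mult rGamma_series_LIMSEQ LIMSEQ_Suc[OF Gauss_limit[OF c]])
  ultimately have "rGamma c * rGamma (c - a - b) * suminf (t c) = rGamma (c - a) * rGamma (c - b)"
    using LIMSEQ_unique tendsto_cong[OF ev] by fastforce
  moreover have "rGamma c \<noteq> 0" "rGamma (c - a - b) \<noteq> 0"
    using c by (auto simp: rGamma_eq_zero_iff elim!: nonpos_Ints_cases)
  moreover have "hypergeom_2F1 a b c 1 = suminf (t c)"
    by (simp add: hypergeom_2F1_def t_def[abs_def])
  ultimately show ?thesis
    by (simp add: Gamma_def field_simps)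
qed

end

lemma c_const_Gamma:
  assumes "d > 0" "s < real d - 1"
  shows "c_const s d = Gamma (real d / 2) * Gamma (real d - s - 1) /
     (Gamma ((real d - s)/2) * Gamma (real d - s/2 - 1))"
proof -
  have eq: "(real d - s)/2 - (2 + s - real d)/2 = real d - s - 1"
    "real d / 2 - s/2 = (real d - s)/2" "real d / 2 - (2 + s - real d)/2 = real d - s/2 - 1"
    by (simp_all add: field_simps)
  have "c_const s d = Gamma (real d / 2) * Gamma (real d - s - 1) *
      rGamma ((real d - s)/2) * rGamma (real d - s/2 - 1)"
    unfolding c_const_def
    by (rule Gauss_hypergeometric[of "real d/2" "s/2" "(2 + s - real d)/2", unfolded eq])
      (use assms in auto)
  then show ?thesis
    unfolding rGamma_inverse_Gamma divide_inverse
    by (simp only: inverse_mult_distrib mult.assoc)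
qed

end

theory Submission
  imports Defs
begin

text \<open>
  Let \<open>u(\<rho>)\<close> be the mutual energy of the spheres of radii \<open>\<rho>\<close> and \<open>R\<close>. Comparing
  \<open>\<sigma>\<^sub>R\<close> with \<open>(1 - p) \<sigma>\<^sub>R + p \<sigma>\<^sub>\<rho>\<close> as \<open>p \<rightarrow> 0\<close> shows that
  \<open>u(\<rho>) + v(\<rho>\<^sup>2)\<close> is minimal at \<open>\<rho> = R\<close>. The conditions then follow from
  upper bounds of \<open>u\<close>: (iii) and (iv) from the kernel being decreasing, (i) and (ii) from an
  expansion of second order at \<open>R\<close>. Only in (iv) for \<open>s < - 1\<close> is minimality too weak; there,
  existence of all energies forces \<open>v\<close> to outgrow the kernel.

  Let \<open>T\<close> be the inner product of two independent uniform points of the unit sphere. The expansion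
  involves only \<open>E (2 - 2 T) powr (- q / 2)\<close> for \<open>q = s\<close> and \<open>q = s + 2\<close>, with
  \<open>E (- ln (2 - 2 T) / 2)\<close> instead of \<open>q = s\<close> if \<open>s = 0\<close>. Rotation invariance determines the
  even moments of \<open>T\<close>, so the binomial series turns these expectations into hypergeometric series
  at 1, which Gauss's theorem and Legendre duplication identify with \<open>c_const q d\<close>.
\<close>

section \<open>Rotation invariance of the uniform distribution on the sphere\<close>

text \<open>Apart from (iv) with s < -1, every condition comes from a lower bound for
  \<open>v\<close>, so only upper bounds of the mutual energy are needed and its differentiability
  never enters. The convenient variable is the squared distance D: on two concentric spheres it is
  affine in the inner product, and for s > -2 the kernel is decreasing and convex in D. The
  second-order term averages the derivative of the kernel, a multiple of D powr (- s / 2 - 1), which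
  is the moment with q = s + 2; its finiteness, q < d - 1, is the hypothesis s < d - 3. The quotient
  of \<open>c_const (s + 2) d\<close> and \<open>c_const s d\<close> then produces the fraction in
  (ii). In (iv) the value s = -1 is the borderline: replacing r by R + r in the kernel has a
  vanishing effect at infinity for s > -1, shifts it by the constant R for s = -1, and is outweighed
  by the growth of the field for s < -1.\<close>

lemma nn_integral_lborel_translate:
  fixes h :: "'a::euclidean_space \<Rightarrow> ennreal"
  assumes [measurable]: "h \<in> borel_measurable borel"
  shows "(\<integral>\<^sup>+x. h (c + x) \<partial>lborel) = (\<integral>\<^sup>+x. h x \<partial>lborel)"
proof -
  have "(\<integral>\<^sup>+x. h x \<partial>lborel) = (\<integral>\<^sup>+x. h x \<partial>distr lborel borel ((+) c))"
    by (simp add: lborel_distr_plus)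
  also have "\<dots> = (\<integral>\<^sup>+x. h (c + x) \<partial>lborel)"
    by (rule nn_integral_distr) auto
  finally show ?thesis ..
qed

lemma orthogonal_transformation_borel_measurable:
  fixes f :: "'a::euclidean_space \<Rightarrow> 'a"
  assumes "orthogonal_transformation f"
  shows "f \<in> borel_measurable borel"
  using assms by (intro borel_measurable_continuous_onI linear_continuous_on
      linear_conv_bounded_linear[THEN iffD1] orthogonal_transformation_linear)

text \<open>
  The image measure is translation invariant. Integrating
  \<open>(x, y) \<mapsto> 1\<^sub>A (f x) 1\<^sub>B (y - f x)\<close> for the unit ball \<open>B\<close>
  in both orders identifies it with Lebesgue measure.
\<close>

lemma distr_lborel_orthogonal_transformation:
  fixes f :: "'a::euclidean_space \<Rightarrow> 'a"
  assumes f: "orthogonal_transformation f"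
  shows "distr lborel borel f = lborel"
proof (rule measure_eqI)
  note [measurable] = orthogonal_transformation_borel_measurable[OF f]
  define g where "g = inv f"
  have g: "f (g x) = x" for x
    unfolding g_def using orthogonal_transformation_bij[OF f]
    by (simp add: bij_is_surj surj_f_inv_f)
  have add: "f (x + y) = f x + f y" for x y
    using orthogonal_transformation_linear[OF f] by (rule linear_add)
  have nf: "norm (f x) = norm x" for x
    using f by (rule orthogonal_transformation_norm)
  let ?B = "ball (0::'a) 1"
  have [measurable]: "?B \<in> sets borel" by simp
  fix A assume "A \<in> sets (distr lborel borel f)"
  then have A [measurable]: "A \<in> sets borel" by simp
  have *: "(\<lambda>x. indicator A (f x) :: ennreal) \<in> borel_measurable borel" by measurable
  have "emeasure (distr lborel borel f) A * emeasure lborel ?B =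
      (\<integral>\<^sup>+x. indicator A (f x) * emeasure lborel ?B \<partial>lborel)"
    by (subst nn_integral_multc) (simp_all add: nn_integral_distr flip: nn_integral_indicator)
  also have "\<dots> = (\<integral>\<^sup>+x. \<integral>\<^sup>+y. indicator A (f x) * indicator ?B (y - f x) \<partial>lborel \<partial>lborel)"
  proof (rule nn_integral_cong)
    fix x
    have "(\<integral>\<^sup>+y. indicator ?B (- f x + y) \<partial>lborel) = (\<integral>\<^sup>+y. indicator ?B y \<partial>(lborel::'a measure))"
      by (rule nn_integral_lborel_translate) (auto intro: borel_measurable_indicator)
    moreover have "(\<lambda>y. indicator ?B (y - f x) :: ennreal) \<in> borel_measurable lborel" by measurable
    ultimately show "indicator A (f x) * emeasure lborel ?B =
        (\<integral>\<^sup>+y. indicator A (f x) * indicator ?B (y - f x) \<partial>lborel)"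
      by (subst nn_integral_cmult) auto
  qed
  also have "\<dots> = (\<integral>\<^sup>+y. \<integral>\<^sup>+x. indicator A (f x) * indicator ?B (y - f x) \<partial>lborel \<partial>lborel)"
    by (rule lborel_pair.Fubini') measurable
  also have "\<dots> = (\<integral>\<^sup>+y. \<integral>\<^sup>+x. indicator A (y + f x) * indicator ?B x \<partial>lborel \<partial>lborel)"
  proof (rule nn_integral_cong)
    \<comment> \<open>Translating x by \<open>g y\<close> turns f x into y + f x and y - f x into -
      f x, which lies in the unit ball exactly when x does.\<close>
    fix y
    have "(\<integral>\<^sup>+x. indicator A (f x) * indicator ?B (y - f x) \<partial>lborel) =
        (\<integral>\<^sup>+x. indicator A (f (g y + x)) * indicator ?B (y - f (g y + x)) \<partial>lborel :: ennreal)"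
      by (rule nn_integral_lborel_translate[symmetric]) measurable
    then show "(\<integral>\<^sup>+x. indicator A (f x) * indicator ?B (y - f x) \<partial>lborel) =
        (\<integral>\<^sup>+x. indicator A (y + f x) * indicator ?B x \<partial>lborel :: ennreal)"
      by (simp add: add g indicator_def nf)
  qed
  also have "\<dots> = (\<integral>\<^sup>+x. \<integral>\<^sup>+y. indicator A (y + f x) * indicator ?B x \<partial>lborel \<partial>lborel)"
    by (rule lborel_pair.Fubini') measurable
  also have "\<dots> = (\<integral>\<^sup>+x. emeasure lborel A * indicator ?B x \<partial>lborel)"
  proof (rule nn_integral_cong)
    fix x
    have "(\<integral>\<^sup>+y. indicator A (f x + y) \<partial>lborel) = (\<integral>\<^sup>+y. indicator A y \<partial>(lborel::'a measure))"
      by (rule nn_integral_lborel_translate) auto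
    then show "(\<integral>\<^sup>+y. indicator A (y + f x) * indicator ?B x \<partial>lborel) =
        emeasure lborel A * indicator ?B x"
      by (simp add: nn_integral_multc add.commute)
  qed
  also have "\<dots> = emeasure lborel A * emeasure lborel ?B"
    by (simp add: nn_integral_cmult)
  finally show "emeasure (distr lborel borel f) A = emeasure lborel A"
    using emeasure_unit_ball_finite_nonzero[where 'a='a]
    by (simp add: ennreal_mult_cancel_left mult.commute[of _ "emeasure lborel ?B"])
qed simp

text \<open>The uniform measure on the ball is invariant and the radial projection commutes with
  \<open>f\<close>, which is linear and preserves norms. The result covers every Euclidean space
  because the index type in the theorem has only sort \<open>finite\<close>.\<close>

lemma distr_sphere_uniform_orthogonal_transformation:
  fixes f :: "'a::euclidean_space \<Rightarrow> 'a"
  assumes f: "orthogonal_transformation f"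
  shows "distr (sphere_uniform R) borel f = sphere_uniform R"
proof -
  note [measurable] = orthogonal_transformation_borel_measurable[OF f]
  have nf: "norm (f x) = norm x" for x
    using f by (rule orthogonal_transformation_norm)
  let ?U = "uniform_measure lborel (ball (0::'a) 1)" and ?p = "\<lambda>x::'a. (R / norm x) *\<^sub>R x"
  have U: "distr ?U borel f = ?U"
  proof (rule measure_eqI)
    fix A assume "A \<in> sets (distr ?U borel f)"
    then have A [measurable]: "A \<in> sets borel" by simp
    have [measurable]: "f -` A \<in> sets borel"
      using measurable_sets[of f borel borel A] by simp
    have "emeasure lborel (ball 0 1 \<inter> A) = emeasure (distr lborel borel f) (ball 0 1 \<inter> A)"
      by (simp add: distr_lborel_orthogonal_transformation[OF f])
    also have "\<dots> = emeasure lborel (ball 0 1 \<inter> f -` A)"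
      by (subst emeasure_distr) (auto simp: nf intro!: arg_cong2[where f=emeasure])
    finally show "emeasure (distr ?U borel f) A = emeasure ?U A"
      by (simp add: emeasure_distr emeasure_uniform_measure)
  qed simp
  have "distr (sphere_uniform R) borel f = distr ?U borel (\<lambda>x. ?p (f x))"
    unfolding sphere_uniform_def
    by (subst distr_distr) (auto simp: o_def nf orthogonal_transformation_scaleR[OF f])
  also have "\<dots> = distr (distr ?U borel f) borel ?p"
    by (subst distr_distr) (auto simp: o_def)
  finally show ?thesis
    by (simp add: U sphere_uniform_def)
qed

text \<open>The reflection in the hyperplane orthogonal to w - z works: equality of the norms gives
  2 (w . u) = u . u, so w moves by exactly u.\<close>

lemma orthogonal_transformation_reflection:
  fixes z w :: "'a::euclidean_space"
  assumes "norm z = norm w"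
  obtains g where "orthogonal_transformation g" "g w = z"
proof (cases "z = w")
  case True
  then show ?thesis by (intro that[of "\<lambda>x. x"]) auto
next
  case False
  define u where "u = w - z"
  define g where "g x = x - (2 * (x \<bullet> u) / (u \<bullet> u)) *\<^sub>R u" for x
  have u: "u \<bullet> u \<noteq> 0" using False by (simp add: u_def)
  have "w \<bullet> w = z \<bullet> z" using assms by (simp add: norm_eq)
  then have wu: "2 * (w \<bullet> u) = u \<bullet> u"
    by (simp add: u_def inner_diff inner_commute)
  have "linear g"
    unfolding g_def by (rule linearI) (simp_all add: inner_add_left algebra_simps add_divide_distrib)
  moreover have "g x \<bullet> g y = x \<bullet> y" for x y
  proof -
    define a b where "a = 2 * (x \<bullet> u) / (u \<bullet> u)" and "b = 2 * (y \<bullet> u) / (u \<bullet> u)"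
    have ab: "a * (u \<bullet> u) = 2 * (x \<bullet> u)" "a * (y \<bullet> u) = b * (x \<bullet> u)"
      using u by (simp_all add: a_def b_def)
    have "g x = x - a *\<^sub>R u" "g y = y - b *\<^sub>R u"
      by (simp_all add: g_def a_def b_def)
    then have "g x \<bullet> g y = x \<bullet> y - b * (x \<bullet> u) - a * (y \<bullet> u) + b * (a * (u \<bullet> u))"
      by (simp only: inner_diff_left inner_diff_right inner_scaleR_left inner_scaleR_right)
        (simp add: inner_commute[of u y] algebra_simps)
    then show ?thesis unfolding ab by simp
  qed
  ultimately have "orthogonal_transformation g"
    by (simp add: orthogonal_transformation_def)
  moreover have "g w = z"
    using u unfolding g_def wu by (simp add: u_def)
  ultimately show ?thesis by (rule that)
qed

abbreviation sphere_unif :: "'a::euclidean_space measure" where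
  "sphere_unif \<equiv> sphere_uniform 1"

lemma sets_sphere_uniform [simp, measurable_cong]: "sets (sphere_uniform R) = sets borel"
  by (simp add: sphere_uniform_def)

lemma space_sphere_uniform [simp]: "space (sphere_uniform R) = UNIV"
  by (simp add: sphere_uniform_def)

lemma prob_space_sphere_uniform: "prob_space (sphere_uniform R)"
  using sphere_uniform_in_borel_prob_measures by (auto simp: borel_prob_measures_def)

lemma sphere_uniform_eq_distr:
  "sphere_uniform R = distr (sphere_unif :: 'a::euclidean_space measure) borel (\<lambda>x. R *\<^sub>R x)"
  unfolding sphere_uniform_def by (subst distr_distr) (auto simp: o_def)

lemma AE_sphere_unif_norm: "AE x in sphere_unif. norm (x::'a::euclidean_space) = 1"
  using sphere_uniform_concentrated[of 1, where 'a='a] by simp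

lemma distr_sphere_unif_inner_cong:
  fixes z w :: "'a::euclidean_space"
  assumes "norm z = norm w"
  shows "distr sphere_unif borel (\<lambda>x. x \<bullet> z) = distr sphere_unif borel (\<lambda>x. x \<bullet> w)"
proof -
  obtain g where g: "orthogonal_transformation g" "g w = z"
    using orthogonal_transformation_reflection[OF assms] .
  note [measurable] = orthogonal_transformation_borel_measurable[OF g(1)]
  have "distr sphere_unif borel (\<lambda>x. x \<bullet> z) =
      distr (distr sphere_unif borel g) borel (\<lambda>x. x \<bullet> z)"
    by (simp add: distr_sphere_uniform_orthogonal_transformation[OF g(1)])
  also have "\<dots> = distr sphere_unif borel (\<lambda>x. g x \<bullet> g w)"
    by (subst distr_distr) (auto simp: o_def g)
  also have "\<dots> = distr sphere_unif borel (\<lambda>x. x \<bullet> w)"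
    using g(1) by (simp add: orthogonal_transformation_def)
  finally show ?thesis .
qed

lemma integral_sphere_unif_inner_cong:
  fixes z w :: "'a::euclidean_space" and h :: "real \<Rightarrow> real"
  assumes "norm z = norm w" and [measurable]: "h \<in> borel_measurable borel"
  shows "(\<integral>x. h (x \<bullet> z) \<partial>sphere_unif) = (\<integral>x. h (x \<bullet> w) \<partial>sphere_unif)"
proof -
  have "(\<integral>x. h (x \<bullet> y) \<partial>sphere_unif) = (\<integral>t. h t \<partial>distr sphere_unif borel (\<lambda>x. x \<bullet> y))"
    for y :: 'a
    by (subst integral_distr) auto
  then show ?thesis
    using distr_sphere_unif_inner_cong[OF assms(1)] by simp
qed

section \<open>Moments of the inner product of two random points of the sphere\<close>

lemma integrable_sphere_unif_bounded:
  fixes h :: "'a::euclidean_space \<Rightarrow> real"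
  assumes "h \<in> borel_measurable borel" and "\<And>x. norm x = 1 \<Longrightarrow> \<bar>h x\<bar> \<le> B"
  shows "integrable sphere_unif h"
proof -
  interpret prob_space "sphere_unif :: 'a measure" by (rule prob_space_sphere_uniform)
  show ?thesis
  proof (rule integrable_const_bound)
    show "AE x in sphere_unif. norm (h x) \<le> B"
      using AE_sphere_unif_norm by eventually_elim (simp add: assms)
  qed (use assms in simp)
qed

lemma integrable_sphere_unif_powers:
  fixes y z :: "'a::euclidean_space"
  shows "integrable sphere_unif (\<lambda>x. (x \<bullet> y) ^ k * (x \<bullet> z) ^ l)"
proof (rule integrable_sphere_unif_bounded)
  fix x :: 'a assume "norm x = 1"
  then have "\<bar>x \<bullet> y\<bar> \<le> norm y" "\<bar>x \<bullet> z\<bar> \<le> norm z"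
    using Cauchy_Schwarz_ineq2[of x y] Cauchy_Schwarz_ineq2[of x z] by auto
  then show "\<bar>(x \<bullet> y) ^ k * (x \<bullet> z) ^ l\<bar> \<le> norm y ^ k * norm z ^ l"
    by (auto simp: abs_mult power_abs intro!: mult_mono power_mono)
qed simp

text \<open>
  Rotating \<open>i\<close> to a multiple of \<open>i + h j\<close> gives
  \<open>E (x \<bullet> (i + h j)) ^ (2 N) = (1 + h\<^sup>2) ^ N E (x \<bullet> i) ^ (2 N)\<close>; compare the
  coefficients of \<open>h\<^sup>2\<close>.
\<close>

lemma sphere_unif_mixed_moment:
  fixes i j :: "'a::euclidean_space"
  assumes ij: "i \<in> Basis" "j \<in> Basis" "i \<noteq> j"
  shows "(2 * real n + 1) * (\<integral>x. (x \<bullet> j)\<^sup>2 * (x \<bullet> i) ^ (2 * n) \<partial>sphere_unif) =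
    (\<integral>x. (x \<bullet> i) ^ (2 * Suc n) \<partial>sphere_unif)"
proof -
  define N where "N = Suc n"
  have N: "N \<ge> 1" by (simp add: N_def)
  define E where "E k = (\<integral>x. (x \<bullet> j) ^ k * (x \<bullet> i) ^ (2 * N - k) \<partial>sphere_unif)" for k
  define M where "M = (\<integral>x. (x \<bullet> i) ^ (2 * N) \<partial>sphere_unif)"
  define p where "p = (\<Sum>k\<le>2 * N. monom (real (2 * N choose k) * E k) k)"
  define q where "q = (\<Sum>k\<le>N. monom (real (N choose k) * M) (2 * k))"
  have "poly p h = poly q h" for h
  proof -
    have "(norm (i + h *\<^sub>R j))\<^sup>2 = 1 + h\<^sup>2"
      using ij unfolding power2_norm_eq_inner
      by (simp add: inner_add inner_Basis power2_eq_square)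
    then have nrm: "norm (i + h *\<^sub>R j) = norm (sqrt (1 + h\<^sup>2) *\<^sub>R i)"
      using ij by (simp add: real_sqrt_unique)
    have "poly p h = (\<Sum>k\<le>2 * N. \<integral>x. real (2 * N choose k) * h ^ k * ((x \<bullet> j) ^ k * (x \<bullet> i) ^ (2 * N - k)) \<partial>sphere_unif)"
      unfolding p_def poly_sum poly_monom E_def integral_mult_right_zero by (simp only: mult_ac)
    also have "\<dots> = (\<integral>x. (\<Sum>k\<le>2 * N. real (2 * N choose k) * h ^ k * ((x \<bullet> j) ^ k * (x \<bullet> i) ^ (2 * N - k))) \<partial>sphere_unif)"
      by (rule Bochner_Integration.integral_sum[symmetric]) (intro integrable_mult_right integrable_sphere_unif_powers)
    also have "\<dots> = (\<integral>x. (x \<bullet> (i + h *\<^sub>R j)) ^ (2 * N) \<partial>sphere_unif)"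
    proof (rule Bochner_Integration.integral_cong)
      fix x
      have "(x \<bullet> (i + h *\<^sub>R j)) ^ (2 * N) = (h * (x \<bullet> j) + x \<bullet> i) ^ (2 * N)"
        by (simp add: inner_add_right add.commute)
      then show "(\<Sum>k\<le>2 * N. real (2 * N choose k) * h ^ k * ((x \<bullet> j) ^ k * (x \<bullet> i) ^ (2 * N - k))) =
          (x \<bullet> (i + h *\<^sub>R j)) ^ (2 * N)"
        by (simp add: binomial_ring power_mult_distrib mult_ac)
    qed simp
    also have "\<dots> = (\<integral>x. (x \<bullet> (sqrt (1 + h\<^sup>2) *\<^sub>R i)) ^ (2 * N) \<partial>sphere_unif)"
      by (rule integral_sphere_unif_inner_cong[OF nrm]) simp
    also have "\<dots> = (h\<^sup>2 + 1) ^ N * M"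
      by (simp add: M_def power_mult_distrib power_mult add.commute)
    also have "\<dots> = poly q h"
      by (simp add: q_def poly_sum poly_monom binomial_ring sum_distrib_left mult_ac flip: power_mult)
    finally show ?thesis .
  qed
  \<comment> \<open>Real polynomials that agree everywhere coincide. In degree 2 the polynomial
    \<open>q\<close> contributes the index k = 1, as it contains only even powers.\<close>
  then have "p = q"
    by (simp flip: poly_eq_poly_eq_iff add: fun_eq_iff)
  then have "coeff p 2 = coeff q 2" by simp
  moreover have "coeff p 2 = real (2 * N choose 2) * E 2"
    using N by (simp add: p_def coeff_sum sum.delta)
  moreover have "coeff q 2 = (\<Sum>k\<le>N. if k = 1 then real (N choose k) * M else 0)"
    unfolding q_def coeff_sum by (rule sum.cong) auto
  ultimately have "real (2 * N choose 2) * E 2 = real N * M"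
    using N by (simp add: sum.delta)
  moreover have "real (2 * N choose 2) = real N * (2 * real n + 1)"
  proof -
    have "2 * N choose 2 = N * (2 * n + 1)" by (simp add: choose_two N_def)
    then show ?thesis by (simp add: algebra_simps)
  qed
  moreover have "2 * N - 2 = 2 * n" "real N > 0" by (simp_all add: N_def)
  ultimately show ?thesis
    by (simp add: E_def M_def flip: N_def) 
qed

text \<open>Insert 1 = sum of the squared coordinates into the moment of order 2 n. The coordinate
  \<open>i\<close> itself gives the next moment M, and each of the d - 1 others gives M / (2 n +
  1).\<close>

lemma sphere_unif_moment_Suc:
  fixes e :: "'a::euclidean_space"
  assumes e: "norm e = 1"
  shows "(real DIM('a) + 2 * real n) * (\<integral>x. (x \<bullet> e) ^ (2 * Suc n) \<partial>sphere_unif) =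
    (2 * real n + 1) * (\<integral>x. (x \<bullet> e) ^ (2 * n) \<partial>sphere_unif)"
proof -
  obtain i :: 'a where i: "i \<in> Basis" using nonempty_Basis by blast
  define M where "M n = (\<integral>x. (x \<bullet> i) ^ (2 * n) \<partial>sphere_unif)" for n
  define Q where "Q j = (\<integral>x. (x \<bullet> j)\<^sup>2 * (x \<bullet> i) ^ (2 * n) \<partial>sphere_unif)" for j
  have Me: "(\<integral>x. (x \<bullet> e) ^ (2 * n) \<partial>sphere_unif) = M n" for n
    unfolding M_def using i e by (intro integral_sphere_unif_inner_cong) auto
  have "M n = (\<integral>x. (\<Sum>j\<in>Basis. (x \<bullet> j)\<^sup>2 * (x \<bullet> i) ^ (2 * n)) \<partial>sphere_unif)"
    unfolding M_def
  proof (rule integral_cong_AE)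
    show "AE x in sphere_unif. (x \<bullet> i) ^ (2 * n) = (\<Sum>j\<in>Basis. (x \<bullet> j)\<^sup>2 * (x \<bullet> i) ^ (2 * n))"
      using AE_sphere_unif_norm
    proof eventually_elim
      case (elim x)
      have "(\<Sum>j\<in>Basis. (x \<bullet> j)\<^sup>2) = (norm x)\<^sup>2"
        unfolding power2_norm_eq_inner by (simp add: power2_eq_square euclidean_inner[of x x])
      then show ?case by (simp add: elim flip: sum_distrib_right)
    qed
  qed auto
  also have "\<dots> = (\<Sum>j\<in>Basis. Q j)"
    unfolding Q_def by (rule Bochner_Integration.integral_sum) (rule integrable_sphere_unif_powers)
  also have "\<dots> = Q i + (\<Sum>j\<in>Basis - {i}. Q j)"
    by (rule sum.remove) (use i in auto)
  also have "Q i = M (Suc n)"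
    by (simp add: Q_def M_def power2_eq_square mult_ac)
  finally have "(2 * real n + 1) * M n =
      (2 * real n + 1) * M (Suc n) + (\<Sum>j\<in>Basis - {i}. (2 * real n + 1) * Q j)"
    by (simp add: distrib_left sum_distrib_left)
  also have "(\<Sum>j\<in>Basis - {i}. (2 * real n + 1) * Q j) = (\<Sum>j\<in>Basis - {i}. M (Suc n))"
    unfolding Q_def M_def using i by (intro sum.cong sphere_unif_mixed_moment) auto
  also have "\<dots> = (real DIM('a) - 1) * M (Suc n)"
    using i DIM_positive[where 'a='a] by (simp add: card_Diff_singleton of_nat_diff Suc_le_eq)
  finally show ?thesis
    unfolding Me by (simp add: algebra_simps)
qed

lemma sphere_unif_moment:
  fixes e :: "'a::euclidean_space"
  assumes "norm e = 1"
  shows "(\<integral>x. (x \<bullet> e) ^ (2 * n) \<partial>sphere_unif) =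
    pochhammer (1 / 2) n / pochhammer (real DIM('a) / 2) n"
proof (induction n)
  case 0
  interpret prob_space "sphere_unif :: 'a measure" by (rule prob_space_sphere_uniform)
  show ?case using prob_space by simp
next
  case (Suc n)
  have pos: "0 < real DIM('a) + 2 * real n" "pochhammer (real DIM('a) / 2) n > 0"
    using DIM_positive[where 'a='a] by (auto intro!: pochhammer_pos simp: add_pos_nonneg)
  define m where "m = (\<integral>x. (x \<bullet> e) ^ (2 * Suc n) \<partial>sphere_unif)"
  have "(real DIM('a) + 2 * real n) * m =
      (2 * real n + 1) * (pochhammer (1 / 2) n / pochhammer (real DIM('a) / 2) n)"
    using sphere_unif_moment_Suc[OF assms, of n] unfolding m_def Suc.IH .
  then show ?case
    using pos unfolding m_def[symmetric] pochhammer_Suc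
    by (simp add: nonzero_eq_divide_eq) (simp add: divide_simps, simp add: algebra_simps)
qed

text \<open>For almost every fixed y the law of x . y is that of x . e, since only the norm of the
  second vector matters; Fubini then removes y.\<close>

lemma distr_sphere_unif_pair_inner:
  fixes e :: "'a::euclidean_space"
  assumes e: "norm e = 1"
  shows "distr (sphere_unif \<Otimes>\<^sub>M (sphere_unif :: 'a measure)) borel (\<lambda>(x, y). x \<bullet> y) =
    distr sphere_unif borel (\<lambda>x. x \<bullet> e)"
proof (rule measure_eqI)
  interpret prob_space "sphere_unif :: 'a measure" by (rule prob_space_sphere_uniform)
  interpret pair_prob_space "sphere_unif :: 'a measure" "sphere_unif :: 'a measure" ..
  fix A assume "A \<in> sets (distr (sphere_unif \<Otimes>\<^sub>M (sphere_unif :: 'a measure)) borel (\<lambda>(x, y). x \<bullet> y))"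
  then have A [measurable]: "A \<in> sets borel" by simp
  have em: "(\<integral>\<^sup>+x. indicator A (x \<bullet> y) \<partial>sphere_unif) =
      emeasure (distr sphere_unif borel (\<lambda>x. x \<bullet> y)) A" for y :: 'a
    by (simp add: nn_integral_distr flip: nn_integral_indicator)
  have "emeasure (distr (sphere_unif \<Otimes>\<^sub>M (sphere_unif :: 'a measure)) borel (\<lambda>(x, y). x \<bullet> y)) A =
      (\<integral>\<^sup>+z. indicator A (fst z \<bullet> snd z) \<partial>(sphere_unif \<Otimes>\<^sub>M (sphere_unif :: 'a measure)))"
    by (simp add: nn_integral_distr case_prod_beta flip: nn_integral_indicator)
  also have "\<dots> = (\<integral>\<^sup>+y. \<integral>\<^sup>+x. indicator A (x \<bullet> y) \<partial>sphere_unif \<partial>(sphere_unif :: 'a measure))"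
    by (subst nn_integral_snd[symmetric]) auto
  also have "\<dots> = (\<integral>\<^sup>+y. emeasure (distr sphere_unif borel (\<lambda>x. x \<bullet> e)) A \<partial>(sphere_unif :: 'a measure))"
  proof (rule nn_integral_cong_AE)
    show "AE y in (sphere_unif :: 'a measure). (\<integral>\<^sup>+x. indicator A (x \<bullet> y) \<partial>sphere_unif) =
        emeasure (distr sphere_unif borel (\<lambda>x. x \<bullet> e)) A"
      using AE_sphere_unif_norm
    proof eventually_elim
      case (elim y)
      then show ?case
        unfolding em using e by (subst distr_sphere_unif_inner_cong[of y e]) auto
    qed
  qed
  also have "\<dots> = emeasure (distr sphere_unif borel (\<lambda>x. x \<bullet> e)) A"
    using prob_space.emeasure_space_1[OF prob_space_sphere_uniform[of 1, where 'a='a]] by simp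
  finally show "emeasure (distr (sphere_unif \<Otimes>\<^sub>M (sphere_unif :: 'a measure)) borel (\<lambda>(x, y). x \<bullet> y)) A =
      emeasure (distr sphere_unif borel (\<lambda>x. x \<bullet> e)) A" .
qed simp

text \<open>The law of the inner product of two independent uniform points of the unit sphere of \<open>\<real>\<^sup>d\<close>.\<close>

locale sphere_inner_law = prob_space \<nu> for \<nu> :: "real measure" +
  fixes d :: nat
  assumes sets_law [simp, measurable_cong]: "sets \<nu> = sets borel"
    and dim: "d \<ge> 2"
    and AE_le_1: "AE t in \<nu>. \<bar>t\<bar> \<le> 1"
    and law_uminus: "distr \<nu> borel uminus = \<nu>"
    and even_moment: "(\<integral>t. t ^ (2 * n) \<partial>\<nu>) = pochhammer (1 / 2) n / pochhammer (real d / 2) n"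

lemma sphere_inner_law:
  assumes "DIM('a::euclidean_space) \<ge> 2"
  shows "sphere_inner_law
    (distr (sphere_unif \<Otimes>\<^sub>M (sphere_unif :: 'a measure)) borel (\<lambda>(x, y). x \<bullet> y)) DIM('a)"
proof -
  obtain e :: 'a where e: "e \<in> Basis" using nonempty_Basis by blast
  then have n: "norm e = 1" by simp
  interpret prob_space "sphere_unif :: 'a measure" by (rule prob_space_sphere_uniform)
  let ?D = "distr sphere_unif borel (\<lambda>x. x \<bullet> e)"
  interpret D: prob_space ?D by (rule prob_space_distr) simp
  have "sphere_inner_law ?D DIM('a)"
  proof unfold_locales
    have "AE x in sphere_unif. \<bar>x \<bullet> e\<bar> \<le> 1"
      using AE_sphere_unif_norm
    proof eventually_elim
      case (elim x)
      then show ?case using n Cauchy_Schwarz_ineq2[of x e] by simp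
    qed
    then show "AE t in ?D. \<bar>t\<bar> \<le> 1"
      by (subst AE_distr_iff) auto
    have "distr ?D borel uminus = distr sphere_unif borel (\<lambda>x. x \<bullet> (- e))"
      by (subst distr_distr) (auto simp: o_def)
    also have "\<dots> = ?D"
      by (rule distr_sphere_unif_inner_cong) simp
    finally show "distr ?D borel uminus = ?D" .
    show "(\<integral>t. t ^ (2 * n) \<partial>?D) = pochhammer (1 / 2) n / pochhammer (real DIM('a) / 2) n" for n
      by (simp add: integral_distr sphere_unif_moment[OF n])
  qed (use assms in auto)
  then show ?thesis
    by (simp add: distr_sphere_unif_pair_inner[OF n])
qed

section \<open>Power and logarithmic moments of the chord length\<close>

text \<open>Raabe's test: n times the quotient of consecutive terms minus one tends to c + 1 - a - b
  > 1. The conditions on \<open>a\<close> and \<open>b\<close> keep all terms nonzero, so that these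
  quotients make sense.\<close>

lemma summable_abs_hypergeom_2F1_one:
  fixes a b c :: real
  assumes c: "c > 0" "c - a - b > 0" and nz: "\<And>n. a + real n \<noteq> 0" "\<And>n. b + real n \<noteq> 0"
  shows "summable (\<lambda>n. \<bar>pochhammer a n * pochhammer b n / (pochhammer c n * fact n)\<bar>)"
    (is "summable (\<lambda>n. \<bar>?t n\<bar>)")
proof (rule raabes_test_convergence)
  have cpos: "pochhammer c n > 0" for n using c(1) by (rule pochhammer_pos)
  have pnz: "pochhammer a n \<noteq> 0" "pochhammer b n \<noteq> 0" for n
    using nz by (auto simp: pochhammer_eq_0_iff) (metis add.commute add.right_inverse)+
  have tnz: "?t n \<noteq> 0" for n
    using pnz[of n] cpos[of n] by simp
  then show "\<forall>\<^sub>F n in sequentially. 0 < \<bar>?t n\<bar>" by simp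
  have "(\<lambda>n. real n * ((c + real n) * (real n + 1) / ((a + real n) * (b + real n)) - 1))
      \<longlonglongrightarrow> c + 1 - a - b"
    by real_asymp
  then have lim: "(\<lambda>n. ereal (real n * ((c + real n) * (real n + 1) / ((a + real n) * (b + real n)) - 1)))
      \<longlonglongrightarrow> ereal (c + 1 - a - b)"
    by simp
  have ev: "\<forall>\<^sub>F n in sequentially. a + real n > 0 \<and> b + real n > 0"
    by (intro eventually_conj) real_asymp+
  have "\<forall>\<^sub>F n in sequentially.
      ereal (real n * ((c + real n) * (real n + 1) / ((a + real n) * (b + real n)) - 1)) =
      ereal (real n * (\<bar>?t n\<bar> / \<bar>?t (Suc n)\<bar> - 1))"
    using ev
  proof eventually_elim
    case (elim n)
    have "?t (Suc n) = ?t n * ((a + real n) * (b + real n) / ((c + real n) * (real n + 1)))"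
      by (simp add: pochhammer_Suc mult_ac add.commute)
    then have "\<bar>?t (Suc n)\<bar> = \<bar>?t n\<bar> * ((a + real n) * (b + real n) / ((c + real n) * (real n + 1)))"
      using elim c(1) by (simp only: abs_mult) simp
    then have "\<bar>?t n\<bar> / \<bar>?t (Suc n)\<bar> = (c + real n) * (real n + 1) / ((a + real n) * (b + real n))"
      using tnz[of n] by (simp only: nonzero_divide_mult_cancel_left abs_eq_0) simp
    then show ?case by simp
  qed
  from Lim_transform_eventually[OF lim this]
  have "(\<lambda>n. ereal (real n * (\<bar>?t n\<bar> / \<bar>?t (Suc n)\<bar> - 1))) \<longlonglongrightarrow> ereal (c + 1 - a - b)" .
  then have "liminf (\<lambda>n. ereal (real n * (\<bar>?t n\<bar> / \<bar>?t (Suc n)\<bar> - 1))) = ereal (c + 1 - a - b)"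
    by (rule lim_imp_Liminf[rotated]) simp
  then show "1 < liminf (\<lambda>n. ereal (real n * (\<bar>?t n\<bar> / \<bar>?t (Suc n)\<bar> - 1)))"
    using c by simp
qed

text \<open>Averaging the binomial series at x and - x cancels the odd powers, leaving those whose
  moments are known.\<close>

lemma binomial_series_even_part:
  fixes a x :: real
  assumes "\<bar>x\<bar> < 1"
  shows "(\<lambda>n. pochhammer a (2 * n) / fact (2 * n) * x ^ (2 * n)) sums
    (((1 - x) powr - a + (1 + x) powr - a) / 2)"
proof -
  have co: "(- a gchoose k) * y ^ k = pochhammer a k / fact k * (- y) ^ k" for k and y :: real
    by (simp add: gbinomial_pochhammer power_minus[of y] mult_ac)
  have "(\<lambda>k. (((- a gchoose k) * (- x) ^ k) + ((- a gchoose k) * x ^ k)) / 2) sums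
      (((1 - x) powr - a + (1 + x) powr - a) / 2)"
    using gen_binomial_real[of "- x" "- a"] gen_binomial_real[of x "- a"] assms
    by (intro sums_divide sums_add) auto
  then have "(\<lambda>k. pochhammer a k / fact k * ((x ^ k + (- x) ^ k) / 2)) sums
      (((1 - x) powr - a + (1 + x) powr - a) / 2)"
    unfolding co by (simp add: algebra_simps add_divide_distrib)
  moreover have "pochhammer a k / fact k * ((x ^ k + (- x) ^ k) / 2) = 0"
    if "k \<notin> range ((*) (2 :: nat))" for k
  proof -
    have "odd k" using that by (auto elim!: evenE)
    then show ?thesis by simp
  qed
  ultimately have "(\<lambda>n. pochhammer a (2 * n) / fact (2 * n) * ((x ^ (2 * n) + (- x) ^ (2 * n)) / 2)) sums
      (((1 - x) powr - a + (1 + x) powr - a) / 2)"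
    by (subst sums_mono_reindex[where g = "(*) 2"]) (auto simp: strict_mono_def)
  then show ?thesis by simp
qed

text \<open>The quotient is the central binomial coefficient divided by 4 ^ n. Squaring avoids roots
  and reduces the induction to (2 n + 1) (2 n + 3) \<le> (2 n + 2)^2.\<close>

lemma pochhammer_half_le:
  "(pochhammer (1 / 2) n / fact n :: real)\<^sup>2 \<le> 1 / (2 * real n + 1)"
proof (induction n)
  case (Suc n)
  define r where "r = (pochhammer (1 / 2) n / fact n :: real)"
  have "pochhammer (1 / 2) (Suc n) / fact (Suc n) = r * ((2 * real n + 1) / (2 * real n + 2))"
    by (simp add: r_def pochhammer_Suc divide_simps) (simp add: algebra_simps)
  then have "(pochhammer (1 / 2) (Suc n) / fact (Suc n) :: real)\<^sup>2 =
      r\<^sup>2 * ((2 * real n + 1) / (2 * real n + 2))\<^sup>2"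
    by (simp only: power_mult_distrib)
  also have "\<dots> \<le> 1 / (2 * real n + 1) * ((2 * real n + 1) / (2 * real n + 2))\<^sup>2"
    using Suc.IH unfolding r_def by (rule mult_right_mono) simp
  also have "\<dots> = (2 * real n + 1) / (2 * real n + 2)\<^sup>2"
    by (simp add: power2_eq_square)
  also have "\<dots> \<le> 1 / (2 * real (Suc n) + 1)"
  proof -
    have "(2 * real n + 1) * (2 * real (Suc n) + 1) \<le> (2 * real n + 2)\<^sup>2"
      by (simp add: power2_eq_square algebra_simps)
    then show ?thesis by (simp add: divide_simps mult.commute)
  qed
  finally show ?case .
qed simp

section \<open>Powers of 1 - T as hypergeometric values\<close>

context sphere_inner_law
begin

lemma space_law [simp]: "space \<nu> = UNIV"
  using sets_law sets_eq_imp_space_eq by fastforce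

lemma integrable_law_bounded:
  assumes "h \<in> borel_measurable borel" "\<And>t. \<bar>t\<bar> \<le> 1 \<Longrightarrow> \<bar>h t\<bar> \<le> (B::real)"
  shows "integrable \<nu> h"
proof (rule integrable_const_bound)
  show "AE t in \<nu>. norm (h t) \<le> B"
    using AE_le_1 by eventually_elim (simp add: assms(2))
qed (use assms(1) in simp)

text \<open>The probability of |t| \<ge> 1 is at most every even moment. As d / 2 \<ge> 1, these are
  bounded by (1/2)_n / n!, which tends to 0. This excludes the end points, where the binomial series
  may diverge and the kernel may be singular.\<close>

lemma AE_less_1: "AE t in \<nu>. \<bar>t\<bar> < 1"
proof -
  define p where "p = measure \<nu> {t. 1 \<le> \<bar>t\<bar>}"
  have "p\<^sup>2 \<le> 1 / (2 * real n + 1)" for n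
  proof -
    have "pochhammer 1 n \<le> pochhammer (real d / 2) n"
      unfolding pochhammer_prod using dim by (intro prod_mono) auto
    then have le: "fact n \<le> pochhammer (real d / 2) n"
      by (simp add: pochhammer_fact)
    have half: "pochhammer (1 / 2 :: real) n > 0" by (intro pochhammer_pos) simp
    have "p = (\<integral>t. indicator {t. 1 \<le> \<bar>t\<bar>} t \<partial>\<nu>)"
      by (simp add: p_def)
    also have "\<dots> \<le> (\<integral>t. t ^ (2 * n) \<partial>\<nu>)"
    proof (rule integral_mono)
      show "integrable \<nu> (\<lambda>t. t ^ (2 * n))"
        by (rule integrable_law_bounded[where B = 1]) (auto simp: power_abs power_le_one)
      fix t :: real
      have "1 \<le> \<bar>t\<bar> \<Longrightarrow> 1 \<le> \<bar>t\<bar> ^ (2 * n)" by (rule one_le_power)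
      then show "indicator {t. 1 \<le> \<bar>t\<bar>} t \<le> t ^ (2 * n)"
        by (auto simp: indicator_def power_even_abs)
    qed (auto intro!: integrable_const_bound[where B = 1])
    also have "\<dots> \<le> pochhammer (1 / 2) n / fact n"
      unfolding even_moment using le half
      by (intro divide_left_mono mult_pos_pos) (auto intro: less_le_trans[OF _ le])
    finally have "p \<le> pochhammer (1 / 2) n / fact n" .
    then have "p\<^sup>2 \<le> (pochhammer (1 / 2) n / fact n)\<^sup>2"
      by (rule power_mono) (simp add: p_def)
    then show ?thesis using pochhammer_half_le[of n] by linarith
  qed
  moreover have "(\<lambda>n. 1 / (2 * real n + 1)) \<longlonglongrightarrow> 0" by real_asymp
  ultimately have "p\<^sup>2 \<le> 0"
    by (intro LIMSEQ_le_const) auto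
  then have "emeasure \<nu> {t. 1 \<le> \<bar>t\<bar>} = 0"
    by (simp add: p_def emeasure_eq_measure)
  then have "{t. 1 \<le> \<bar>t\<bar>} \<in> null_sets \<nu>" by (simp add: null_sets_def)
  from AE_not_in[OF this] show ?thesis by eventually_elim auto
qed

lemma integral_law_uminus:
  fixes h :: "real \<Rightarrow> real"
  assumes [measurable]: "h \<in> borel_measurable borel"
  shows "(\<integral>t. h (- t) \<partial>\<nu>) = (\<integral>t. h t \<partial>\<nu>)"
proof -
  have "(\<integral>t. h t \<partial>\<nu>) = (\<integral>t. h t \<partial>distr \<nu> borel uminus)"
    by (simp add: law_uminus)
  also have "\<dots> = (\<integral>t. h (- t) \<partial>\<nu>)"
    by (rule integral_distr) auto
  finally show ?thesis ..
qed

lemma expectation_law: "(\<integral>t. t \<partial>\<nu>) = 0"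
  using integral_law_uminus[of "\<lambda>t. t"] by simp

text \<open>
  Since \<open>t\<close> and \<open>- t\<close> have the same law, only the even terms of the binomial
  series contribute, and their expectations form a hypergeometric series at 1.
\<close>

lemma one_minus_powr_law:
  fixes a :: real
  assumes a: "- 1 < a" "a \<noteq> 0" "a < (real d - 1) / 2"
  shows "integrable \<nu> (\<lambda>t. (1 - t) powr - a)"
    and "(\<integral>t. (1 - t) powr - a \<partial>\<nu>) = hypergeom_2F1 (a / 2) ((a + 1) / 2) (real d / 2) 1"
proof -
  define k where "k n = pochhammer a (2 * n) / fact (2 * n)" for n
  define h where "h t = ((1 - t) powr - a + (1 + t) powr - a) / 2" for t
  define u where "u n = pochhammer (a / 2) n * pochhammer ((a + 1) / 2) n /
    (pochhammer (real d / 2) n * fact n)" for n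
  \<comment> \<open>Both \<open>pochhammer a (2 * n)\<close> and \<open>fact (2 * n)\<close> split
    by duplication; the factor (1/2)_n of the latter cancels against the numerator of the
    moment.\<close>
  have ku: "k n * (pochhammer (1 / 2) n / pochhammer (real d / 2) n) = u n" for n
  proof -
    have "pochhammer a (2 * n) = 2 ^ (2 * n) * pochhammer (a / 2) n * pochhammer ((a + 1) / 2) n"
      using pochhammer_double[of "a / 2" n] by (simp add: add_divide_distrib)
    moreover have "pochhammer (1 / 2 :: real) n > 0" "pochhammer (real d / 2) n > 0"
      using dim by (auto intro!: pochhammer_pos)
    ultimately show ?thesis
      by (simp add: k_def u_def fact_double)
  qed
  have sums: "(\<lambda>n. k n * x ^ (2 * n)) sums h x" if "\<bar>x\<bar> < 1" for x
    using binomial_series_even_part[OF that, of a] by (simp add: k_def h_def)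
  have abs_summable: "summable (\<lambda>n. norm (k n * x ^ (2 * n)))" if "\<bar>x\<bar> < 1" for x
  proof -
    \<comment> \<open>Convergence at this radius between |x| and 1 gives absolute convergence at
      x.\<close>
    define y where "y = (1 + \<bar>x\<bar>) / 2"
    have y: "\<bar>x\<bar> < y" "\<bar>y\<bar> < 1" using that by (auto simp: y_def)
    have "x\<^sup>2 < y\<^sup>2" using y(1) by (intro power2_strict_mono) linarith
    moreover have "summable (\<lambda>n. k n * (y\<^sup>2) ^ n)"
      using sums[OF y(2)] by (auto simp: sums_iff power_mult)
    ultimately have "summable (\<lambda>n. norm (k n * (x\<^sup>2) ^ n))"
      by (intro powser_insidea) auto
    then show ?thesis by (simp add: power_mult)
  qed
  have "summable (\<lambda>n. \<bar>u n\<bar>)"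
    unfolding u_def
  proof (rule summable_abs_hypergeom_2F1_one)
    show "a / 2 + real n \<noteq> 0" for n using a by (cases n) auto
    show "(a + 1) / 2 + real n \<noteq> 0" for n
      using a(1) add_pos_nonneg[of "(a + 1) / 2" "real n"] by auto
  qed (use a dim in \<open>auto simp: field_simps\<close>)
  have int: "integrable \<nu> (\<lambda>t. k n * t ^ (2 * n))" for n
    by (intro integrable_mult_right integrable_law_bounded[where B = 1])
      (auto simp: power_abs power_le_one)
  have "(\<integral>t. norm (k n * t ^ (2 * n)) \<partial>\<nu>) = \<bar>k n\<bar> * (\<integral>t. t ^ (2 * n) \<partial>\<nu>)" for n
    by (simp add: abs_mult)
  also have "\<dots> n = \<bar>u n\<bar>" for n
  proof -
    have "pochhammer (1 / 2 :: real) n > 0" "pochhammer (real d / 2) n > 0"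
      using dim by (auto intro!: pochhammer_pos)
    then show ?thesis
      unfolding even_moment ku[symmetric] abs_mult by simp
  qed
  finally have sm: "summable (\<lambda>n. \<integral>t. norm (k n * t ^ (2 * n)) \<partial>\<nu>)"
    using \<open>summable (\<lambda>n. \<bar>u n\<bar>)\<close> by simp
  have AE_sm: "AE t in \<nu>. summable (\<lambda>n. norm (k n * t ^ (2 * n)))"
    using AE_less_1 by eventually_elim (rule abs_summable)
  have S: "integrable \<nu> (\<lambda>t. \<Sum>n. k n * t ^ (2 * n))"
      "(\<integral>t. (\<Sum>n. k n * t ^ (2 * n)) \<partial>\<nu>) = (\<Sum>n. \<integral>t. k n * t ^ (2 * n) \<partial>\<nu>)"
    by (rule integrable_suminf[OF int AE_sm sm] integral_suminf[OF int AE_sm sm])+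
  have hS: "AE t in \<nu>. (\<Sum>n. k n * t ^ (2 * n)) = h t"
    using AE_less_1 by eventually_elim (use sums in \<open>auto simp: sums_iff\<close>)
  have [measurable]: "h \<in> borel_measurable borel" unfolding h_def by measurable
  have hint: "integrable \<nu> h"
    using integrable_cong_AE_imp[OF S(1) _ hS] by simp
  \<comment> \<open>Both powers are nonnegative, so each is at most 2 h.\<close>
  have minus: "integrable \<nu> (\<lambda>t. (1 - t) powr - a)" "integrable \<nu> (\<lambda>t. (1 + t) powr - a)"
    by (rule Bochner_Integration.integrable_bound[OF integrable_mult_right[OF hint, of 2]];
      simp add: h_def)+
  then show "integrable \<nu> (\<lambda>t. (1 - t) powr - a)" by simp
  have "(\<integral>t. (1 - t) powr - a \<partial>\<nu>) = (\<integral>t. h t \<partial>\<nu>)"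
    using minus integral_law_uminus[of "\<lambda>t. (1 - t) powr - a"] by (simp add: h_def)
  also have "\<dots> = (\<integral>t. (\<Sum>n. k n * t ^ (2 * n)) \<partial>\<nu>)"
    using hS by (intro integral_cong_AE) auto
  also have "\<dots> = (\<Sum>n. u n)"
    by (simp only: S(2) integral_mult_right_zero even_moment ku)
  finally show "(\<integral>t. (1 - t) powr - a \<partial>\<nu>) = hypergeom_2F1 (a / 2) ((a + 1) / 2) (real d / 2) 1"
    by (simp add: hypergeom_2F1_def u_def)
qed

end

section \<open>Gamma-function forms of the constants\<close>

lemma not_nonpos_Int_pos: "(x::real) > 0 \<Longrightarrow> x \<notin> \<int>\<^sub>\<le>\<^sub>0"
  by (auto elim!: nonpos_Ints_cases)

lemma Gamma_legendre_duplication_real: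
  fixes z :: real
  assumes z: "z > 0"
  shows "Gamma z * Gamma (z + 1 / 2) = 2 powr (1 - 2 * z) * sqrt pi * Gamma (2 * z)"
proof -
  have half: "complex_of_real z + 1 / 2 = complex_of_real (z + 1 / 2)" by simp
  have two: "2 * complex_of_real z = complex_of_real (2 * z)" by simp
  have n: "complex_of_real z \<notin> \<int>\<^sub>\<le>\<^sub>0" "complex_of_real z + 1 / 2 \<notin> \<int>\<^sub>\<le>\<^sub>0"
    unfolding half of_real_in_nonpos_Ints_iff using z by (auto simp: not_nonpos_Int_pos)
  have e: "exp ((1 - complex_of_real (2 * z)) * of_real (ln 2)) = of_real (2 powr (1 - 2 * z))"
  proof -
    have "(1 - complex_of_real (2 * z)) * of_real (ln 2) = of_real ((1 - 2 * z) * ln 2)" by simp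
    then show ?thesis by (simp only: exp_of_real) (simp add: powr_def)
  qed
  have "complex_of_real (Gamma z * Gamma (z + 1 / 2)) =
      complex_of_real (2 powr (1 - 2 * z) * sqrt pi * Gamma (2 * z))"
    using Gamma_legendre_duplication[OF n] 
    unfolding half two e Gamma_complex_of_real by simp
  then show ?thesis by (simp only: of_real_eq_iff)
qed

text \<open>The form in which two Gauss evaluations meet, that of \<open>c_const\<close> and that of
  the chord moment, after one use of Legendre duplication for each.\<close>

definition c_closed :: "nat \<Rightarrow> real \<Rightarrow> real" where
  "c_closed d q = 2 powr (real d - 2 - q) * Gamma (real d / 2) * Gamma ((real d - q - 1) / 2) /
     (sqrt pi * Gamma (real d - 1 - q / 2))"

lemma c_const_eq_c_closed:
  assumes "d \<ge> 2" "- 2 < q" "q < real d - 1"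
  shows "c_const q d = c_closed d q"
proof -
  define P Q where "P = 2 powr (real d - 2 - q)" and "Q = 2 powr (1 - (real d - q - 1))"
  have z: "(real d - q - 1) / 2 > 0" "2 * ((real d - q - 1) / 2) = real d - q - 1"
    "(real d - q - 1) / 2 + 1 / 2 = (real d - q) / 2"
    using assms by (simp_all add: field_simps)
  have G: "Gamma ((real d - q - 1) / 2) * Gamma ((real d - q) / 2) = Q * sqrt pi * Gamma (real d - q - 1)"
    using Gamma_legendre_duplication_real[OF z(1)] unfolding z(2,3) Q_def .
  have "P * Q = 2 powr (real d - 2 - q + (1 - (real d - q - 1)))"
    unfolding P_def Q_def by (rule powr_add[symmetric])
  then have PQ: "P * Q = 1" by simp
  have "P * (Gamma ((real d - q - 1) / 2) * Gamma ((real d - q) / 2)) =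
      (P * Q) * (Gamma (real d - q - 1) * sqrt pi)"
    unfolding G by (simp only: mult_ac)
  then have "Gamma (real d - q - 1) * sqrt pi =
      P * (Gamma ((real d - q - 1) / 2) * Gamma ((real d - q) / 2))"
    unfolding PQ by simp
  moreover have "Gamma ((real d - q) / 2) > 0" "Gamma (real d - 1 - q / 2) > 0"
    using assms by (auto intro!: Gamma_real_pos)
  moreover have "A * X / (B * C) = P * A * E / (S * C)"
    if "X * S = P * (E * B)" "B > 0" "C > 0" "S > 0" for A X B C E S :: real
  proof -
    have "A * X * (S * C) = P * A * E * (B * C)"
      using arg_cong[OF that(1), of "\<lambda>x. x * A * C"] by (simp add: mult_ac)
    then show ?thesis using that by (simp add: frac_eq_eq)
  qed
  ultimately have "Gamma (real d / 2) * Gamma (real d - q - 1) /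
      (Gamma ((real d - q) / 2) * Gamma (real d - 1 - q / 2)) = c_closed d q"
    unfolding c_closed_def P_def[symmetric] by simp
  moreover have "real d - q / 2 - 1 = real d - 1 - q / 2" by simp
  ultimately show ?thesis
    using assms by (simp only: c_const_Gamma)
qed

text \<open>The left side is the moment of 2 - 2 T of order - q / 2, that is, the value of
  \<open>one_minus_powr_law\<close> at a = q / 2 with the power of 2 restored.\<close>

lemma c_closed_eq_hypergeom:
  assumes "d \<ge> 2" "- 2 < q" "q < real d - 1"
  shows "2 powr (- (q / 2)) * hypergeom_2F1 (q / 2 / 2) ((q / 2 + 1) / 2) (real d / 2) 1 = c_closed d q"
proof -
  define z where "z = (real d - 1 - q / 2) / 2"
  have z: "z > 0" using assms by (auto simp: z_def)
  have "hypergeom_2F1 (q / 2 / 2) ((q / 2 + 1) / 2) (real d / 2) 1 =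
      Gamma (real d / 2) * Gamma (real d / 2 - q / 2 / 2 - (q / 2 + 1) / 2) *
      rGamma (real d / 2 - q / 2 / 2) * rGamma (real d / 2 - (q / 2 + 1) / 2)"
    by (rule Gauss_hypergeometric) (use assms in \<open>auto simp: field_simps\<close>)
  also have "real d / 2 - q / 2 / 2 - (q / 2 + 1) / 2 = (real d - q - 1) / 2"
    by (simp add: field_simps)
  also have "real d / 2 - q / 2 / 2 = z + 1 / 2"
    by (simp add: field_simps z_def)
  also have "real d / 2 - (q / 2 + 1) / 2 = z"
    by (simp add: field_simps z_def)
  also have "Gamma (real d / 2) * Gamma ((real d - q - 1) / 2) * rGamma (z + 1 / 2) * rGamma z =
      Gamma (real d / 2) * Gamma ((real d - q - 1) / 2) / (Gamma z * Gamma (z + 1 / 2))"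
    unfolding rGamma_inverse_Gamma divide_inverse inverse_mult_distrib by (simp only: mult_ac)
  also have "Gamma z * Gamma (z + 1 / 2) = 2 powr (1 - 2 * z) * sqrt pi * Gamma (2 * z)"
    by (rule Gamma_legendre_duplication_real[OF z])
  finally have h: "hypergeom_2F1 (q / 2 / 2) ((q / 2 + 1) / 2) (real d / 2) 1 =
    Gamma (real d / 2) * Gamma ((real d - q - 1) / 2) / (2 powr (1 - 2 * z) * sqrt pi * Gamma (2 * z))" .
  have p: "2 powr (- (q / 2)) = 2 powr (real d - 2 - q) * 2 powr (1 - 2 * z)"
  proof -
    have "- (q / 2) = real d - 2 - q + (1 - 2 * z)" by (simp add: z_def field_simps)
    then show ?thesis by (simp only: powr_add)
  qed
  have z2: "2 * z = real d - 1 - q / 2" by (simp add: z_def)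
  have "P * Q * (A / (Q * S * G)) = P * A / (S * G)" if "Q \<noteq> 0" for P Q A S G :: real
    using that by simp
  moreover have "2 powr (1 - 2 * z) \<noteq> (0::real)" by simp
  ultimately show ?thesis
    unfolding h p c_closed_def mult.assoc[of _ "Gamma (real d / 2)"] z2[symmetric] by blast
qed

lemma c_const_pos:
  assumes "d \<ge> 2" "- 2 < q" "q < real d - 1"
  shows "c_const q d > 0"
  unfolding c_const_eq_c_closed[OF assms] c_closed_def
  using assms by (intro divide_pos_pos mult_pos_pos Gamma_real_pos) auto

text \<open>Raising the exponent by 2 lowers two Gamma arguments by 1, to x and y, and divides the
  power of 2 by 4. The functional equation turns this into the factor 4 x / y between the
  constants.\<close>

lemma c_const_add_2:
  assumes "d \<ge> 2" "- 2 < s" "s < real d - 3"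
  shows "c_const (s + 2) d * (4 * (real d - s - 3)) = c_const s d * (2 * real d - s - 4)"
proof -
  define x y where "x = (real d - s - 3) / 2" and "y = real d - 2 - s / 2"
  have xy: "x > 0" "y > 0" using assms by (auto simp: x_def y_def)
  have G: "Gamma (x + 1) = x * Gamma x" "Gamma (y + 1) = y * Gamma y"
    using xy by (auto intro!: Gamma_plus1 not_nonpos_Int_pos)
  have "Gamma y > 0" using xy by (intro Gamma_real_pos)
  have eq: "(real d - s - 1) / 2 = x + 1" "real d - 1 - s / 2 = y + 1"
    "(real d - (s + 2) - 1) / 2 = x" "real d - 1 - (s + 2) / 2 = y"
    by (auto simp: x_def y_def field_simps)
  have p: "2 powr (real d - 2 - s) = 4 * 2 powr (real d - 2 - (s + 2))"
  proof -
    have "real d - 2 - s = 2 + (real d - 2 - (s + 2))" by simp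
    then show ?thesis by (simp only: powr_add) simp
  qed
  have c: "c_const (s + 2) d = c_closed d (s + 2)" "c_const s d = c_closed d s"
    by (rule c_const_eq_c_closed; use assms in simp)+
  have "4 * (real d - s - 3) = 8 * x" "2 * real d - s - 4 = 2 * y"
    by (auto simp: x_def y_def)
  then show ?thesis
    unfolding c c_closed_def eq G p using xy \<open>Gamma y > 0\<close> by (simp add: divide_simps)
qed

lemma c_const_0: "c_const 0 d = 1"
proof -
  have "c_const 0 d = (\<Sum>n. if n = 0 then 1 else 0)"
    unfolding c_const_def hypergeom_2F1_def
    by (intro arg_cong[where f = suminf]) (auto simp: fun_eq_iff pochhammer_0_left)
  also have "\<dots> = 1" using suminf_finite[of "{0::nat}" "\<lambda>n. if n = 0 then 1 else 0 :: real"] by simp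
  finally show ?thesis .
qed

text \<open>The value at 0 is 1, so the derivative is the logarithmic one: the power of 2
  contributes - ln 2, and the Gamma factors depending on q contribute the two Digamma terms with
  weight 1/2, the denominator with positive sign.\<close>

lemma c_const_has_derivative_b_const:
  assumes d: "d \<ge> 2"
  shows "((\<lambda>q. c_const q d) has_real_derivative b_const d) (at 0)"
proof -
  have pos: "real d - 1 > 0" using d by simp
  have G: "Gamma (real d / 2) > 0" "Gamma ((real d - 1) / 2) > 0" "Gamma (real d - 1) > 0"
    using d by (auto intro!: Gamma_real_pos)
  have n: "real d - 1 \<notin> \<int>\<^sub>\<le>\<^sub>0" "(real d - 1) / 2 \<notin> \<int>\<^sub>\<le>\<^sub>0"
    using pos by (intro not_nonpos_Int_pos; simp)+
  have c0: "c_closed d 0 = 1"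
    using c_const_eq_c_closed[OF d, of 0] c_const_0[of d] pos by simp
  define K where "K = Gamma (real d / 2) / sqrt pi"
  have cK: "c_closed d q = K * (2 powr (real d - 2 - q) * Gamma ((real d - q - 1) / 2) /
      Gamma (real d - 1 - q / 2))" for q
    by (simp add: c_closed_def K_def)
  define P A B where "P q = 2 powr (real d - 2 - q)" and "A q = Gamma ((real d - q - 1) / 2)"
    and "B q = Gamma (real d - 1 - q / 2)" for q
  have P: "(P has_real_derivative P 0 * - ln 2) (at 0)"
    unfolding P_def by (auto intro!: derivative_eq_intros)
  have A: "(A has_real_derivative A 0 * Digamma ((real d - 1) / 2) * (- 1 / 2)) (at 0)"
    unfolding A_def by (rule DERIV_chain2[where f = Gamma, OF has_field_derivative_Gamma,
      THEN DERIV_cong]) (use n in \<open>auto intro!: derivative_eq_intros\<close>)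
  have B: "(B has_real_derivative B 0 * Digamma (real d - 1) * (- 1 / 2)) (at 0)"
    unfolding B_def by (rule DERIV_chain2[where f = Gamma, OF has_field_derivative_Gamma,
      THEN DERIV_cong]) (use n in \<open>auto intro!: derivative_eq_intros\<close>)
  have B0: "B 0 > 0" using G by (simp add: B_def)
  have c: "c_closed d = (\<lambda>q. K * (P q * A q / B q))"
    by (simp add: cK P_def A_def B_def fun_eq_iff)
  have "(c_closed d has_real_derivative c_closed d 0 * b_const d) (at 0)"
    unfolding c
    by (rule DERIV_cong[OF DERIV_cmult[OF DERIV_divide[OF DERIV_mult[OF P A] B]]])
      (use B0 in \<open>simp_all add: b_const_def divide_simps, simp add: algebra_simps\<close>)
  then have "(c_closed d has_real_derivative b_const d) (at 0)"
    by (simp add: c0)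
  then show ?thesis
  proof (rule has_field_derivative_transform_within_open)
    show "open {- 2<..<real d - 1}" by simp
    show "(0::real) \<in> {- 2<..<real d - 1}" using pos by simp
    show "c_closed d q = c_const q d" if "q \<in> {- 2<..<real d - 1}" for q
      using that d by (simp add: c_const_eq_c_closed)
  qed
qed

section \<open>Moments of the squared chord 2 - 2 T\<close>

context sphere_inner_law
begin

lemma chord_powr_law:
  assumes q: "- 2 < q" "q \<noteq> 0" "q < real d - 1"
  shows "integrable \<nu> (\<lambda>t. (2 - 2 * t) powr (- q / 2))"
    and "(\<integral>t. (2 - 2 * t) powr (- q / 2) \<partial>\<nu>) = c_const q d"
proof -
  have eq: "AE t in \<nu>. (2 - 2 * t) powr (- q / 2) = 2 powr (- (q / 2)) * (1 - t) powr - (q / 2)"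
    using AE_less_1
  proof eventually_elim
    case (elim t)
    have "(2 * (1 - t)) powr (- (q / 2)) = 2 powr (- (q / 2)) * (1 - t) powr - (q / 2)"
      using elim by (intro powr_mult)
    then show ?case by (simp add: algebra_simps)
  qed
  have a: "- 1 < q / 2" "q / 2 \<noteq> 0" "q / 2 < (real d - 1) / 2" using q by auto
  note * = one_minus_powr_law[OF a]
  have "integrable \<nu> (\<lambda>t. 2 powr (- (q / 2)) * (1 - t) powr - (q / 2))"
    using *(1) by simp
  then show "integrable \<nu> (\<lambda>t. (2 - 2 * t) powr (- q / 2))"
    by (rule integrable_cong_AE[THEN iffD2, OF _ _ eq, rotated 2]) simp_all
  have "(\<integral>t. (2 - 2 * t) powr (- q / 2) \<partial>\<nu>) = (\<integral>t. 2 powr (- (q / 2)) * (1 - t) powr - (q / 2) \<partial>\<nu>)"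
    by (rule integral_cong_AE[OF _ _ eq]) simp_all
  also have "\<dots> = c_const q d"
    using *(2) c_closed_eq_hypergeom[OF dim q(1,3)] c_const_eq_c_closed[OF dim q(1,3)] by simp
  finally show "(\<integral>t. (2 - 2 * t) powr (- q / 2) \<partial>\<nu>) = c_const q d" .
qed

text \<open>
  With \<open>Y = - ln (2 - 2 * t) / 2\<close>, \<open>1 + q Y \<le> exp (q Y)\<close> bounds \<open>E Y\<close> by
  difference quotients at 0 of \<open>q \<mapsto> c_const q d\<close>, from above for \<open>q > 0\<close> and from
  below for \<open>q < 0\<close>.
\<close>

lemma chord_ln_law:
  shows "integrable \<nu> (\<lambda>t. - ln (2 - 2 * t) / 2)"
    and "(\<integral>t. - ln (2 - 2 * t) / 2 \<partial>\<nu>) = b_const d"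
proof -
  define Y where "Y t = - ln (2 - 2 * t) / 2" for t :: real
  have [measurable]: "Y \<in> borel_measurable borel" unfolding Y_def by measurable
  have le: "1 + q * Y t \<le> (2 - 2 * t) powr (- q / 2)" if "\<bar>t\<bar> < 1" for q t
  proof -
    have "(2 - 2 * t) powr (- q / 2) = exp (q * Y t)"
      using that by (simp add: Y_def powr_def)
    then show ?thesis using exp_ge_add_one_self[of "q * Y t"] by simp
  qed
  have half: "1 / 2 < real d - 1" using dim by simp
  \<comment> \<open>With q = 1/2 and q = -1/2 the inequality \<open>le\<close> bounds Y from above
    and from below by these two powers, so their doubled sum dominates |Y|.\<close>
  have "integrable \<nu> (\<lambda>t. 2 * ((2 - 2 * t) powr (- (1 / 2) / 2) + (2 - 2 * t) powr (- (- 1 / 2) / 2)))"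
    by (rule integrable_mult_right, rule Bochner_Integration.integrable_add;
      rule chord_powr_law(1)) (use half in simp_all)
  then have int: "integrable \<nu> Y"
  proof (rule Bochner_Integration.integrable_bound)
    show "AE t in \<nu>. norm (Y t) \<le> norm (2 * ((2 - 2 * t) powr (- (1 / 2) / 2) + (2 - 2 * t) powr (- (- 1 / 2) / 2)))"
      using AE_less_1
    proof eventually_elim
      case (elim t)
      have *: "\<bar>y\<bar> \<le> \<bar>2 * (A + B)\<bar>"
        if "0 \<le> A" "0 \<le> B" "1 + 1 / 2 * y \<le> A" "1 + - 1 / 2 * y \<le> B" for y A B :: real
        using that by argo
      show ?case
        unfolding real_norm_def
        by (rule *[OF _ _ le[OF elim, of "1 / 2"] le[OF elim, of "- 1 / 2"]]) simp_all
    qed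
  qed simp
  then show "integrable \<nu> (\<lambda>t. - ln (2 - 2 * t) / 2)" unfolding Y_def .
  have qle: "1 + q * (\<integral>t. Y t \<partial>\<nu>) \<le> c_const q d" if "- 2 < q" "q \<noteq> 0" "q < real d - 1" for q
  proof -
    have "1 + q * (\<integral>t. Y t \<partial>\<nu>) = (\<integral>t. 1 + q * Y t \<partial>\<nu>)"
      using int prob_space[unfolded space_law] by simp
    also have "\<dots> \<le> (\<integral>t. (2 - 2 * t) powr (- q / 2) \<partial>\<nu>)"
    proof (rule integral_mono_AE)
      show "integrable \<nu> (\<lambda>t. 1 + q * Y t)" using int by simp
      show "AE t in \<nu>. 1 + q * Y t \<le> (2 - 2 * t) powr (- q / 2)"
        using AE_less_1 by eventually_elim (rule le)
    qed (rule chord_powr_law(1)[OF that])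
    finally show ?thesis unfolding chord_powr_law(2)[OF that] .
  qed
  have D: "((\<lambda>q. (c_const q d - 1) / q) \<longlongrightarrow> b_const d) (at 0)"
    using c_const_has_derivative_b_const[OF dim]
    unfolding has_field_derivative_iff diff_zero c_const_0 .
  have "(\<integral>t. Y t \<partial>\<nu>) \<le> b_const d"
  proof (rule tendsto_lowerbound)
    show "((\<lambda>q. (c_const q d - 1) / q) \<longlongrightarrow> b_const d) (at_right 0)"
      using D by (simp add: filterlim_at_split)
    show "\<forall>\<^sub>F q in at_right 0. (\<integral>t. Y t \<partial>\<nu>) \<le> (c_const q d - 1) / q"
      unfolding eventually_at_right_field
    proof (intro exI conjI allI impI)
      fix q :: real assume "0 < q" "q < 1"
      then show "(\<integral>t. Y t \<partial>\<nu>) \<le> (c_const q d - 1) / q"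
        using qle[of q] dim by (simp add: pos_le_divide_eq mult.commute)
    qed simp
  qed simp
  moreover have "b_const d \<le> (\<integral>t. Y t \<partial>\<nu>)"
  proof (rule tendsto_upperbound)
    show "((\<lambda>q. (c_const q d - 1) / q) \<longlongrightarrow> b_const d) (at_left 0)"
      using D by (simp add: filterlim_at_split)
    show "\<forall>\<^sub>F q in at_left 0. (c_const q d - 1) / q \<le> (\<integral>t. Y t \<partial>\<nu>)"
      unfolding eventually_at_left_field
    proof (intro exI conjI allI impI)
      fix q :: real assume "- 1 < q" "q < 0"
      then show "(c_const q d - 1) / q \<le> (\<integral>t. Y t \<partial>\<nu>)"
        using qle[of q] dim by (simp add: neg_divide_le_eq mult.commute)
    qed simp
  qed simp
  ultimately show "(\<integral>t. - ln (2 - 2 * t) / 2 \<partial>\<nu>) = b_const d"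
    unfolding Y_def by (rule antisym)
qed

end

section \<open>The potential of a sphere on concentric spheres\<close>

text \<open>The kernel as a function of the squared distance.\<close>

definition riesz_sq :: "real \<Rightarrow> real \<Rightarrow> real" where
  "riesz_sq s D = (if s = 0 then - ln D / 2 else D powr (- s / 2) / s)"

text \<open>The effect on a kernel value of multiplying the squared distance by l. In every case it
  is affine in \<open>x\<close>, so it commutes with averaging over a probability measure.\<close>

definition riesz_scale :: "real \<Rightarrow> real \<Rightarrow> real \<Rightarrow> real" where
  "riesz_scale s l x = (if s = 0 then x - ln l / 2 else l powr (- s / 2) * x)"

lemma riesz_sq_measurable [measurable]: "riesz_sq s \<in> borel_measurable borel"
  unfolding riesz_sq_def[abs_def] by (cases "s = 0") simp_all

lemma riesz_sq_mult:
  assumes "l > 0" "D > 0"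
  shows "riesz_sq s (l * D) = riesz_scale s l (riesz_sq s D)"
  using assms by (simp add: riesz_sq_def riesz_scale_def ln_mult powr_mult diff_divide_distrib)

lemma riesz_kernel_eq_riesz_sq:
  assumes "x \<noteq> 0"
  shows "riesz_kernel s x = ereal (riesz_sq s ((norm x)\<^sup>2))"
proof -
  have "norm x powr 2 = (norm x)\<^sup>2" using assms by simp
  then have "((norm x)\<^sup>2) powr (- s / 2) = (norm x powr 2) powr (- s / 2)" by (simp only:)
  also have "\<dots> = norm x powr (- s)" unfolding powr_powr by simp
  finally have *: "((norm x)\<^sup>2) powr (- s / 2) = norm x powr (- s)" .
  show ?thesis
  proof (cases "s = 0")
    case True
    then show ?thesis using assms by (simp add: riesz_kernel_def riesz_sq_def ln_realpow)
  next
    case False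
    then show ?thesis
      using assms unfolding riesz_kernel_def riesz_sq_def * by (simp add: powr_minus_divide)
  qed
qed

lemma riesz_sq_has_derivative:
  assumes "D > 0"
  shows "(riesz_sq s has_real_derivative - (D powr (- s / 2 - 1)) / 2) (at D)"
proof (cases "s = 0")
  case True
  have "((\<lambda>D. - ln D / 2) has_real_derivative - (1 / D) / 2) (at D)"
    using assms by (auto intro!: derivative_eq_intros)
  then show ?thesis
    using True assms by (simp add: riesz_sq_def[abs_def] powr_minus_divide)
next
  case False
  have "((\<lambda>D. D powr (- s / 2) / s) has_real_derivative ((- s / 2) * D powr (- s / 2 - 1)) / s) (at D)"
    using assms by (intro DERIV_cdivide has_real_derivative_powr)
  then show ?thesis
    using False by (simp add: riesz_sq_def[abs_def])
qed

text \<open>For \<open>s > - 2\<close> the kernel is convex in the squared distance; this is its tangent inequality at \<open>D + e\<close>.\<close>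

lemma riesz_sq_add_le:
  assumes s: "s > - 2" and D: "D > 0" "e \<ge> 0"
  shows "riesz_sq s (D + e) \<le> riesz_sq s D - e / 2 * (D + e) powr (- s / 2 - 1)"
proof (cases "e = 0")
  case False
  with D have e: "D < D + e" by simp
  obtain z where z: "D < z" "z < D + e"
    "riesz_sq s (D + e) - riesz_sq s D = (D + e - D) * (- (z powr (- s / 2 - 1)) / 2)"
    using MVT2[OF e, of "riesz_sq s" "\<lambda>z. - (z powr (- s / 2 - 1)) / 2"] riesz_sq_has_derivative D
    by (metis less_le_trans)
  have "(D + e) powr (- s / 2 - 1) \<le> z powr (- s / 2 - 1)"
    using z D s by (intro powr_mono2') auto
  then have "e * (D + e) powr (- s / 2 - 1) \<le> e * z powr (- s / 2 - 1)"
    using D by (intro mult_left_mono)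
  then show ?thesis using z(3) by simp
qed simp

text \<open>The tangent inequality at the other end point \<open>D\<close>. It controls the gap
  between the kernel at distances r - R and r + R.\<close>

lemma riesz_sq_add_ge:
  assumes s: "s > - 2" and D: "D > 0" "e \<ge> 0"
  shows "riesz_sq s D - e / 2 * D powr (- s / 2 - 1) \<le> riesz_sq s (D + e)"
proof (cases "e = 0")
  case False
  with D have e: "D < D + e" by simp
  obtain z where z: "D < z" "z < D + e"
    "riesz_sq s (D + e) - riesz_sq s D = (D + e - D) * (- (z powr (- s / 2 - 1)) / 2)"
    using MVT2[OF e, of "riesz_sq s" "\<lambda>z. - (z powr (- s / 2 - 1)) / 2"] riesz_sq_has_derivative D
    by (metis less_le_trans)
  have "z powr (- s / 2 - 1) \<le> D powr (- s / 2 - 1)"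
    using z D s by (intro powr_mono2') auto
  then have "e * z powr (- s / 2 - 1) \<le> e * D powr (- s / 2 - 1)"
    using D by (intro mult_left_mono)
  then show ?thesis using z(3) by simp
qed simp

lemma riesz_sq_antimono:
  assumes s: "s > - 2" and D: "0 < D" "D \<le> E"
  shows "riesz_sq s E \<le> riesz_sq s D"
proof -
  have "riesz_sq s E \<le> riesz_sq s D - (E - D) / 2 * E powr (- s / 2 - 1)"
    using riesz_sq_add_le[OF s D(1), of "E - D"] D by simp
  also have "\<dots> \<le> riesz_sq s D" using D by simp
  finally show ?thesis .
qed

definition chord_sq :: "real \<Rightarrow> real \<Rightarrow> real \<Rightarrow> real" where
  "chord_sq a b t = a\<^sup>2 + b\<^sup>2 - 2 * a * b * t"

lemma chord_sq_commute: "chord_sq a b t = chord_sq b a t"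
  by (simp add: chord_sq_def)

lemma chord_sq_same: "chord_sq a a t = a\<^sup>2 * (2 - 2 * t)"
  by (simp add: chord_sq_def power2_eq_square algebra_simps)

lemma norm_diff_eq_chord_sq:
  fixes x y :: "'a::real_inner"
  assumes "norm x = 1" "norm y = 1"
  shows "(norm (a *\<^sub>R x - b *\<^sub>R y))\<^sup>2 = chord_sq a b (x \<bullet> y)"
proof -
  have n: "x \<bullet> x = 1" "y \<bullet> y = 1" using assms by (simp_all add: norm_eq_1)
  show ?thesis
    unfolding power2_norm_eq_inner inner_diff_left inner_diff_right inner_scaleR_left
      inner_scaleR_right n inner_commute[of y x] chord_sq_def
    by (simp add: power2_eq_square algebra_simps)
qed

text \<open>The squared chord is (a - b)^2 + a b (2 - 2 t). The second summand alone is a squared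
  chord of a single sphere of radius sqrt (a b), so bounds for one sphere also serve two different
  radii.\<close>

lemma chord_sq_bounds:
  assumes "a > 0" "b > 0" "\<bar>t\<bar> < 1"
  shows "0 < a * b * (2 - 2 * t)" "a * b * (2 - 2 * t) \<le> chord_sq a b t"
    "chord_sq a b t \<le> (a + b)\<^sup>2" "(a - b)\<^sup>2 \<le> chord_sq a b t"
proof -
  show p: "0 < a * b * (2 - 2 * t)" using assms by simp
  have "chord_sq a b t = (a - b)\<^sup>2 + a * b * (2 - 2 * t)"
    by (simp add: chord_sq_def power2_eq_square algebra_simps)
  then show "a * b * (2 - 2 * t) \<le> chord_sq a b t" "(a - b)\<^sup>2 \<le> chord_sq a b t"
    using p by simp_all
  have "chord_sq a b t = (a + b)\<^sup>2 - 2 * (a * b) * (1 + t)"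
    by (simp add: chord_sq_def power2_eq_square algebra_simps)
  moreover have "0 \<le> 2 * (a * b) * (1 + t)" using assms by (intro mult_nonneg_nonneg) auto
  ultimately show "chord_sq a b t \<le> (a + b)\<^sup>2" by simp
qed

lemma chord_sq_pos:
  assumes "a > 0" "b > 0" "\<bar>t\<bar> < 1"
  shows "0 < chord_sq a b t"
  using chord_sq_bounds[OF assms] by linarith

lemma chord_sq_measurable [measurable]: "chord_sq a b \<in> borel_measurable borel"
  unfolding chord_sq_def[abs_def] by measurable

text \<open>The energy of the unit sphere without field. At s = 0 the value is the limit of (c_const
  s d - 1) / s, because the power kernel has to lose its constant 1 / s before it tends to the
  logarithm.\<close>

definition riesz_self :: "real \<Rightarrow> nat \<Rightarrow> real" where
  "riesz_self s d = (if s = 0 then b_const d else c_const s d / s)"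

context sphere_inner_law
begin

definition sphere_pot :: "real \<Rightarrow> real \<Rightarrow> real \<Rightarrow> real" where
  "sphere_pot s a b = (\<integral>t. riesz_sq s (chord_sq a b t) \<partial>\<nu>)"

lemma riesz_sq_chord_law:
  assumes s: "- 2 < s" "s < real d - 1"
  shows "integrable \<nu> (\<lambda>t. riesz_sq s (2 - 2 * t))"
    and "(\<integral>t. riesz_sq s (2 - 2 * t) \<partial>\<nu>) = riesz_self s d"
proof -
  have "integrable \<nu> (\<lambda>t. riesz_sq s (2 - 2 * t)) \<and>
    (\<integral>t. riesz_sq s (2 - 2 * t) \<partial>\<nu>) = riesz_self s d"
  proof (cases "s = 0")
    case True
    then have *: "riesz_sq s (2 - 2 * t) = - ln (2 - 2 * t) / 2" "riesz_self s d = b_const d" for t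
      by (simp_all add: riesz_sq_def riesz_self_def)
    show ?thesis unfolding * using chord_ln_law by (rule conjI)
  next
    case False
    then have *: "riesz_sq s (2 - 2 * t) = (2 - 2 * t) powr (- s / 2) / s" "riesz_self s d = c_const s d / s" for t
      by (simp_all add: riesz_sq_def riesz_self_def)
    show ?thesis
      unfolding * integral_divide_zero chord_powr_law(2)[OF s(1) False s(2)]
      by (intro conjI integrable_divide_zero chord_powr_law(1)[OF s(1) False s(2)] refl)
  qed
  then show "integrable \<nu> (\<lambda>t. riesz_sq s (2 - 2 * t))"
    "(\<integral>t. riesz_sq s (2 - 2 * t) \<partial>\<nu>) = riesz_self s d" by auto
qed

lemma riesz_sq_scaled_law:
  assumes s: "- 2 < s" "s < real d - 1" and l: "l > 0"
  shows "integrable \<nu> (\<lambda>t. riesz_sq s (l * (2 - 2 * t)))"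
    and "(\<integral>t. riesz_sq s (l * (2 - 2 * t)) \<partial>\<nu>) = riesz_scale s l (riesz_self s d)"
proof -
  have eq: "AE t in \<nu>. riesz_sq s (l * (2 - 2 * t)) = riesz_scale s l (riesz_sq s (2 - 2 * t))"
    using AE_less_1 by eventually_elim (use l in \<open>auto intro!: riesz_sq_mult\<close>)
  have [measurable]: "(\<lambda>t. riesz_scale s l (riesz_sq s (2 - 2 * t))) \<in> borel_measurable borel"
    unfolding riesz_scale_def by (cases "s = 0") simp_all
  have "integrable \<nu> (\<lambda>t. riesz_scale s l (riesz_sq s (2 - 2 * t)))"
    using riesz_sq_chord_law(1)[OF s] by (cases "s = 0") (simp_all add: riesz_scale_def)
  then show "integrable \<nu> (\<lambda>t. riesz_sq s (l * (2 - 2 * t)))"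
    by (rule integrable_cong_AE[THEN iffD2, OF _ _ eq, rotated 2]) simp_all
  have "(\<integral>t. riesz_sq s (l * (2 - 2 * t)) \<partial>\<nu>) = (\<integral>t. riesz_scale s l (riesz_sq s (2 - 2 * t)) \<partial>\<nu>)"
    by (rule integral_cong_AE[OF _ _ eq]) simp_all
  also have "\<dots> = riesz_scale s l (\<integral>t. riesz_sq s (2 - 2 * t) \<partial>\<nu>)"
    using riesz_sq_chord_law(1)[OF s] prob_space[unfolded space_law]
    by (cases "s = 0") (simp_all add: riesz_scale_def)
  finally show "(\<integral>t. riesz_sq s (l * (2 - 2 * t)) \<partial>\<nu>) = riesz_scale s l (riesz_self s d)"
    by (simp add: riesz_sq_chord_law(2)[OF s])
qed

lemma integrable_riesz_sq_chord_sq: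
  assumes s: "- 2 < s" "s < real d - 1" and ab: "a > 0" "b > 0"
  shows "integrable \<nu> (\<lambda>t. riesz_sq s (chord_sq a b t))"
proof (rule Bochner_Integration.integrable_bound)
  show "integrable \<nu> (\<lambda>t. \<bar>riesz_sq s (a * b * (2 - 2 * t))\<bar> + \<bar>riesz_sq s ((a + b)\<^sup>2)\<bar>)"
    by (rule Bochner_Integration.integrable_add, rule integrable_abs, rule riesz_sq_scaled_law(1))
      (use s ab in simp_all)
  show "AE t in \<nu>. norm (riesz_sq s (chord_sq a b t)) \<le>
      norm (\<bar>riesz_sq s (a * b * (2 - 2 * t))\<bar> + \<bar>riesz_sq s ((a + b)\<^sup>2)\<bar>)"
    using AE_less_1
  proof eventually_elim
    case (elim t)
    note b = chord_sq_bounds[OF ab elim]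
    have "riesz_sq s (chord_sq a b t) \<le> riesz_sq s (a * b * (2 - 2 * t))"
      using b s by (intro riesz_sq_antimono) auto
    moreover have "riesz_sq s ((a + b)\<^sup>2) \<le> riesz_sq s (chord_sq a b t)"
      using b s chord_sq_pos[OF ab elim] by (intro riesz_sq_antimono) auto
    ultimately show ?case by simp
  qed
qed simp

lemma sphere_pot_same:
  assumes s: "- 2 < s" "s < real d - 1" and "R > 0"
  shows "sphere_pot s R R = riesz_scale s (R\<^sup>2) (riesz_self s d)"
  unfolding sphere_pot_def chord_sq_same using assms by (intro riesz_sq_scaled_law(2)) auto

text \<open>No two points of the spheres are closer than |a - b|, and the kernel decreases with
  distance.\<close>

lemma sphere_pot_le:
  assumes s: "- 2 < s" "s < real d - 1" and ab: "a > 0" "b > 0" "a \<noteq> b"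
  shows "sphere_pot s a b \<le> riesz_sq s ((a - b)\<^sup>2)"
proof -
  have "sphere_pot s a b \<le> (\<integral>t. riesz_sq s ((a - b)\<^sup>2) \<partial>\<nu>)"
    unfolding sphere_pot_def
  proof (rule integral_mono_AE)
    show "AE t in \<nu>. riesz_sq s (chord_sq a b t) \<le> riesz_sq s ((a - b)\<^sup>2)"
      using AE_less_1
      by eventually_elim (use ab s in \<open>auto intro!: riesz_sq_antimono chord_sq_bounds\<close>)
  qed (use integrable_riesz_sq_chord_sq assms in auto)
  then show ?thesis using prob_space[unfolded space_law] by simp
qed

text \<open>For s = -1 the kernel is minus the distance, and the distance is at least its component
  a - b t along the first point, whose mean is a. The bound \<open>sphere_pot_le\<close> would lose
  the constant b here.\<close>

lemma sphere_pot_minus_one_le: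
  assumes ab: "a > 0" "b > 0"
  shows "sphere_pot (- 1) a b \<le> - a"
proof -
  have id: "integrable \<nu> (\<lambda>t. t)" by (rule integrable_law_bounded[where B = 1]) auto
  have "sphere_pot (- 1) a b \<le> (\<integral>t. b * t - a \<partial>\<nu>)"
    unfolding sphere_pot_def
  proof (rule integral_mono_AE)
    show "AE t in \<nu>. riesz_sq (- 1) (chord_sq a b t) \<le> b * t - a"
      using AE_less_1
    proof eventually_elim
      case (elim t)
      have "(a - b * t)\<^sup>2 + b\<^sup>2 * (1 - t\<^sup>2) = chord_sq a b t"
        by (simp add: chord_sq_def power2_eq_square algebra_simps)
      moreover have "b\<^sup>2 * (1 - t\<^sup>2) \<ge> 0"
        using elim abs_square_le_1[of t] by (intro mult_nonneg_nonneg) auto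
      ultimately have "(a - b * t)\<^sup>2 \<le> chord_sq a b t" by linarith
      then have "a - b * t \<le> sqrt (chord_sq a b t)" by (rule real_le_rsqrt)
      then show ?case
        using chord_sq_pos[OF ab elim] by (simp add: riesz_sq_def powr_half_sqrt)
    qed
    show "integrable \<nu> (\<lambda>t. riesz_sq (- 1) (chord_sq a b t))"
      using dim ab by (intro integrable_riesz_sq_chord_sq) auto
  qed (use id in auto)
  also have "\<dots> = - a"
    using id prob_space[unfolded space_law] by (simp add: expectation_law)
  finally show ?thesis .
qed

text \<open>The averaged gain from convexity when one radius changes from R to R + h: the integrand
  is -2 times the derivative of the kernel at the new squared chord.\<close>

definition tangent_gain :: "real \<Rightarrow> real \<Rightarrow> real \<Rightarrow> real" where
  "tangent_gain s R h = (\<integral>t. ((1 + h / R) * (R\<^sup>2 * (2 - 2 * t)) + h\<^sup>2) powr (- s / 2 - 1) \<partial>\<nu>)"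

lemma tangent_gain_nonneg: "tangent_gain s R h \<ge> 0"
  unfolding tangent_gain_def by (rule Bochner_Integration.integral_nonneg) simp

text \<open>The exponent - s / 2 - 1 is - q / 2 for q = s + 2, so s < d - 3 is exactly q < d -
  1.\<close>

lemma integrable_chord_powr_scaled:
  assumes s: "- 2 < s" "s < real d - 3" and l: "l > 0"
  shows "integrable \<nu> (\<lambda>t. (l * (2 - 2 * t)) powr (- s / 2 - 1))"
    and "(\<integral>t. (l * (2 - 2 * t)) powr (- s / 2 - 1) \<partial>\<nu>) = l powr (- s / 2 - 1) * c_const (s + 2) d"
proof -
  have e: "- (s + 2) / 2 = - s / 2 - 1" by (simp add: field_simps)
  have q: "- 2 < s + 2" "s + 2 \<noteq> 0" "s + 2 < real d - 1" using s by auto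
  note c = chord_powr_law[OF q, unfolded e]
  have eq: "AE t in \<nu>. (l * (2 - 2 * t)) powr (- s / 2 - 1) =
      l powr (- s / 2 - 1) * (2 - 2 * t) powr (- s / 2 - 1)"
    using AE_less_1 by eventually_elim (use l in \<open>auto intro!: powr_mult\<close>)
  have "integrable \<nu> (\<lambda>t. l powr (- s / 2 - 1) * (2 - 2 * t) powr (- s / 2 - 1))"
    using c(1) by (rule integrable_mult_right)
  then show "integrable \<nu> (\<lambda>t. (l * (2 - 2 * t)) powr (- s / 2 - 1))"
    by (rule integrable_cong_AE[THEN iffD2, OF _ _ eq, rotated 2]) simp_all
  have "(\<integral>t. (l * (2 - 2 * t)) powr (- s / 2 - 1) \<partial>\<nu>) =
      (\<integral>t. l powr (- s / 2 - 1) * (2 - 2 * t) powr (- s / 2 - 1) \<partial>\<nu>)"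
    by (rule integral_cong_AE[OF _ _ eq]) simp_all
  then show "(\<integral>t. (l * (2 - 2 * t)) powr (- s / 2 - 1) \<partial>\<nu>) = l powr (- s / 2 - 1) * c_const (s + 2) d"
    by (simp only: integral_mult_right_zero c(2))
qed

lemma integrable_tangent_gain:
  assumes s: "- 2 < s" "s < real d - 3" and R: "R > 0" "R + h > 0"
  shows "integrable \<nu> (\<lambda>t. ((1 + h / R) * (R\<^sup>2 * (2 - 2 * t)) + h\<^sup>2) powr (- s / 2 - 1))"
proof (rule Bochner_Integration.integrable_bound)
  define l where "l = (1 + h / R) * R\<^sup>2"
  have "1 + h / R > 0" using R by (simp add: field_simps)
  then have l: "l > 0" using R by (simp add: l_def)
  show "integrable \<nu> (\<lambda>t. (l * (2 - 2 * t)) powr (- s / 2 - 1))"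
    by (rule integrable_chord_powr_scaled(1)[OF s l])
  show "AE t in \<nu>. norm (((1 + h / R) * (R\<^sup>2 * (2 - 2 * t)) + h\<^sup>2) powr (- s / 2 - 1)) \<le>
      norm ((l * (2 - 2 * t)) powr (- s / 2 - 1))"
    using AE_less_1
  proof eventually_elim
    case (elim t)
    have "(l * (2 - 2 * t) + h\<^sup>2) powr (- s / 2 - 1) \<le> (l * (2 - 2 * t)) powr (- s / 2 - 1)"
      using l elim s by (intro powr_mono2') auto
    then show ?case by (simp add: l_def mult.assoc)
  qed
qed simp

text \<open>
  Moving one sphere from radius \<open>R\<close> to \<open>R + h\<close> multiplies the squared chord by
  \<open>1 + h / R\<close> and adds \<open>h\<^sup>2\<close>. The first change is homogeneous scaling, the second is
  estimated by convexity of the kernel in the squared distance.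
\<close>

lemma sphere_pot_upper_bound:
  assumes s: "- 2 < s" "s < real d - 3" and R: "R > 0" "R + h > 0"
  shows "sphere_pot s (R + h) R \<le>
    riesz_scale s (1 + h / R) (sphere_pot s R R) - h\<^sup>2 / 2 * tangent_gain s R h"
proof -
  define l where "l = (1 + h / R) * R\<^sup>2"
  have "1 + h / R > 0" using R by (simp add: field_simps)
  then have l: "l > 0" using R by (simp add: l_def)
  have s': "s < real d - 1" using s by simp
  note int = riesz_sq_scaled_law[OF s(1) s' l] integrable_tangent_gain[OF s R]
  have ls: "(1 + h / R) * (R\<^sup>2 * (2 - 2 * t)) = l * (2 - 2 * t)" for t
    by (simp add: l_def mult.assoc)
  have ch: "chord_sq (R + h) R t = l * (2 - 2 * t) + h\<^sup>2" for t
    using R by (simp add: l_def chord_sq_def power2_eq_square field_simps)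
  have "sphere_pot s (R + h) R \<le> (\<integral>t. riesz_sq s (l * (2 - 2 * t)) -
      h\<^sup>2 / 2 * ((1 + h / R) * (R\<^sup>2 * (2 - 2 * t)) + h\<^sup>2) powr (- s / 2 - 1) \<partial>\<nu>)"
    unfolding sphere_pot_def
  proof (rule integral_mono_AE)
    show "AE t in \<nu>. riesz_sq s (chord_sq (R + h) R t) \<le> riesz_sq s (l * (2 - 2 * t)) -
      h\<^sup>2 / 2 * ((1 + h / R) * (R\<^sup>2 * (2 - 2 * t)) + h\<^sup>2) powr (- s / 2 - 1)"
      using AE_less_1
    proof eventually_elim
      case (elim t)
      show ?case unfolding ch ls using elim l s by (intro riesz_sq_add_le) auto
    qed
    show "integrable \<nu> (\<lambda>t. riesz_sq s (chord_sq (R + h) R t))"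
      using s s' R by (intro integrable_riesz_sq_chord_sq) auto
  qed (intro Bochner_Integration.integrable_diff integrable_mult_right int)
  also have "\<dots> = riesz_scale s l (riesz_self s d) - h\<^sup>2 / 2 * tangent_gain s R h"
    unfolding tangent_gain_def int(2)[symmetric] integral_mult_right_zero[symmetric]
    by (intro Bochner_Integration.integral_diff integrable_mult_right int)
  also have "riesz_scale s l (riesz_self s d) = riesz_scale s (1 + h / R) (riesz_scale s (R\<^sup>2) (riesz_self s d))"
  proof -
    have "1 + h / R > 0" using R by (simp add: field_simps)
    then show ?thesis
      using R unfolding l_def by (simp add: riesz_scale_def ln_mult powr_mult diff_divide_distrib add_divide_distrib)
  qed
  finally show ?thesis
    using sphere_pot_same[OF s(1) s' R(1)] by simp
qed

text \<open>Dominated convergence. The limit integrand dominates because h > 0 enlarges the base and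
  the exponent is negative, so the sequence approaches from the right; one such sequence suffices
  for the second derivative.\<close>

lemma tangent_gain_tendsto:
  assumes s: "- 2 < s" "s < real d - 3" and R: "R > 0"
  shows "(\<lambda>n. tangent_gain s R (1 / real (Suc n))) \<longlonglongrightarrow> R powr (- s - 2) * c_const (s + 2) d"
proof -
  have R2: "R\<^sup>2 > 0" using R by simp
  have "(\<lambda>n. tangent_gain s R (1 / real (Suc n))) \<longlonglongrightarrow>
      (\<integral>t. (R\<^sup>2 * (2 - 2 * t)) powr (- s / 2 - 1) \<partial>\<nu>)"
    unfolding tangent_gain_def
  proof (rule integral_dominated_convergence)
    show "integrable \<nu> (\<lambda>t. (R\<^sup>2 * (2 - 2 * t)) powr (- s / 2 - 1))"
      by (rule integrable_chord_powr_scaled(1)[OF s R2])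
    show "AE t in \<nu>. (\<lambda>n. ((1 + 1 / real (Suc n) / R) * (R\<^sup>2 * (2 - 2 * t)) + (1 / real (Suc n))\<^sup>2) powr (- s / 2 - 1))
        \<longlonglongrightarrow> (R\<^sup>2 * (2 - 2 * t)) powr (- s / 2 - 1)"
      using AE_less_1
    proof eventually_elim
      case (elim t)
      define c where "c = R\<^sup>2 * (2 - 2 * t)"
      have "c > 0" using elim R by (simp add: c_def)
      have n: "(\<lambda>n. 1 / real (Suc n)) \<longlonglongrightarrow> 0" by real_asymp
      have "(\<lambda>n. ((1 + 1 / real (Suc n) / R) * c + (1 / real (Suc n))\<^sup>2) powr (- s / 2 - 1))
          \<longlonglongrightarrow> ((1 + 0 / R) * c + 0\<^sup>2) powr (- s / 2 - 1)"
        using \<open>c > 0\<close> R by (intro tendsto_intros n) auto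
      then show ?case by (simp add: c_def)
    qed
    show "AE t in \<nu>. norm (((1 + 1 / real (Suc n) / R) * (R\<^sup>2 * (2 - 2 * t)) + (1 / real (Suc n))\<^sup>2) powr (- s / 2 - 1))
        \<le> (R\<^sup>2 * (2 - 2 * t)) powr (- s / 2 - 1)" for n
      using AE_less_1
    proof eventually_elim
      case (elim t)
      define c where "c = R\<^sup>2 * (2 - 2 * t)"
      have "c > 0" using elim R by (simp add: c_def)
      moreover have "0 \<le> 1 / real (Suc n) / R * c" using \<open>c > 0\<close> R by simp
      then have "c \<le> (1 + 1 / real (Suc n) / R) * c + (1 / real (Suc n))\<^sup>2"
        by (simp add: distrib_right)
      ultimately show ?case
        unfolding c_def[symmetric] using s by (simp add: powr_mono2')
    qed
  qed simp_all
  also have "(\<integral>t. (R\<^sup>2 * (2 - 2 * t)) powr (- s / 2 - 1) \<partial>\<nu>) = (R\<^sup>2) powr (- s / 2 - 1) * c_const (s + 2) d"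
    by (rule integrable_chord_powr_scaled(2)[OF s R2])
  also have "(R\<^sup>2) powr (- s / 2 - 1) = R powr (- s - 2)"
  proof -
    have "R powr 2 = R\<^sup>2" using R by simp
    then have "(R\<^sup>2) powr (- s / 2 - 1) = (R powr 2) powr (- s / 2 - 1)" by (simp only:)
    moreover have "2 * (- s / 2 - 1) = - s - 2" by (simp add: field_simps)
    ultimately show ?thesis by (simp only: powr_powr)
  qed
  finally show ?thesis .
qed

end

section \<open>The Euler--Lagrange inequality\<close>

lemma riesz_kernel_measurable [measurable]:
  "riesz_kernel s \<in> borel_measurable (borel :: 'a::euclidean_space measure)"
  unfolding riesz_kernel_def[abs_def] by measurable

lemma riesz_kernel_not_MInfty: "riesz_kernel s x \<noteq> - \<infinity>"
  by (simp add: riesz_kernel_def)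

lemma energy_integrand_measurable:
  fixes V :: "'a::euclidean_space \<Rightarrow> ereal"
  assumes [measurable]: "V \<in> borel_measurable borel"
  shows "energy_integrand s V \<in> borel_measurable (borel \<Otimes>\<^sub>M borel)"
  unfolding energy_integrand_def by measurable

lemma nn_integral_ennreal_integrable:
  fixes f :: "'a \<Rightarrow> real"
  assumes "integrable M f"
  shows "(\<integral>\<^sup>+x. ennreal (f x) \<partial>M) = ennreal (\<integral>x. max 0 (f x) \<partial>M)"
proof -
  have "(\<integral>\<^sup>+x. ennreal (f x) \<partial>M) = (\<integral>\<^sup>+x. ennreal (max 0 (f x)) \<partial>M)"
    by (intro nn_integral_cong) (simp add: max_def ennreal_neg)
  also have "\<dots> = ennreal (\<integral>x. max 0 (f x) \<partial>M)"
    using assms by (intro nn_integral_eq_integral) auto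
  finally show ?thesis .
qed

abbreviation inner_law :: "'a::euclidean_space itself \<Rightarrow> real measure" where
  "inner_law _ \<equiv> distr (sphere_unif \<Otimes>\<^sub>M (sphere_unif :: 'a measure)) borel (\<lambda>(x, y). x \<bullet> y)"

text \<open>Integrands that depend only on the inner product reduce to one dimension. Parallel and
  antipodal pairs form a null set and may be left out, which matters because the kernel can be
  infinite on the diagonal.\<close>

lemma nn_integral_sphere_uniform_pair:
  fixes F :: "'a::euclidean_space \<times> 'a \<Rightarrow> ennreal"
  assumes dim: "DIM('a) \<ge> 2"
    and F [measurable]: "F \<in> borel_measurable (borel \<Otimes>\<^sub>M borel)"
    and g [measurable]: "g \<in> borel_measurable borel"
    and eq: "\<And>x y. \<lbrakk>norm x = 1; norm y = 1; \<bar>x \<bullet> y\<bar> < 1\<rbrakk> \<Longrightarrow> F (a *\<^sub>R x, b *\<^sub>R y) = g (x \<bullet> y)"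
  shows "(\<integral>\<^sup>+x. \<integral>\<^sup>+y. F (x, y) \<partial>sphere_uniform b \<partial>sphere_uniform a) = (\<integral>\<^sup>+t. g t \<partial>inner_law TYPE('a))"
proof -
  let ?S = "sphere_unif :: 'a measure"
  interpret prob_space ?S by (rule prob_space_sphere_uniform)
  interpret P: pair_prob_space ?S ?S ..
  interpret law: sphere_inner_law "inner_law TYPE('a)" "DIM('a)"
    by (rule sphere_inner_law[OF dim])
  interpret B: prob_space "sphere_uniform b :: 'a measure" by (rule prob_space_sphere_uniform)
  have "(\<integral>\<^sup>+x. \<integral>\<^sup>+y. F (x, y) \<partial>sphere_uniform b \<partial>sphere_uniform a) =
      (\<integral>\<^sup>+x. \<integral>\<^sup>+y. F (a *\<^sub>R x, y) \<partial>sphere_uniform b \<partial>?S)"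
    unfolding sphere_uniform_eq_distr[of a]
    by (rule nn_integral_distr) (auto intro!: B.borel_measurable_nn_integral)
  also have "\<dots> = (\<integral>\<^sup>+x. \<integral>\<^sup>+y. F (a *\<^sub>R x, b *\<^sub>R y) \<partial>?S \<partial>?S)"
    unfolding sphere_uniform_eq_distr[of b]
    by (intro nn_integral_cong nn_integral_distr) auto
  also have "\<dots> = (\<integral>\<^sup>+z. F (a *\<^sub>R fst z, b *\<^sub>R snd z) \<partial>(?S \<Otimes>\<^sub>M ?S))"
    by (subst nn_integral_fst[symmetric]) auto
  also have "\<dots> = (\<integral>\<^sup>+z. g (fst z \<bullet> snd z) \<partial>(?S \<Otimes>\<^sub>M ?S))"
  proof (rule nn_integral_cong_AE)
    have "AE z in ?S \<Otimes>\<^sub>M ?S. norm (fst z) = 1 \<and> norm (snd z) = 1"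
    proof (rule P.AE_pair_measure)
      show "AE x in ?S. AE y in ?S. norm (fst (x, y)) = 1 \<and> norm (snd (x, y)) = 1"
        using AE_sphere_unif_norm[where 'a='a]
      proof eventually_elim
        case (elim x)
        show ?case using AE_sphere_unif_norm[where 'a='a] by eventually_elim (simp add: elim)
      qed
    qed measurable
    moreover have "AE z in ?S \<Otimes>\<^sub>M ?S. \<bar>fst z \<bullet> snd z\<bar> < 1"
      using law.AE_less_1 by (subst (asm) AE_distr_iff) (auto simp: case_prod_beta)
    ultimately show "AE z in ?S \<Otimes>\<^sub>M ?S. F (a *\<^sub>R fst z, b *\<^sub>R snd z) = g (fst z \<bullet> snd z)"
      by eventually_elim (auto intro: eq)
  qed
  also have "\<dots> = (\<integral>\<^sup>+t. g t \<partial>inner_law TYPE('a))"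
    by (subst nn_integral_distr) (auto simp: case_prod_beta)
  finally show ?thesis .
qed

text \<open>The convex combination p, 1 - p of two uniform sphere measures, encoded as a random
  choice of the radius so that the rules for \<open>bind\<close> provide total mass and
  integrals.\<close>

definition sphere_mix :: "real \<Rightarrow> real \<Rightarrow> real \<Rightarrow> 'a::euclidean_space measure" where
  "sphere_mix p a b = measure_pmf (bernoulli_pmf p) \<bind> (\<lambda>c. sphere_uniform (if c then a else b))"

lemma sphere_uniform_in_subprob_algebra [simp]:
  "sphere_uniform r \<in> space (subprob_algebra borel)"
  by (simp add: space_subprob_algebra prob_space_imp_subprob_space prob_space_sphere_uniform)

lemma sets_sphere_mix [simp, measurable_cong]: "sets (sphere_mix p a b) = sets borel"
  unfolding sphere_mix_def by (subst sets_bind[where N = borel]) auto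

lemma space_sphere_mix [simp]: "space (sphere_mix p a b) = UNIV"
  using sets_eq_imp_space_eq[OF sets_sphere_mix] by simp

lemma prob_space_sphere_mix: "prob_space (sphere_mix p a b)"
  unfolding sphere_mix_def
  by (rule measure_pmf.prob_space_bind[where S = borel]) (auto intro!: prob_space_sphere_uniform)

lemma nn_integral_sphere_mix:
  fixes f :: "'a::euclidean_space \<Rightarrow> ennreal"
  assumes "0 \<le> p" "p \<le> 1" and [measurable]: "f \<in> borel_measurable borel"
  shows "(\<integral>\<^sup>+x. f x \<partial>sphere_mix p a b) =
    (\<integral>\<^sup>+x. f x \<partial>sphere_uniform a) * ennreal p + (\<integral>\<^sup>+x. f x \<partial>sphere_uniform b) * ennreal (1 - p)"
  unfolding sphere_mix_def
  by (subst nn_integral_bind[where B = borel]) (use assms in auto)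

lemma nn_integral_sphere_mix_pair:
  fixes F :: "'a::euclidean_space \<times> 'a \<Rightarrow> ennreal"
  assumes p: "0 \<le> p" "p \<le> 1"
    and F [measurable]: "F \<in> borel_measurable (borel \<Otimes>\<^sub>M borel)"
  defines "E \<equiv> \<lambda>c e. \<integral>\<^sup>+x. \<integral>\<^sup>+y. F (x, y) \<partial>sphere_uniform e \<partial>sphere_uniform c"
  shows "(\<integral>\<^sup>+z. F z \<partial>(sphere_mix p a b \<Otimes>\<^sub>M sphere_mix p a b)) =
    (E a a * ennreal p + E a b * ennreal (1 - p)) * ennreal p +
    (E b a * ennreal p + E b b * ennreal (1 - p)) * ennreal (1 - p)"
proof -
  interpret M: prob_space "sphere_mix p a b :: 'a measure" by (rule prob_space_sphere_mix)
  interpret A: prob_space "sphere_uniform a :: 'a measure" by (rule prob_space_sphere_uniform)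
  interpret B: prob_space "sphere_uniform b :: 'a measure" by (rule prob_space_sphere_uniform)
  have [measurable]: "(\<lambda>x. \<integral>\<^sup>+y. F (x, y) \<partial>sphere_uniform a) \<in> borel_measurable borel"
    "(\<lambda>x. \<integral>\<^sup>+y. F (x, y) \<partial>sphere_uniform b) \<in> borel_measurable borel"
    by (auto intro!: A.borel_measurable_nn_integral B.borel_measurable_nn_integral)
  have "(\<integral>\<^sup>+z. F z \<partial>(sphere_mix p a b \<Otimes>\<^sub>M sphere_mix p a b)) =
      (\<integral>\<^sup>+x. \<integral>\<^sup>+y. F (x, y) \<partial>sphere_mix p a b \<partial>sphere_mix p a b)"
    by (rule M.nn_integral_fst[symmetric]) simp
  also have "\<dots> = (\<integral>\<^sup>+x. (\<integral>\<^sup>+y. F (x, y) \<partial>sphere_uniform a) * ennreal p +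
      (\<integral>\<^sup>+y. F (x, y) \<partial>sphere_uniform b) * ennreal (1 - p) \<partial>sphere_mix p a b)"
    by (intro nn_integral_cong nn_integral_sphere_mix p) simp
  also have "\<dots> = (E a a * ennreal p + E a b * ennreal (1 - p)) * ennreal p +
    (E b a * ennreal p + E b b * ennreal (1 - p)) * ennreal (1 - p)"
    unfolding E_def by (subst nn_integral_sphere_mix[OF p]) (simp_all add: nn_integral_add nn_integral_multc)
  finally show ?thesis .
qed

lemma energy_integrand_sphere:
  fixes x y :: "'a::euclidean_space"
  assumes "norm x = 1" "norm y = 1" "\<bar>x \<bullet> y\<bar> < 1" "a > 0" "b > 0"
    and "v (a\<^sup>2) = ereal va" "v (b\<^sup>2) = ereal vb"
  shows "energy_integrand s (\<lambda>x. v ((norm x)\<^sup>2)) (a *\<^sub>R x, b *\<^sub>R y) =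
    ereal (riesz_sq s (chord_sq a b (x \<bullet> y)) + va + vb)"
proof -
  have n: "(norm (a *\<^sub>R x - b *\<^sub>R y))\<^sup>2 = chord_sq a b (x \<bullet> y)"
    by (rule norm_diff_eq_chord_sq) fact+
  have "chord_sq a b (x \<bullet> y) > 0" by (rule chord_sq_pos) fact+
  then have "a *\<^sub>R x - b *\<^sub>R y \<noteq> 0" using n by auto
  from riesz_kernel_eq_riesz_sq[OF this, of s] show ?thesis
    using assms unfolding n by (simp add: energy_integrand_def)
qed

section \<open>Energies of spheres in a continuous radial field\<close>

locale sphere_energy =
  fixes s :: real and v :: "real \<Rightarrow> ereal" and dim_type :: "'a::euclidean_space itself"
  assumes dim2: "DIM('a) \<ge> 2" and s: "- 2 < s" "s < real DIM('a) - 1"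
    and v_cont: "continuous_on {0..} v"
begin

abbreviation V :: "'a \<Rightarrow> ereal" where "V \<equiv> \<lambda>x. v ((norm x)\<^sup>2)"

sublocale law: sphere_inner_law "inner_law TYPE('a)" "DIM('a)"
  by (rule sphere_inner_law[OF dim2])

lemma V_measurable [measurable]: "V \<in> borel_measurable borel"
  by (intro borel_measurable_continuous_onI continuous_on_compose2[OF v_cont]) (auto intro!: continuous_intros)

lemmas integrand_measurable [measurable] = energy_integrand_measurable[OF V_measurable, of s]

text \<open>A real number, with \<open>real_of_ereal\<close> faithful where the field is finite at
  both radii; it is applied to energies only under that assumption.\<close>

definition mutual :: "real \<Rightarrow> real \<Rightarrow> real" where
  "mutual a b = law.sphere_pot s a b + real_of_ereal (v (a\<^sup>2)) + real_of_ereal (v (b\<^sup>2))"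

lemma mutual_commute: "mutual a b = mutual b a"
  by (simp add: mutual_def law.sphere_pot_def chord_sq_commute[of a])

text \<open>The energy is a difference of two nonnegative integrals, so both are kept as finite
  reals: mixtures expand each of them bilinearly, and subtraction comes last.\<close>

lemma mutual_energy:
  assumes ab: "a > 0" "b > 0" and fin: "\<bar>v (a\<^sup>2)\<bar> \<noteq> \<infinity>" "\<bar>v (b\<^sup>2)\<bar> \<noteq> \<infinity>"
  obtains P N :: real where "P \<ge> 0" "N \<ge> 0" "P - N = mutual a b"
    "(\<integral>\<^sup>+x. \<integral>\<^sup>+y. e2ennreal (energy_integrand s V (x, y)) \<partial>sphere_uniform b \<partial>sphere_uniform a) = ennreal P"
    "(\<integral>\<^sup>+x. \<integral>\<^sup>+y. e2ennreal (- energy_integrand s V (x, y)) \<partial>sphere_uniform b \<partial>sphere_uniform a) = ennreal N"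
proof -
  define va vb where "va = real_of_ereal (v (a\<^sup>2))" and "vb = real_of_ereal (v (b\<^sup>2))"
  have v: "v (a\<^sup>2) = ereal va" "v (b\<^sup>2) = ereal vb"
    using fin by (simp_all add: va_def vb_def ereal_real')
  define f where "f t = riesz_sq s (chord_sq a b t) + va + vb" for t
  have [measurable]: "f \<in> borel_measurable borel" unfolding f_def by measurable
  have pot: "integrable (inner_law TYPE('a)) (\<lambda>t. riesz_sq s (chord_sq a b t))"
    using s ab by (intro law.integrable_riesz_sq_chord_sq) auto
  then have int: "integrable (inner_law TYPE('a)) f"
    unfolding f_def by (intro Bochner_Integration.integrable_add law.integrable_const)
  have If: "(\<integral>t. f t \<partial>inner_law TYPE('a)) = mutual a b"
    unfolding f_def mutual_def law.sphere_pot_def va_def vb_def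
    using pot law.prob_space[unfolded law.space_law] by simp
  note eq = energy_integrand_sphere[where s = s and v = v, OF _ _ _ ab v]
  define P N where "P = (\<integral>t. max 0 (f t) \<partial>inner_law TYPE('a))"
    and "N = (\<integral>t. max 0 (- f t) \<partial>inner_law TYPE('a))"
  show ?thesis
  proof (rule that[of P N])
    show "P \<ge> 0" "N \<ge> 0" by (simp_all add: P_def N_def)
    have "P - N = (\<integral>t. max 0 (f t) - max 0 (- f t) \<partial>inner_law TYPE('a))"
      unfolding P_def N_def using int by (intro Bochner_Integration.integral_diff[symmetric]) auto
    also have "\<dots> = (\<integral>t. f t \<partial>inner_law TYPE('a))"
      by (intro Bochner_Integration.integral_cong) auto
    finally show "P - N = mutual a b" by (simp add: If)
    have "(\<integral>\<^sup>+x. \<integral>\<^sup>+y. e2ennreal (energy_integrand s V (x, y)) \<partial>sphere_uniform b \<partial>sphere_uniform a) =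
        (\<integral>\<^sup>+t. ennreal (f t) \<partial>inner_law TYPE('a))"
      by (rule nn_integral_sphere_uniform_pair[OF dim2]) (simp_all add: eq f_def)
    then show "(\<integral>\<^sup>+x. \<integral>\<^sup>+y. e2ennreal (energy_integrand s V (x, y)) \<partial>sphere_uniform b \<partial>sphere_uniform a) = ennreal P"
      unfolding P_def nn_integral_ennreal_integrable[OF int] .
    have "(\<integral>\<^sup>+x. \<integral>\<^sup>+y. e2ennreal (- energy_integrand s V (x, y)) \<partial>sphere_uniform b \<partial>sphere_uniform a) =
        (\<integral>\<^sup>+t. ennreal (- f t) \<partial>inner_law TYPE('a))"
      by (rule nn_integral_sphere_uniform_pair[OF dim2]) (simp_all add: eq f_def)
    moreover have "integrable (inner_law TYPE('a)) (\<lambda>t. - f t)" using int by simp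
    ultimately show "(\<integral>\<^sup>+x. \<integral>\<^sup>+y. e2ennreal (- energy_integrand s V (x, y)) \<partial>sphere_uniform b \<partial>sphere_uniform a) = ennreal N"
      unfolding N_def by (simp only: nn_integral_ennreal_integrable)
  qed
qed

lemma energy_sphere_mix:
  assumes p: "0 \<le> p" "p \<le> 1" and ab: "a > 0" "b > 0"
    and fin: "\<bar>v (a\<^sup>2)\<bar> \<noteq> \<infinity>" "\<bar>v (b\<^sup>2)\<bar> \<noteq> \<infinity>"
  shows "energy s V (sphere_mix p a b) =
    ereal (p\<^sup>2 * mutual a a + 2 * p * (1 - p) * mutual a b + (1 - p)\<^sup>2 * mutual b b)"
proof -
  obtain P1 N1 where 1: "P1 \<ge> 0" "N1 \<ge> 0" "P1 - N1 = mutual a a"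
    "(\<integral>\<^sup>+x. \<integral>\<^sup>+y. e2ennreal (energy_integrand s V (x, y)) \<partial>sphere_uniform a \<partial>sphere_uniform a) = ennreal P1"
    "(\<integral>\<^sup>+x. \<integral>\<^sup>+y. e2ennreal (- energy_integrand s V (x, y)) \<partial>sphere_uniform a \<partial>sphere_uniform a) = ennreal N1"
    using mutual_energy[OF ab(1) ab(1) fin(1) fin(1)] .
  obtain P2 N2 where 2: "P2 \<ge> 0" "N2 \<ge> 0" "P2 - N2 = mutual a b"
    "(\<integral>\<^sup>+x. \<integral>\<^sup>+y. e2ennreal (energy_integrand s V (x, y)) \<partial>sphere_uniform b \<partial>sphere_uniform a) = ennreal P2"
    "(\<integral>\<^sup>+x. \<integral>\<^sup>+y. e2ennreal (- energy_integrand s V (x, y)) \<partial>sphere_uniform b \<partial>sphere_uniform a) = ennreal N2"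
    using mutual_energy[OF ab fin] .
  obtain P3 N3 where 3: "P3 \<ge> 0" "N3 \<ge> 0" "P3 - N3 = mutual b a"
    "(\<integral>\<^sup>+x. \<integral>\<^sup>+y. e2ennreal (energy_integrand s V (x, y)) \<partial>sphere_uniform a \<partial>sphere_uniform b) = ennreal P3"
    "(\<integral>\<^sup>+x. \<integral>\<^sup>+y. e2ennreal (- energy_integrand s V (x, y)) \<partial>sphere_uniform a \<partial>sphere_uniform b) = ennreal N3"
    using mutual_energy[OF ab(2,1) fin(2,1)] .
  obtain P4 N4 where 4: "P4 \<ge> 0" "N4 \<ge> 0" "P4 - N4 = mutual b b"
    "(\<integral>\<^sup>+x. \<integral>\<^sup>+y. e2ennreal (energy_integrand s V (x, y)) \<partial>sphere_uniform b \<partial>sphere_uniform b) = ennreal P4"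
    "(\<integral>\<^sup>+x. \<integral>\<^sup>+y. e2ennreal (- energy_integrand s V (x, y)) \<partial>sphere_uniform b \<partial>sphere_uniform b) = ennreal N4"
    using mutual_energy[OF ab(2) ab(2) fin(2) fin(2)] .
  \<comment> \<open>One bilinear form serves both parts; being linear in its arguments, it commutes
    with taking the difference.\<close>
  define comb where "comb x1 x2 x3 x4 = (x1 * p + x2 * (1 - p)) * p + (x3 * p + x4 * (1 - p)) * (1 - p)"
    for x1 x2 x3 x4 :: real
  have comb_nonneg: "comb x1 x2 x3 x4 \<ge> 0" if "x1 \<ge> 0" "x2 \<ge> 0" "x3 \<ge> 0" "x4 \<ge> 0" for x1 x2 x3 x4
    using that p unfolding comb_def by (intro add_nonneg_nonneg mult_nonneg_nonneg) auto
  have ennreal_comb: "(ennreal x1 * ennreal p + ennreal x2 * ennreal (1 - p)) * ennreal p +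
      (ennreal x3 * ennreal p + ennreal x4 * ennreal (1 - p)) * ennreal (1 - p) = ennreal (comb x1 x2 x3 x4)"
    if "x1 \<ge> 0" "x2 \<ge> 0" "x3 \<ge> 0" "x4 \<ge> 0" for x1 x2 x3 x4
    using that p unfolding comb_def
    by (simp only: ennreal_mult[symmetric] ennreal_plus[symmetric] add_nonneg_nonneg mult_nonneg_nonneg
        diff_ge_0_iff_ge)
  have pos_measurable: "(\<lambda>z. e2ennreal (energy_integrand s V z)) \<in> borel_measurable (borel \<Otimes>\<^sub>M borel)"
    and neg_measurable: "(\<lambda>z. e2ennreal (- energy_integrand s V z)) \<in> borel_measurable (borel \<Otimes>\<^sub>M borel)"
    by measurable
  have pos: "energy_pos s V (sphere_mix p a b) = ennreal (comb P1 P2 P3 P4)"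
    unfolding energy_pos_def
    by (simp only: nn_integral_sphere_mix_pair[OF p pos_measurable] 1 2 3 4 ennreal_comb)
  have neg: "energy_neg s V (sphere_mix p a b) = ennreal (comb N1 N2 N3 N4)"
    unfolding energy_neg_def
    by (simp only: nn_integral_sphere_mix_pair[OF p neg_measurable] 1 2 3 4 ennreal_comb)
  have "energy s V (sphere_mix p a b) = ereal (comb P1 P2 P3 P4 - comb N1 N2 N3 N4)"
    unfolding energy_def pos neg using comb_nonneg 1 2 3 4 by (simp add: enn2ereal_ennreal)
  also have "comb P1 P2 P3 P4 - comb N1 N2 N3 N4 =
      comb (P1 - N1) (P2 - N2) (P3 - N3) (P4 - N4)"
    by (simp add: comb_def algebra_simps)
  also have "\<dots> = p\<^sup>2 * mutual a a + 2 * p * (1 - p) * mutual a b + (1 - p)\<^sup>2 * mutual b b"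
    unfolding 1 2 3 4 mutual_commute[of b a] by (simp add: comb_def power2_eq_square algebra_simps)
  finally show ?thesis .
qed

lemma sphere_mix_0: "sphere_mix 0 a b = (sphere_uniform b :: 'a measure)"
proof (rule measure_eqI)
  fix A :: "'a set" assume "A \<in> sets (sphere_mix 0 a b)"
  then have "A \<in> sets borel" by simp
  then show "emeasure (sphere_mix 0 a b) A = emeasure (sphere_uniform b) A"
    using nn_integral_sphere_mix[of 0 "indicator A" a b]
    by (simp add: nn_integral_indicator)
qed simp

lemma sphere_mix_in_borel_prob_measures: "sphere_mix p a b \<in> borel_prob_measures"
  by (simp add: borel_prob_measures_def prob_space_sphere_mix)

text \<open>The Euler--Lagrange inequality, from the variation \<open>(1 - p) \<sigma>\<^sub>R + p \<sigma>\<^sub>\<rho>\<close> as \<open>p \<rightarrow> 0\<close>.\<close>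

lemma equilibrium_mutual_le:
  assumes eq: "equilibrium_measure s V (sphere_uniform R)" and R: "R > 0" "\<rho> > 0"
    and fin: "\<bar>v (R\<^sup>2)\<bar> \<noteq> \<infinity>" "\<bar>v (\<rho>\<^sup>2)\<bar> \<noteq> \<infinity>"
  shows "mutual R R \<le> mutual \<rho> R"
proof (rule ccontr)
  assume "\<not> mutual R R \<le> mutual \<rho> R"
  then have d: "mutual R R - mutual \<rho> R > 0" by simp
  define \<delta> K where "\<delta> = mutual R R - mutual \<rho> R"
    and "K = mutual \<rho> \<rho> - 2 * mutual \<rho> R + mutual R R"
  \<comment> \<open>The energy of the mixture is its value at p = 0 plus p (p K - 2 \<delta>). This
    choice gives p (|K| + 1) \<le> \<delta>, so the increment is negative.\<close>
  define p where "p = min 1 (\<delta> / (\<bar>K\<bar> + 1))"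
  have p: "0 < p" "p \<le> 1" "p \<le> \<delta> / (\<bar>K\<bar> + 1)" using d by (auto simp: p_def \<delta>_def)
  have "energy s V (sphere_uniform R) = ereal (mutual R R)"
    using energy_sphere_mix[of 0 \<rho> R] R fin by (simp add: sphere_mix_0)
  moreover have "\<not> energy s V (sphere_mix p \<rho> R) < energy s V (sphere_uniform R)"
    using eq sphere_mix_in_borel_prob_measures unfolding equilibrium_measure_def is_arg_min_def by blast
  ultimately have "mutual R R \<le> p\<^sup>2 * mutual \<rho> \<rho> + 2 * p * (1 - p) * mutual \<rho> R + (1 - p)\<^sup>2 * mutual R R"
    using energy_sphere_mix[of p \<rho> R] p R fin by simp
  also have "\<dots> = mutual R R + p * (p * K - 2 * \<delta>)"
    by (simp add: K_def \<delta>_def power2_eq_square algebra_simps)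
  finally have "p * (p * K - 2 * \<delta>) \<ge> 0" by simp
  then have "2 * \<delta> \<le> p * K" using p by (simp add: zero_le_mult_iff)
  also have "p * K \<le> p * (\<bar>K\<bar> + 1)" using p by (intro mult_left_mono) auto
  also have "\<dots> \<le> \<delta>" using p by (simp add: pos_le_divide_eq)
  finally show False using d by (simp add: \<delta>_def)
qed

text \<open>Otherwise the sphere of radius R has infinite energy, while the one of radius
  \<open>b\<close> has finite energy and is a better competitor.\<close>

lemma equilibrium_finite:
  assumes eq: "equilibrium_measure s V (sphere_uniform R)" and R: "R > 0"
    and wd: "energy_well_defined s V"
    and b: "b > 0" "\<bar>v (b\<^sup>2)\<bar> \<noteq> \<infinity>"
  shows "v (R\<^sup>2) \<noteq> \<infinity>"
proof
  assume inf: "v (R\<^sup>2) = \<infinity>"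
  let ?\<sigma> = "sphere_uniform R :: 'a measure"
  interpret prob_space ?\<sigma> by (rule prob_space_sphere_uniform)
  have "energy_pos s V ?\<sigma> = (\<integral>\<^sup>+x. \<integral>\<^sup>+y. e2ennreal (energy_integrand s V (x, y)) \<partial>?\<sigma> \<partial>?\<sigma>)"
    unfolding energy_pos_def by (rule nn_integral_fst[symmetric]) measurable
  also have "\<dots> = (\<integral>\<^sup>+t. \<infinity> \<partial>inner_law TYPE('a))"
  proof (rule nn_integral_sphere_uniform_pair[OF dim2])
    fix x y :: 'a assume "norm x = 1" "norm y = 1"
    then show "e2ennreal (energy_integrand s V (R *\<^sub>R x, R *\<^sub>R y)) = \<infinity>"
      using inf R riesz_kernel_not_MInfty[of s "R *\<^sub>R x - R *\<^sub>R y"]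
      by (simp add: energy_integrand_def e2ennreal_infty)
  qed measurable
  also have "\<dots> = \<infinity>" using law.emeasure_space_1 by simp
  finally have pos: "energy_pos s V ?\<sigma> = \<infinity>" .
  have neg: "energy_neg s V ?\<sigma> < \<infinity>"
    using wd sphere_uniform_in_borel_prob_measures unfolding energy_well_defined_def by blast
  then obtain n where "n \<ge> 0" "energy_neg s V ?\<sigma> = ennreal n"
    by (cases "energy_neg s V ?\<sigma>") auto
  then have "energy s V ?\<sigma> = \<infinity>"
    unfolding energy_def pos by (simp add: enn2ereal_ennreal)
  moreover have "energy s V (sphere_uniform b) < \<infinity>"
    using energy_sphere_mix[of 0 b b] b by (simp add: sphere_mix_0)
  moreover have "(sphere_uniform b :: 'a measure) \<in> borel_prob_measures"
    by (rule sphere_uniform_in_borel_prob_measures)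
  ultimately show False
    using eq unfolding equilibrium_measure_def is_arg_min_def by auto
qed

text \<open>Where the field is infinite the bound is trivial, so it holds at every positive radius
  and can be used in limits.\<close>

lemma equilibrium_lower_bound:
  assumes eq: "equilibrium_measure s V (sphere_uniform R)" and R: "R > 0" "\<rho> > 0"
    and vR: "v (R\<^sup>2) = ereal w" and v_range: "v (\<rho>\<^sup>2) \<noteq> - \<infinity>"
  shows "ereal (law.sphere_pot s R R + w - law.sphere_pot s \<rho> R) \<le> v (\<rho>\<^sup>2)"
proof (cases "v (\<rho>\<^sup>2)")
  case (real r)
  have "mutual R R \<le> mutual \<rho> R"
    using vR real by (intro equilibrium_mutual_le[OF eq R]) auto
  then show ?thesis using vR real by (simp add: mutual_def)
qed (use v_range in auto)

end

section \<open>Derivatives in the extended sense at a minimum\<close>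

lemma at_within_atLeast_0: "(x::real) > 0 \<Longrightarrow> at x within {0..} = at x"
  by (rule at_within_interior) (simp add: interior_real_atLeast)

text \<open>The difference quotient of \<open>f\<close> dominates that of the minorant to the right
  of x and is dominated by it to the left. Both one-sided limits equal \<open>L\<close>, which pins
  it to \<open>g\<close>.\<close>

lemma ext_derivative_eq_of_minorant:
  fixes f :: "real \<Rightarrow> ereal"
  assumes L: "(ext_diff_quot f x \<longlongrightarrow> L) (at x)"
    and fx: "f x = ereal w"
    and G: "(G has_real_derivative g) (at x)" "G x = 0"
    and le: "\<forall>\<^sub>F t in at x. ereal (w + G t) \<le> f t"
  shows "L = ereal g"
proof (rule antisym)
  have q: "((\<lambda>t. ereal (G t / (t - x))) \<longlongrightarrow> ereal g) (at x)"
    using G unfolding has_field_derivative_iff by simp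
  have ql: "((\<lambda>t. ereal (G t / (t - x))) \<longlongrightarrow> ereal g) (at_left x)"
    and qr: "((\<lambda>t. ereal (G t / (t - x))) \<longlongrightarrow> ereal g) (at_right x)"
    using q unfolding filterlim_at_split by auto
  have Ll: "(ext_diff_quot f x \<longlongrightarrow> L) (at_left x)" and Lr: "(ext_diff_quot f x \<longlongrightarrow> L) (at_right x)"
    using L unfolding filterlim_at_split by auto
  have lel: "\<forall>\<^sub>F t in at_left x. ereal (w + G t) \<le> f t" and ler: "\<forall>\<^sub>F t in at_right x. ereal (w + G t) \<le> f t"
    using le unfolding eventually_at_split by auto
  have "\<forall>\<^sub>F t in at_left x. t < x"
    by (simp add: eventually_at_filter)
  with lel have "\<forall>\<^sub>F t in at_left x. ext_diff_quot f x t \<le> ereal (G t / (t - x))"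
  proof eventually_elim
    case (elim t)
    then show ?case
      by (cases "f t") (auto simp: ext_diff_quot_def fx divide_right_mono_neg)
  qed
  from tendsto_le[OF _ ql Ll this] show "L \<le> ereal g" by simp
  have "\<forall>\<^sub>F t in at_right x. x < t"
    by (rule eventually_at_right_less)
  with ler have "\<forall>\<^sub>F t in at_right x. ereal (G t / (t - x)) \<le> ext_diff_quot f x t"
  proof eventually_elim
    case (elim t)
    then show ?case
      by (cases "f t") (auto simp: ext_diff_quot_def fx divide_right_mono)
  qed
  from tendsto_le[OF _ Lr qr this] show "ereal g \<le> L" by simp
qed

text \<open>
  If the limit of the difference quotients of \<open>f1\<close> were below some \<open>B < 2 C\<close>, then \<open>f\<close> would
  lie below the parabola \<open>w + g k + B / 2 k\<^sup>2\<close> to the right of \<open>x\<close>.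
\<close>

lemma ext_second_derivative_ge:
  fixes f f1 :: "real \<Rightarrow> ereal"
  assumes fx: "f x = ereal w" and f1x: "f1 x = ereal g"
    and cont: "(f \<longlongrightarrow> f x) (at x)" "(f1 \<longlongrightarrow> f1 x) (at x)"
    and d1: "\<forall>\<^sub>F t in at x. (ext_diff_quot f t \<longlongrightarrow> f1 t) (at t)"
    and d2: "(ext_diff_quot f1 x \<longlongrightarrow> L) (at x)"
    and k: "\<And>n. k n > 0" "k \<longlonglongrightarrow> 0"
    and le: "\<And>n. ereal (w + g * k n + c n * (k n)\<^sup>2) \<le> f (x + k n)"
    and c: "c \<longlonglongrightarrow> C"
  shows "ereal (2 * C) \<le> L"
proof (rule ccontr)
  assume "\<not> ereal (2 * C) \<le> L"
  then have "L < ereal (2 * C)" by simp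
  then obtain B where B: "L < ereal B" "B < 2 * C"
    using ereal_dense2[of L "ereal (2 * C)"] by (metis ereal_less_eq(3) less_ereal.simps(1))
  have fin: "\<forall>\<^sub>F t in at x. \<bar>h t\<bar> \<noteq> \<infinity>" if "(h \<longlongrightarrow> ereal r) (at x)" for h :: "real \<Rightarrow> ereal" and r
  proof -
    have "\<forall>\<^sub>F t in at x. h t \<in> {- \<infinity><..<\<infinity>}"
      using that by (rule topological_tendstoD) auto
    then show ?thesis by eventually_elim auto
  qed
  have "\<forall>\<^sub>F t in at x. ext_diff_quot f1 x t < ereal B"
    using d2 B(1) by (rule order_tendstoD)
  then have "\<forall>\<^sub>F t in at x. \<bar>f t\<bar> \<noteq> \<infinity> \<and> \<bar>f1 t\<bar> \<noteq> \<infinity> \<and> (ext_diff_quot f t \<longlongrightarrow> f1 t) (at t) \<and>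
      ext_diff_quot f1 x t < ereal B"
    using d1 fin[OF cont(1)[unfolded fx]] fin[OF cont(2)[unfolded f1x]] by eventually_elim auto
  then obtain e where e: "e > 0" and P: "\<And>t. x < t \<Longrightarrow> t < x + e \<Longrightarrow> \<bar>f t\<bar> \<noteq> \<infinity> \<and> \<bar>f1 t\<bar> \<noteq> \<infinity> \<and>
      (ext_diff_quot f t \<longlongrightarrow> f1 t) (at t) \<and> ext_diff_quot f1 x t < ereal B"
    unfolding eventually_at by (auto simp: dist_real_def)
  define wr where "wr t = real_of_ereal (f t)" for t
  define g1 where "g1 t = real_of_ereal (f1 t)" for t
  have fwr: "f t = ereal (wr t)" "f1 t = ereal (g1 t)" if "x < t" "t < x + e" for t
    using P[OF that] by (simp_all add: wr_def g1_def ereal_real')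
  have wrx: "wr x = w" by (simp add: wr_def fx)
  have D: "(wr has_real_derivative g1 t) (at t)" if t: "x < t" "t < x + e" for t
  proof -
    have "((\<lambda>y. ereal ((wr y - wr t) / (y - t))) \<longlongrightarrow> ereal (g1 t)) (at t)"
    proof (rule Lim_transform_eventually)
      show "(ext_diff_quot f t \<longlongrightarrow> ereal (g1 t)) (at t)"
        using P[OF t] fwr(2)[OF t] by simp
      have "\<forall>\<^sub>F y in at t. y \<in> {x<..<x + e}"
        using t by (intro eventually_at_in_open') auto
      then show "\<forall>\<^sub>F y in at t. ext_diff_quot f t y = ereal ((wr y - wr t) / (y - t))"
        using eventually_neq_at_within[of t] 
        by eventually_elim (use t in \<open>simp add: ext_diff_quot_def fwr\<close>)
    qed
    then show ?thesis unfolding has_field_derivative_iff by simp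
  qed
  have below: "wr (x + l) < w + g * l + B / 2 * l\<^sup>2" if l: "0 < l" "l < e" for l
  proof -
    \<comment> \<open>The deviation from the parabola. Its derivative is negative because the
      difference quotient of \<open>f1\<close> at x stays below \<open>B\<close>.\<close>
    define h where "h t = wr t - g * (t - x) - B / 2 * (t - x)\<^sup>2" for t
    have "h (x + l) < h x"
    proof (rule DERIV_neg_imp_decreasing_open[of x "x + l" h])
      show "x < x + l" using l by simp
      fix t assume t: "x < t" "t < x + l"
      then have t': "x < t" "t < x + e" using l by auto
      have "(h has_real_derivative g1 t - g - B * (t - x)) (at t)"
        unfolding h_def by (auto intro!: derivative_eq_intros D[OF t'])
      moreover have "(g1 t - g) / (t - x) < B"
        using P[OF t'] t' by (simp add: ext_diff_quot_def f1x fwr)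
      then have "g1 t - g - B * (t - x) < 0"
        using t by (simp add: pos_divide_less_eq)
      ultimately show "\<exists>y. (h has_real_derivative y) (at t) \<and> y < 0" by blast
    next
      \<comment> \<open>The derivative of \<open>wr\<close> is available only to the right of x; at
        x itself continuity comes from the limit of \<open>f\<close>.\<close>
      have "continuous (at t within {x..x + l}) wr" if t: "t \<in> {x..x + l}" for t
      proof (cases "t = x")
        case True
        have "((\<lambda>y. real_of_ereal (f y)) \<longlongrightarrow> w) (at x)"
          using cont(1) unfolding fx by (rule lim_real_of_ereal)
        then have "(wr \<longlongrightarrow> wr x) (at x)" by (simp add: wr_def[abs_def] fx)
        then show ?thesis
          unfolding continuous_within True by (rule tendsto_within_subset) simp
      next
        case False
        then have "(wr has_real_derivative g1 t) (at t)" using t l by (intro D) auto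
        then show ?thesis
          by (rule continuous_at_imp_continuous_at_within[OF DERIV_isCont])
      qed
      then have "continuous_on {x..x + l} wr"
        by (simp add: continuous_on_eq_continuous_within)
      then show "continuous_on {x..x + l} h"
        unfolding h_def by (intro continuous_intros)
    qed
    then show ?thesis by (simp add: h_def wrx)
  qed
  have "\<forall>\<^sub>F n in sequentially. k n < e"
    using k(2) e by (rule order_tendstoD)
  then have "\<forall>\<^sub>F n in sequentially. c n \<le> B / 2"
  proof eventually_elim
    case (elim n)
    have "f (x + k n) = ereal (wr (x + k n))" using elim k(1)[of n] by (intro fwr) auto
    then have "w + g * k n + c n * (k n)\<^sup>2 \<le> wr (x + k n)" using le[of n] by simp
    also have "\<dots> < w + g * k n + B / 2 * (k n)\<^sup>2" using elim k(1)[of n] by (intro below)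
    finally have "c n * (k n)\<^sup>2 < B / 2 * (k n)\<^sup>2" by simp
    then show ?case using k(1)[of n] by (simp add: mult_less_cancel_right split: if_splits)
  qed
  from tendsto_upperbound[OF c this] have "C \<le> B / 2" by simp
  with B(2) show False by simp
qed

text \<open>Here y is the relative change of the squared radius, the variable in which
  \<open>v\<close> is differentiated. The squared chord is scaled by the square root of 1 + y,
  whence the exponent - s / 4.\<close>

definition riesz_radial :: "real \<Rightarrow> real \<Rightarrow> real" where
  "riesz_radial s y = (if s = 0 then ln (1 + y) / 4 else (1 - (1 + y) powr (- s / 4)) / s)"

lemma riesz_radial_0 [simp]: "riesz_radial s 0 = 0"
  by (simp add: riesz_radial_def)

lemma riesz_radial_has_derivative:
  assumes "y > - 1"
  shows "(riesz_radial s has_real_derivative (1 + y) powr (- s / 4 - 1) / 4) (at y)"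
proof (cases "s = 0")
  case True
  have "((\<lambda>y. ln (1 + y) / 4) has_real_derivative (1 / (1 + y)) / 4) (at y)"
    by (intro DERIV_cdivide) (use assms in \<open>auto intro!: derivative_eq_intros\<close>)
  then show ?thesis
    using True assms by (simp add: riesz_radial_def[abs_def] powr_minus_divide mult.commute)
next
  case False
  have "((\<lambda>y. (1 + y) powr (- s / 4)) has_real_derivative (- s / 4) * (1 + y) powr (- s / 4 - 1) * (0 + 1)) (at y)"
    using assms by (intro DERIV_chain2[OF has_real_derivative_powr] DERIV_add DERIV_const DERIV_ident) auto
  then have "((\<lambda>y. (1 - (1 + y) powr (- s / 4)) / s) has_real_derivative
      (0 - (- s / 4) * (1 + y) powr (- s / 4 - 1) * (0 + 1)) / s) (at y)"
    by (intro DERIV_cdivide DERIV_diff DERIV_const)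
  then show ?thesis
    using False by (simp add: riesz_radial_def[abs_def])
qed

text \<open>The derivative is (1 + y) powr (- m) / 4 with m = s / 4 + 1. Bernoulli's inequality
  bounds it below by (1 - m y) / 4, and integration gives the coefficient m / 8 = (s + 4) /
  32.\<close>

lemma riesz_radial_ge:
  assumes s: "s > - 4" and y: "y \<ge> 0"
  shows "y / 4 - (s + 4) / 32 * y\<^sup>2 \<le> riesz_radial s y"
proof -
  define m where "m = s / 4 + 1"
  have m: "m > 0" "- s / 4 - 1 = - m" "(s + 4) / 32 = m / 8" using s by (auto simp: m_def field_simps)
  have bern: "1 - m * z \<le> (1 + z) powr (- m)" if "z \<ge> 0" for z
  proof -
    have "- m * z \<le> - m * ln (1 + z)"
      using m ln_add_one_self_le_self[OF that] by simp
    then have "1 - m * z \<le> 1 + (- m * ln (1 + z))" by simp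
    also have "\<dots> \<le> exp (- m * ln (1 + z))" by (rule exp_ge_add_one_self)
    also have "\<dots> = (1 + z) powr (- m)" using that by (simp add: powr_def)
    finally show ?thesis .
  qed
  define h where "h z = riesz_radial s z - (z / 4 - m / 8 * z\<^sup>2)" for z
  have "h 0 \<le> h y"
  proof (rule DERIV_nonneg_imp_nondecreasing[OF y])
    fix z :: real assume z: "0 \<le> z" "z \<le> y"
    have "(h has_real_derivative (1 + z) powr (- m) / 4 - (1 - m * z) / 4) (at z)"
      unfolding h_def
      by (rule DERIV_cong[OF DERIV_diff[OF riesz_radial_has_derivative[of z s, unfolded m(2)]]], use z in simp)
        (auto intro!: derivative_eq_intros simp: diff_divide_distrib)
    then show "\<exists>y. (h has_real_derivative y) (at z) \<and> 0 \<le> y"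
      using bern[OF z(1)] by (intro exI[of _ "(1 + z) powr (- m) / 4 - (1 - m * z) / 4"]) simp
  qed
  then show ?thesis by (simp add: h_def m)
qed

section \<open>Growth of the external field\<close>

text \<open>If the bound failed for every \<open>M\<close>, a discrete measure would have infinite
  negative energy. Its atoms come in antipodal pairs, because 2 r is the largest distance on the
  sphere of radius r and thus gives the strongest bound.\<close>

lemma energy_well_defined_growth:
  fixes v :: "real \<Rightarrow> ereal"
  assumes wd: "energy_well_defined s (\<lambda>x::'a::euclidean_space. v ((norm x)\<^sup>2))"
  shows "\<exists>M::real. \<forall>r>0. ereal (- M - riesz_sq s ((2 * r)\<^sup>2)) \<le> v (r\<^sup>2) + v (r\<^sup>2)"
proof (rule ccontr)
  let ?V = "\<lambda>x::'a. v ((norm x)\<^sup>2)"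
  assume "\<not> ?thesis"
  then have "\<forall>n. \<exists>r>0. v (r\<^sup>2) + v (r\<^sup>2) < ereal (- (real n * 2 ^ (4 * n + 3)) - riesz_sq s ((2 * r)\<^sup>2))"
    by (auto simp: not_le)
  then obtain r where r: "\<And>n. r n > 0"
    "\<And>n. v ((r n)\<^sup>2) + v ((r n)\<^sup>2) < ereal (- (real n * 2 ^ (4 * n + 3)) - riesz_sq s ((2 * r n)\<^sup>2))"
    by metis
  obtain u :: 'a where u: "u \<in> Basis" using nonempty_Basis by blast
  \<comment> \<open>Indices 2 n and 2 n + 1 form the n-th antipodal pair. Their geometric weights
    multiply to 2 ^ - (4 n + 3), which the factor 2 ^ (4 * n + 3) above compensates, so this pair
    alone contributes at least n.\<close>
  define y where "y k = (if even k then r (k div 2) *\<^sub>R u else - (r (k div 2) *\<^sub>R u))" for k :: nat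
  define \<mu> where "\<mu> = distr (measure_pmf (geometric_pmf (1 / 2))) borel y"
  have pm: "prob_space \<mu>" unfolding \<mu>_def by (rule measure_pmf.prob_space_distr) simp
  interpret prob_space \<mu> by (rule pm)
  have sets [measurable_cong, simp]: "sets \<mu> = sets borel" by (simp add: \<mu>_def)
  \<comment> \<open>Only an inequality, since different indices may give the same point.\<close>
  have atom: "ennreal ((1 / 2) ^ Suc k) \<le> emeasure \<mu> {y k}" for k
  proof -
    have "ennreal ((1 / 2) ^ Suc k) = emeasure (measure_pmf (geometric_pmf (1 / 2))) {k}"
      by (simp add: emeasure_pmf_single mult.commute)
    also have "\<dots> \<le> emeasure (measure_pmf (geometric_pmf (1 / 2))) (y -` {y k})"
      by (intro emeasure_mono) auto
    also have "\<dots> = emeasure \<mu> {y k}" by (simp add: \<mu>_def emeasure_distr)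
    finally show ?thesis .
  qed
  have "\<mu> \<in> borel_prob_measures" using pm by (simp add: borel_prob_measures_def)
  then have neg: "energy_neg s ?V \<mu> < \<infinity>" using wd by (simp add: energy_well_defined_def)
  have "ennreal (real n) \<le> energy_neg s ?V \<mu>" for n
  proof -
    define K where "K = real n * 2 ^ (4 * n + 3)"
    define z where "z = (y (2 * n), y (2 * n + 1))"
    have z: "z = (r n *\<^sub>R u, - (r n *\<^sub>R u))" by (simp add: z_def y_def)
    have ne: "fst z - snd z \<noteq> 0" "norm (fst z - snd z) = 2 * r n"
      using r(1)[of n] u by (auto simp: z simp flip: scaleR_add_left)
    have "riesz_kernel s (fst z - snd z) = ereal (riesz_sq s ((2 * r n)\<^sup>2))"
      using riesz_kernel_eq_riesz_sq[OF ne(1), of s] unfolding ne(2) .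
    then have "energy_integrand s ?V z = ereal (riesz_sq s ((2 * r n)\<^sup>2)) + (v ((r n)\<^sup>2) + v ((r n)\<^sup>2))"
      using u r(1)[of n] by (simp add: energy_integrand_def z add.assoc)
    also have "\<dots> \<le> ereal (riesz_sq s ((2 * r n)\<^sup>2)) + ereal (- K - riesz_sq s ((2 * r n)\<^sup>2))"
      using r(2)[of n] unfolding K_def by (intro add_left_mono less_imp_le)
    finally have "energy_integrand s ?V z \<le> ereal (- K)" by simp
    then have "ereal K \<le> - energy_integrand s ?V z"
      using ereal_minus_le_minus by (metis uminus_ereal.simps(1) minus_minus)
    then have K: "ennreal K \<le> e2ennreal (- energy_integrand s ?V z)"
      using e2ennreal_mono by fastforce
    have "ennreal (real n) = ennreal K * (ennreal ((1 / 2) ^ Suc (2 * n)) * ennreal ((1 / 2) ^ Suc (2 * n + 1)))"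
      by (simp add: K_def flip: ennreal_mult') (simp add: power_mult power_add power_divide flip: power_mult_distrib)
    also have "\<dots> \<le> ennreal K * (emeasure \<mu> {y (2 * n)} * emeasure \<mu> {y (2 * n + 1)})"
      by (intro mult_left_mono mult_mono atom) auto
    also have "\<dots> = ennreal K * emeasure (\<mu> \<Otimes>\<^sub>M \<mu>) {z}"
      using emeasure_pair_measure_Times[of "{y (2 * n)}" \<mu> "{y (2 * n + 1)}"] by (simp add: z_def)
    also have "\<dots> = (\<integral>\<^sup>+x. ennreal K * indicator {z} x \<partial>(\<mu> \<Otimes>\<^sub>M \<mu>))"
    proof (rule nn_integral_cmult_indicator[symmetric])
      have "{y (2 * n)} \<times> {y (2 * n + 1)} \<in> sets (\<mu> \<Otimes>\<^sub>M \<mu>)" by (intro pair_measureI) auto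
      then show "{z} \<in> sets (\<mu> \<Otimes>\<^sub>M \<mu>)" by (simp add: z_def)
    qed
    also have "\<dots> \<le> energy_neg s ?V \<mu>"
      unfolding energy_neg_def by (intro nn_integral_mono) (use K in \<open>auto simp: indicator_def\<close>)
    finally show ?thesis .
  qed
  then have "energy_neg s ?V \<mu> = \<infinity>"
  proof (cases "energy_neg s ?V \<mu>")
    case (real q)
    obtain n where "q < real n" using reals_Archimedean2 by blast
    with real \<open>\<And>n. ennreal (real n) \<le> energy_neg s ?V \<mu>\<close>[of n] show ?thesis
      by simp
  qed simp
  with neg show False by simp
qed

section \<open>Necessary conditions at the equilibrium radius\<close>

lemma Liminf_ge_of_tendsto:
  assumes "\<forall>\<^sub>F r in at_top. ereal (a + e r) \<le> F r" and "(e \<longlongrightarrow> 0) at_top"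
  shows "ereal a \<le> Liminf at_top (F :: real \<Rightarrow> ereal)"
proof -
  have lim: "((\<lambda>r. ereal (a + e r)) \<longlongrightarrow> ereal (a + 0)) at_top"
    using assms(2) by (intro tendsto_intros)
  have "Liminf at_top (\<lambda>r. ereal (a + e r)) = ereal (a + 0)"
    by (rule lim_imp_Liminf[OF _ lim]) simp
  then have "ereal a = Liminf at_top (\<lambda>r. ereal (a + e r))" by simp
  also have "\<dots> \<le> Liminf at_top F"
    by (rule Liminf_mono[OF assms(1)])
  finally show ?thesis .
qed

locale sphere_equilibrium = sphere_energy s v dim_type
  for s :: real and v :: "real \<Rightarrow> ereal" and dim_type :: "'a::euclidean_space itself" +
  fixes R :: real
  assumes R: "R > 0" and s3: "s < real DIM('a) - 3"
    and v_range: "\<forall>t\<ge>0. v t \<noteq> - \<infinity>"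
    and v_fin: "\<exists>b>0. \<bar>v (b\<^sup>2)\<bar> \<noteq> \<infinity>"
    and wd: "energy_well_defined s V"
    and eq: "equilibrium_measure s V (sphere_uniform R)"
begin

definition vR :: real where "vR = real_of_ereal (v (R\<^sup>2))"
definition self_pot :: real where "self_pot = law.sphere_pot s R R"
text \<open>Equal to s times \<open>self_pot\<close> if s \<noteq> 0 and to 1 if s = 0; it lets the
  derivative computations treat both kernels at once. It turns out to be 4 R^2 times the derivative
  of \<open>v\<close> at R^2.\<close>

definition \<kappa> :: real where "\<kappa> = R powr (- s) * c_const s DIM('a)"

lemma v_R: "v (R\<^sup>2) = ereal vR"
proof -
  from v_fin obtain b where "b > 0" "\<bar>v (b\<^sup>2)\<bar> \<noteq> \<infinity>" by (elim exE conjE)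
  then have "v (R\<^sup>2) \<noteq> \<infinity>" by (rule equilibrium_finite[OF eq R wd])
  moreover have "v (R\<^sup>2) \<noteq> - \<infinity>" using v_range by (meson zero_le_power2)
  ultimately have "\<bar>v (R\<^sup>2)\<bar> \<noteq> \<infinity>" by (rule ereal_infinity_cases)
  then show ?thesis unfolding vR_def by (rule ereal_real'[symmetric])
qed

lemma R_powr: "(R\<^sup>2) powr x = R powr (2 * x)"
proof -
  have "R powr 2 = R\<^sup>2" using R by simp
  then have "(R\<^sup>2) powr x = (R powr 2) powr x" by (simp only:)
  then show ?thesis by (simp only: powr_powr)
qed

lemma self_pot_eq:
  "self_pot = (if s = 0 then - ln R + b_const DIM('a) else R powr (- s) / s * c_const s DIM('a))"
proof -
  have "self_pot = riesz_scale s (R\<^sup>2) (riesz_self s DIM('a))"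
    unfolding self_pot_def using s by (intro law.sphere_pot_same R)
  then show ?thesis
    using R by (simp add: riesz_scale_def riesz_self_def R_powr ln_realpow)
qed

lemma \<kappa>_pos: "\<kappa> > 0"
  unfolding \<kappa>_def using R s dim2 by (intro mult_pos_pos c_const_pos) auto

lemma lower_bound:
  assumes "\<rho> > 0"
  shows "ereal (self_pot + vR - law.sphere_pot s \<rho> R) \<le> v (\<rho>\<^sup>2)"
  unfolding self_pot_def using v_range by (intro equilibrium_lower_bound[OF eq R assms v_R]) auto

lemma self_pot_minus_scale:
  assumes l: "l > 0"
  shows "self_pot - riesz_scale s l self_pot = \<kappa> * riesz_radial s (l\<^sup>2 - 1)"
proof (cases "s = 0")
  case True
  have "riesz_scale s l self_pot = self_pot - ln l / 2"
    by (simp add: True riesz_scale_def)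
  moreover have "\<kappa> = 1"
    unfolding \<kappa>_def using R True by (simp add: c_const_0)
  moreover have "riesz_radial s (l\<^sup>2 - 1) = ln l / 2"
    using l by (simp add: True riesz_radial_def ln_realpow)
  ultimately show ?thesis by simp
next
  case False
  have "l powr 2 = l\<^sup>2" using l by simp
  then have "(l\<^sup>2) powr (- s / 4) = (l powr 2) powr (- s / 4)" by (simp only:)
  also have "\<dots> = l powr (- s / 2)" unfolding powr_powr by simp
  finally have "(l\<^sup>2) powr (- s / 4) = l powr (- s / 2)" .
  then show ?thesis
    using False by (simp add: riesz_scale_def riesz_radial_def \<kappa>_def self_pot_eq field_simps)
qed

text \<open>The source of (i) and (ii): the \<open>riesz_radial\<close> term is the exact effect of
  scaling the chords, the last term the gain from convexity.\<close>

lemma radial_lower_bound: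
  assumes h: "R + h > 0"
  shows "ereal (vR + \<kappa> * riesz_radial s (((R + h)\<^sup>2 - R\<^sup>2) / R\<^sup>2) + h\<^sup>2 / 2 * law.tangent_gain s R h)
    \<le> v ((R + h)\<^sup>2)"
proof -
  have l: "1 + h / R > 0" using R h by (simp add: field_simps)
  have "(1 + h / R)\<^sup>2 - 1 = ((R + h)\<^sup>2 - R\<^sup>2) / R\<^sup>2"
    using R by (simp add: power2_eq_square field_simps)
  then have "vR + \<kappa> * riesz_radial s (((R + h)\<^sup>2 - R\<^sup>2) / R\<^sup>2) + h\<^sup>2 / 2 * law.tangent_gain s R h =
      vR + (self_pot - riesz_scale s (1 + h / R) self_pot) + h\<^sup>2 / 2 * law.tangent_gain s R h"
    using self_pot_minus_scale[OF l] by simp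
  also have "\<dots> \<le> self_pot + vR - law.sphere_pot s (R + h) R"
    using law.sphere_pot_upper_bound[OF s(1) s3 R h] by (simp add: self_pot_def)
  finally have "ereal (vR + \<kappa> * riesz_radial s (((R + h)\<^sup>2 - R\<^sup>2) / R\<^sup>2) + h\<^sup>2 / 2 * law.tangent_gain s R h)
      \<le> ereal (self_pot + vR - law.sphere_pot s (R + h) R)"
    by simp
  also have "\<dots> \<le> v ((R + h)\<^sup>2)" by (rule lower_bound[OF h])
  finally show ?thesis .
qed

text \<open>The nonnegative gain is dropped; what remains is a differentiable minorant touching
  \<open>v\<close> at R^2, with slope \<kappa> / 4 times 1 / R^2.\<close>

lemma first_derivative:
  assumes "(ext_diff_quot v (R\<^sup>2) \<longlongrightarrow> L) (at (R\<^sup>2))"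
  shows "L = ereal (\<kappa> / (4 * R\<^sup>2))"
proof (rule ext_derivative_eq_of_minorant[OF assms v_R])
  define G where "G t = \<kappa> * riesz_radial s ((t - R\<^sup>2) / R\<^sup>2)" for t
  have "((\<lambda>t. riesz_radial s ((t - R\<^sup>2) / R\<^sup>2)) has_real_derivative
      (1 + (R\<^sup>2 - R\<^sup>2) / R\<^sup>2) powr (- s / 4 - 1) / 4 * ((1 - 0) / R\<^sup>2)) (at (R\<^sup>2))"
    by (rule DERIV_chain2[OF riesz_radial_has_derivative
          DERIV_cdivide[OF DERIV_diff[OF DERIV_ident DERIV_const]]]) simp
  from DERIV_cmult[OF this, of \<kappa>]
  show "(G has_real_derivative \<kappa> / (4 * R\<^sup>2)) (at (R\<^sup>2))"
    unfolding G_def by simp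
  show "G (R\<^sup>2) = 0" by (simp add: G_def)
  have "\<forall>\<^sub>F t in at (R\<^sup>2). t \<in> {0<..}"
    using R by (intro eventually_at_in_open') auto
  then show "\<forall>\<^sub>F t in at (R\<^sup>2). ereal (vR + G t) \<le> v t"
  proof eventually_elim
    case (elim t)
    define h where "h = sqrt t - R"
    have h: "R + h > 0" "(R + h)\<^sup>2 = t" using elim by (simp_all add: h_def)
    have "vR + G t \<le> vR + G t + h\<^sup>2 / 2 * law.tangent_gain s R h"
      using law.tangent_gain_nonneg by simp
    then have "ereal (vR + G t) \<le> ereal (vR + G t + h\<^sup>2 / 2 * law.tangent_gain s R h)" by simp
    also have "\<dots> \<le> v t"
      using radial_lower_bound[OF h(1)] unfolding h(2) G_def .
    finally show ?case .
  qed
qed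

text \<open>With k the change of the squared radius, the first quadratic coefficient comes from
  \<open>riesz_radial_ge\<close> at y = k / R^2. The second is half the limiting gain times the
  limit 1 / (4 R^2) of (h / k)^2. The outer factor 2 passes from Taylor coefficient to
  derivative.\<close>

lemma second_derivative:
  fixes v1 :: "real \<Rightarrow> ereal"
  assumes v1: "v1 (R\<^sup>2) = ereal (\<kappa> / (4 * R\<^sup>2))"
    and cont: "(v \<longlongrightarrow> v (R\<^sup>2)) (at (R\<^sup>2))" "(v1 \<longlongrightarrow> v1 (R\<^sup>2)) (at (R\<^sup>2))"
    and d1: "\<forall>\<^sub>F t in at (R\<^sup>2). (ext_diff_quot v t \<longlongrightarrow> v1 t) (at t)"
    and d2: "(ext_diff_quot v1 (R\<^sup>2) \<longlongrightarrow> L) (at (R\<^sup>2))"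
  shows "ereal (2 * (- \<kappa> * (s + 4) / (32 * R ^ 4) +
    R powr (- s - 2) * c_const (s + 2) DIM('a) / (8 * R\<^sup>2))) \<le> L"
proof (rule ext_second_derivative_ge[OF v_R v1 cont d1 d2])
  define h where "h n = 1 / real (Suc n)" for n
  define k where "k n = (R + h n)\<^sup>2 - R\<^sup>2" for n
  define c where "c n = - \<kappa> * (s + 4) / (32 * R ^ 4) + (h n / k n)\<^sup>2 / 2 * law.tangent_gain s R (h n)" for n
  have h: "h n > 0" for n by (simp add: h_def)
  have kh: "k n = h n * (2 * R + h n)" for n by (simp add: k_def power2_eq_square algebra_simps)
  show k: "k n > 0" for n unfolding kh using h[of n] R by simp
  have h0: "h \<longlonglongrightarrow> 0" unfolding h_def by real_asymp
  have "k \<longlonglongrightarrow> 0 * (2 * R + 0)" unfolding kh[abs_def] by (intro tendsto_intros h0)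
  then show "k \<longlonglongrightarrow> 0" by simp
  have "(\<lambda>n. 1 / (2 * R + h n)) \<longlonglongrightarrow> 1 / (2 * R + 0)"
    using R by (intro tendsto_intros h0) auto
  moreover have "1 / (2 * R + h n) = h n / k n" for n
    using h[of n] by (simp add: kh)
  ultimately have hk: "(\<lambda>n. h n / k n) \<longlonglongrightarrow> 1 / (2 * R)" by simp
  have "c \<longlonglongrightarrow> - \<kappa> * (s + 4) / (32 * R ^ 4) +
      (1 / (2 * R))\<^sup>2 / 2 * (R powr (- s - 2) * c_const (s + 2) DIM('a))"
    unfolding c_def h_def
    by (intro tendsto_intros hk[unfolded h_def] law.tangent_gain_tendsto s s3 R) auto
  then show "c \<longlonglongrightarrow> - \<kappa> * (s + 4) / (32 * R ^ 4) +
      R powr (- s - 2) * c_const (s + 2) DIM('a) / (8 * R\<^sup>2)"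
    by (simp add: power2_eq_square mult_ac)
  show "ereal (vR + \<kappa> / (4 * R\<^sup>2) * k n + c n * (k n)\<^sup>2) \<le> v (R\<^sup>2 + k n)" for n
  proof -
    have y: "k n / R\<^sup>2 \<ge> 0" using k[of n] R by simp
    have "k n / R\<^sup>2 / 4 - (s + 4) / 32 * (k n / R\<^sup>2)\<^sup>2 \<le> riesz_radial s (k n / R\<^sup>2)"
      using s by (intro riesz_radial_ge y) auto
    then have "\<kappa> * (k n / R\<^sup>2 / 4 - (s + 4) / 32 * (k n / R\<^sup>2)\<^sup>2) \<le> \<kappa> * riesz_radial s (k n / R\<^sup>2)"
      using \<kappa>_pos by (intro mult_left_mono) auto
    moreover have "\<kappa> * (k n / R\<^sup>2 / 4 - (s + 4) / 32 * (k n / R\<^sup>2)\<^sup>2) =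
        \<kappa> / (4 * R\<^sup>2) * k n - \<kappa> * (s + 4) / (32 * R ^ 4) * (k n)\<^sup>2"
      using R by (simp add: field_simps power2_eq_square power4_eq_xxxx)
    moreover have "(h n / k n)\<^sup>2 / 2 * law.tangent_gain s R (h n) * (k n)\<^sup>2 =
        (h n)\<^sup>2 / 2 * law.tangent_gain s R (h n)"
      using k[of n] by (simp add: power_divide)
    then have "c n * (k n)\<^sup>2 = - \<kappa> * (s + 4) / (32 * R ^ 4) * (k n)\<^sup>2 +
        (h n)\<^sup>2 / 2 * law.tangent_gain s R (h n)"
      unfolding c_def by (simp only: distrib_right)
    ultimately have "vR + \<kappa> / (4 * R\<^sup>2) * k n + c n * (k n)\<^sup>2 \<le>
        vR + \<kappa> * riesz_radial s (k n / R\<^sup>2) + (h n)\<^sup>2 / 2 * law.tangent_gain s R (h n)"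
      by simp
    moreover have "R + h n > 0" using R h[of n] by simp
    from radial_lower_bound[OF this]
    have "ereal (vR + \<kappa> * riesz_radial s (k n / R\<^sup>2) + (h n)\<^sup>2 / 2 * law.tangent_gain s R (h n)) \<le> v (R\<^sup>2 + k n)"
      by (simp add: k_def)
    ultimately show ?thesis by (meson ereal_less_eq(3) order_trans)
  qed
qed

section \<open>The field at the origin and at infinity\<close>

lemma v_tendsto_at_0: "((\<lambda>r. v (r\<^sup>2)) \<longlongrightarrow> v 0) (at_right 0)"
proof -
  have "(v \<longlongrightarrow> v 0) (at 0 within {0..})"
    using v_cont by (simp add: continuous_on_def)
  moreover have "filterlim (\<lambda>r::real. r\<^sup>2) (at 0 within {0..}) (at_right 0)"
    unfolding filterlim_at
  proof (intro conjI)
    have "((\<lambda>r::real. r\<^sup>2) \<longlongrightarrow> 0\<^sup>2) (at_right 0)" by (intro tendsto_intros)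
    then show "((\<lambda>r::real. r\<^sup>2) \<longlongrightarrow> 0) (at_right 0)" by simp
    show "\<forall>\<^sub>F r::real in at_right 0. r\<^sup>2 \<in> {0..} \<and> r\<^sup>2 \<noteq> 0"
      using eventually_at_right_less[of "0::real"] by eventually_elim auto
  qed
  ultimately show ?thesis by (rule filterlim_compose)
qed

lemma lower_bound_away:
  assumes "\<rho> > 0" "\<rho> \<noteq> R"
  shows "ereal (self_pot + vR - riesz_sq s ((\<rho> - R)\<^sup>2)) \<le> v (\<rho>\<^sup>2)"
proof -
  have "law.sphere_pot s \<rho> R \<le> riesz_sq s ((\<rho> - R)\<^sup>2)"
    using s assms by (intro law.sphere_pot_le R) auto
  then have "ereal (self_pot + vR - riesz_sq s ((\<rho> - R)\<^sup>2)) \<le> ereal (self_pot + vR - law.sphere_pot s \<rho> R)"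
    by simp
  also have "\<dots> \<le> v (\<rho>\<^sup>2)" by (rule lower_bound[OF assms(1)])
  finally show ?thesis .
qed

lemma v_0_ge: "ereal (self_pot + vR - riesz_sq s (R\<^sup>2)) \<le> v 0"
proof (rule tendsto_le[OF _ v_tendsto_at_0])
  have "isCont (riesz_sq s) (R\<^sup>2)"
    using R by (intro DERIV_isCont[OF riesz_sq_has_derivative]) auto
  moreover have "((\<lambda>\<rho>. (\<rho> - R)\<^sup>2) \<longlongrightarrow> (0 - R)\<^sup>2) (at_right 0)" by (intro tendsto_intros)
  ultimately have "((\<lambda>\<rho>. riesz_sq s ((\<rho> - R)\<^sup>2)) \<longlongrightarrow> riesz_sq s (R\<^sup>2)) (at_right 0)"
    by (intro isCont_tendsto_compose[of "R\<^sup>2" "riesz_sq s"]) auto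
  then show "((\<lambda>\<rho>. ereal (self_pot + vR - riesz_sq s ((\<rho> - R)\<^sup>2))) \<longlongrightarrow>
      ereal (self_pot + vR - riesz_sq s (R\<^sup>2))) (at_right 0)"
    by (intro tendsto_intros)
  have "\<forall>\<^sub>F \<rho> in at_right 0. \<rho> \<in> {0<..<R}"
    by (rule eventually_at_right_real[OF R])
  then show "\<forall>\<^sub>F \<rho> in at_right 0. ereal (self_pot + vR - riesz_sq s ((\<rho> - R)\<^sup>2)) \<le> v (\<rho>\<^sup>2)"
    by eventually_elim (intro lower_bound_away; auto)
qed simp

text \<open>The potential is at most the kernel at r - R, while the claim has r + R. The squares
  differ by 4 r R and the kernel has slope of order r powr (- s - 2), so the gap is of order r powr
  (- s - 1) and vanishes for s > -1.\<close>

lemma liminf_at_infinity: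
  assumes s1: "s > - 1"
  shows "ereal (vR + self_pot) \<le> Liminf at_top (\<lambda>r. ereal (riesz_sq s ((R + r)\<^sup>2)) + v (r\<^sup>2))"
proof (rule Liminf_ge_of_tendsto)
  define e where "e r = - (2 * r * R * (r - R) powr (- s - 2))" for r
  show "(e \<longlongrightarrow> 0) at_top"
    unfolding e_def using s1 by real_asymp
  show "\<forall>\<^sub>F r in at_top. ereal (vR + self_pot + e r) \<le> ereal (riesz_sq s ((R + r)\<^sup>2)) + v (r\<^sup>2)"
    using eventually_gt_at_top[of R]
  proof eventually_elim
    case (elim r)
    have "(r - R) powr 2 = (r - R)\<^sup>2" using elim by simp
    then have "((r - R)\<^sup>2) powr (- s / 2 - 1) = ((r - R) powr 2) powr (- s / 2 - 1)" by (simp only:)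
    also have "\<dots> = (r - R) powr (- s - 2)" unfolding powr_powr by (simp add: algebra_simps)
    finally have p: "((r - R)\<^sup>2) powr (- s / 2 - 1) = (r - R) powr (- s - 2)" .
    have "riesz_sq s ((r - R)\<^sup>2) - 4 * r * R / 2 * ((r - R)\<^sup>2) powr (- s / 2 - 1) \<le>
        riesz_sq s ((r - R)\<^sup>2 + 4 * r * R)"
      using elim R s by (intro riesz_sq_add_ge) auto
    also have "(r - R)\<^sup>2 + 4 * r * R = (R + r)\<^sup>2" by (simp add: power2_eq_square algebra_simps)
    finally have "vR + self_pot + e r \<le> riesz_sq s ((R + r)\<^sup>2) + (self_pot + vR - riesz_sq s ((r - R)\<^sup>2))"
      unfolding p e_def by (simp add: algebra_simps)
    then have "ereal (vR + self_pot + e r) \<le> ereal (riesz_sq s ((R + r)\<^sup>2)) + ereal (self_pot + vR - riesz_sq s ((r - R)\<^sup>2))"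
      by simp
    also have "\<dots> \<le> ereal (riesz_sq s ((R + r)\<^sup>2)) + v (r\<^sup>2)"
      using elim R by (intro add_left_mono lower_bound_away) auto
    finally show ?case .
  qed
qed

lemma liminf_at_infinity_minus_one:
  assumes s1: "s = - 1"
  shows "ereal (vR + self_pot) \<le> Liminf at_top (\<lambda>r. ereal (- r) + v (r\<^sup>2))"
proof (rule Liminf_bounded)
  show "\<forall>\<^sub>F r in at_top. ereal (vR + self_pot) \<le> ereal (- r) + v (r\<^sup>2)"
    using eventually_gt_at_top[of 0]
  proof eventually_elim
    case (elim r)
    have "law.sphere_pot s r R \<le> - r"
      unfolding s1 using dim2 elim R by (intro law.sphere_pot_minus_one_le) auto
    then have "ereal (vR + self_pot) \<le> ereal (- r) + ereal (self_pot + vR - law.sphere_pot s r R)"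
      by simp
    also have "\<dots> \<le> ereal (- r) + v (r\<^sup>2)"
      by (intro add_left_mono lower_bound elim)
    finally show ?case .
  qed
qed

text \<open>
  For \<open>s < - 1\<close> the lower bound on \<open>v\<close> from the equilibrium condition is too weak, but existence of
  the energy of all measures forces \<open>v\<close> to grow strictly faster than the kernel.
\<close>

lemma liminf_at_infinity_less_minus_one:
  assumes s1: "s < - 1"
  shows "C \<le> Liminf at_top (\<lambda>r. ereal (riesz_sq s ((R + r)\<^sup>2)) + v (r\<^sup>2))"
proof -
  define q where "q = - s"
  have q: "1 < q" "q < 2" using s s1 by (auto simp: q_def)
  have rs: "riesz_sq s (x\<^sup>2) = - (x powr q / q)" if "x > 0" for x
  proof -
    have "x powr 2 = x\<^sup>2" using that by simp
    then have "(x\<^sup>2) powr (- s / 2) = (x powr 2) powr (- s / 2)" by (simp only:)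
    also have "\<dots> = x powr q" unfolding powr_powr by (simp add: q_def)
    finally show ?thesis using q by (simp add: riesz_sq_def q_def)
  qed
  obtain M where M: "\<And>r. r > 0 \<Longrightarrow> ereal (- M - riesz_sq s ((2 * r)\<^sup>2)) \<le> v (r\<^sup>2) + v (r\<^sup>2)"
    using energy_well_defined_growth[OF wd] by blast
  define h where "h r = - ((R + r) powr q / q) + ((2 * r) powr q / q - M) / 2" for r
  have ev: "\<forall>\<^sub>F r in at_top. ereal (h r) \<le> ereal (riesz_sq s ((R + r)\<^sup>2)) + v (r\<^sup>2)"
    using eventually_gt_at_top[of 0]
  proof eventually_elim
    case (elim r)
    have r2: "2 * r > 0" using elim by simp
    have "ereal (((2 * r) powr q / q - M) / 2) \<le> v (r\<^sup>2)"
      using M[OF elim, unfolded rs[OF r2]] v_range by (cases "v (r\<^sup>2)") auto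
    then have "ereal (- ((R + r) powr q / q)) + ereal (((2 * r) powr q / q - M) / 2) \<le>
        ereal (- ((R + r) powr q / q)) + v (r\<^sup>2)"
      by (rule add_left_mono)
    then show ?case using elim R by (simp add: h_def rs)
  qed
  have "filterlim h at_top at_top"
  proof -
    have "((\<lambda>r. 2 powr q / 2 - (1 + R / r) powr q) \<longlongrightarrow> 2 powr q / 2 - 1) at_top"
      by real_asymp
    \<comment> \<open>Here s < -1, that is q > 1, decides: half of (2 r) powr q outgrows (R + r)
      powr q.\<close>
    moreover have "2 powr q / 2 - 1 > 0"
      using powr_less_mono[of 1 q 2] q by simp
    moreover have "filterlim (\<lambda>r. r powr q / q) at_top at_top"
      using q by real_asymp
    ultimately have "filterlim (\<lambda>r. (2 powr q / 2 - (1 + R / r) powr q) * (r powr q / q)) at_top at_top"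
      by (rule filterlim_tendsto_pos_mult_at_top)
    then have "filterlim (\<lambda>r. - (M / 2) + (2 powr q / 2 - (1 + R / r) powr q) * (r powr q / q)) at_top at_top"
      by (rule filterlim_tendsto_add_at_top[OF tendsto_const])
    moreover have "\<forall>\<^sub>F r in at_top. - (M / 2) + (2 powr q / 2 - (1 + R / r) powr q) * (r powr q / q) = h r"
      using eventually_gt_at_top[of 0]
    proof eventually_elim
      case (elim r)
      have "(1 + R / r) * r = R + r" using elim by (simp add: distrib_right)
      then have "(R + r) powr q = ((1 + R / r) * r) powr q" by (simp only:)
      also have "\<dots> = (1 + R / r) powr q * r powr q" using elim R by (intro powr_mult)
      finally have "(R + r) powr q = (1 + R / r) powr q * r powr q" .
      moreover have "(2 * r) powr q = 2 powr q * r powr q" using elim by (intro powr_mult)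
      ultimately show ?case
        using q by (simp add: h_def field_simps)
    qed
    ultimately show ?thesis by (rule filterlim_mono_eventually[OF _ order_refl order_refl])
  qed
  have "Liminf at_top (\<lambda>r. ereal (riesz_sq s ((R + r)\<^sup>2)) + v (r\<^sup>2)) = \<infinity>"
  proof -
    have "ereal B \<le> Liminf at_top (\<lambda>r. ereal (riesz_sq s ((R + r)\<^sup>2)) + v (r\<^sup>2))" for B
    proof (rule Liminf_bounded)
      have "\<forall>\<^sub>F r in at_top. B \<le> h r"
        using \<open>filterlim h at_top at_top\<close> by (simp add: filterlim_at_top)
      with ev show "\<forall>\<^sub>F r in at_top. ereal B \<le> ereal (riesz_sq s ((R + r)\<^sup>2)) + v (r\<^sup>2)"
      proof eventually_elim
        case (elim r)
        then show ?case by (meson ereal_less_eq(3) order_trans)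
      qed
    qed
    then show ?thesis by (rule ereal_top)
  qed
  then show ?thesis by simp
qed

end

lemma ext_differentiable_tendsto:
  assumes "ext_differentiable {0..} f x" "x > 0"
  shows "(ext_diff_quot f x \<longlongrightarrow> ext_deriv {0..} f x) (at x)"
proof -
  obtain L where L: "(ext_diff_quot f x \<longlongrightarrow> L) (at x)"
    using assms unfolding ext_differentiable_def at_within_atLeast_0[OF assms(2)] by blast
  moreover have "ext_deriv {0..} f x = L"
    unfolding ext_deriv_def at_within_atLeast_0[OF assms(2)] using L by (intro tendsto_Lim) auto
  ultimately show ?thesis by simp
qed

text \<open>Continuity provides the limits at 0, but \<open>v\<close> need not have a limit at
  infinity; \<open>Liminf\<close> gives the bound for the limit whenever that exists. For s = -1 the
  kernel term contains r instead of R + r: the mutual energy of the spheres is asymptotically - r,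
  and the difference R would not vanish.\<close>

theorem theorem1p3:
  fixes s R :: real and d :: nat and v :: "real \<Rightarrow> ereal"
    and V :: "real^'n::finite \<Rightarrow> ereal" and v' v'' :: "real \<Rightarrow> ereal"
  assumes d: "d = CARD('n)" "d \<ge> 2"
    and s: "-2 < s" "s < real d - 3"
    and v_range: "\<forall>t\<ge>0. v t \<noteq> -\<infinity>"
    and v_lsc: "lsc_on {0..} v"
    and v_bdd: "\<exists>m::real. \<forall>t\<ge>0. ereal m \<le> v t"
    and v_fin: "\<exists>a b. 0 \<le> a \<and> a < b \<and> (\<forall>t\<in>{a<..<b}. \<bar>v t\<bar> \<noteq> \<infinity>)"
    and v_C2: "ext_Ck_on 2 {0..} v"
    and V_def: "V = (\<lambda>x. v ((norm x)\<^sup>2))"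
    and wd: "energy_well_defined s V"
    and v'_def: "v' = ext_deriv {0..} v"
    and v''_def: "v'' = (ext_deriv {0..} ^^ 2) v"
    and R: "R > 0"
    and eq: "equilibrium_measure s V (sphere_uniform R :: (real^'n) measure)"
  shows "ereal (R powr (s + 2)) * v' (R\<^sup>2) = ereal (c_const s d / 4)
    \<and> ereal (R\<^sup>2) * (v'' (R\<^sup>2) / v' (R\<^sup>2))
        \<ge> ereal (- ((s + 2) * (real d - s - 4) / (4 * (real d - s - 3))))
    \<and> (s \<noteq> 0 \<longrightarrow>
          (\<exists>L. ((\<lambda>r. ereal (R powr s) * (v (r\<^sup>2) - v (R\<^sup>2))) \<longlongrightarrow> L) (at_right 0)
             \<and> L \<ge> ereal ((c_const s d - 1) / s)))
    \<and> (s = 0 \<longrightarrow>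
          (\<exists>L. ((\<lambda>r. v (r\<^sup>2) - v (R\<^sup>2)) \<longlongrightarrow> L) (at_right 0) \<and> L \<ge> ereal (b_const d)))
    \<and> (s \<noteq> 0 \<and> s \<noteq> -1 \<longrightarrow>
          v (R\<^sup>2) + ereal (R powr (- s) / s * c_const s d)
            \<le> Liminf at_top (\<lambda>r::real. ereal ((R + r) powr (- s) / s) + v (r\<^sup>2)))
    \<and> (s = -1 \<longrightarrow>
          v (R\<^sup>2) + ereal (R powr (- s) / s * c_const s d)
            \<le> Liminf at_top (\<lambda>r::real. ereal (r powr (- s) / s) + v (r\<^sup>2)))
    \<and> (s = 0 \<longrightarrow>
          ereal (- ln R + b_const d) + v (R\<^sup>2)
            \<le> Liminf at_top (\<lambda>r::real. ereal (- ln (R + r)) + v (r\<^sup>2)))"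
proof -
  have DIM: "DIM(real^'n) = d" using d by simp
  have "continuous_on {0..} v"
    using v_C2 unfolding ext_Ck_on_def continuous_on_def by (metis funpow_0 le0)
  moreover obtain a b where ab: "0 \<le> a" "a < b" "\<forall>t\<in>{a<..<b}. \<bar>v t\<bar> \<noteq> \<infinity>"
    using v_fin by blast
  have "sqrt ((a + b) / 2) > 0" "(sqrt ((a + b) / 2))\<^sup>2 \<in> {a<..<b}"
    using ab by auto
  then have "\<exists>b>0. \<bar>v (b\<^sup>2)\<bar> \<noteq> \<infinity>"
    by (intro exI[of _ "sqrt ((a + b) / 2)"] conjI bspec[OF ab(3)])
  ultimately interpret E: sphere_equilibrium s v "TYPE(real^'n)" R
    using s d v_range R wd eq unfolding V_def by unfold_locales simp_all
  have R2: "R\<^sup>2 > 0" using R by simp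
  have diff: "ext_differentiable {0..} v t" "ext_differentiable {0..} v' t" if "t > 0" for t
    using v_C2[unfolded ext_Ck_on_def, THEN conjunct1, rule_format, of 0 t]
      v_C2[unfolded ext_Ck_on_def, THEN conjunct1, rule_format, of 1 t] that
    by (simp_all add: v'_def)
  have v'': "v'' = ext_deriv {0..} v'"
    by (simp add: v''_def v'_def numeral_2_eq_2)
  have cont: "(v \<longlongrightarrow> v (R\<^sup>2)) (at (R\<^sup>2))" "(v' \<longlongrightarrow> v' (R\<^sup>2)) (at (R\<^sup>2))"
    using v_C2[unfolded ext_Ck_on_def, THEN conjunct2, rule_format, THEN conjunct2, rule_format, of 0 "R\<^sup>2"]
      v_C2[unfolded ext_Ck_on_def, THEN conjunct2, rule_format, THEN conjunct2, rule_format, of 1 "R\<^sup>2"] R2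
    by (simp_all add: v'_def at_within_atLeast_0[OF R2] del: zero_less_power2)
  define c where "c = c_const s d"
  have c: "c > 0" unfolding c_def using d s by (intro c_const_pos) auto
  have \<kappa>: "E.\<kappa> = R powr (- s) * c" unfolding E.\<kappa>_def c_def DIM ..
  define g where "g = E.\<kappa> / (4 * R\<^sup>2)"
  have g: "g > 0" using E.\<kappa>_pos R2 by (simp add: g_def)
  have d1: "(ext_diff_quot v t \<longlongrightarrow> v' t) (at t)" if "t > 0" for t
    unfolding v'_def by (rule ext_differentiable_tendsto[OF diff(1)[OF that] that])
  have v': "v' (R\<^sup>2) = ereal g"
    unfolding g_def by (rule E.first_derivative[OF d1[OF R2]])
  have "\<forall>\<^sub>F t in at (R\<^sup>2). t \<in> {0<..}"
    using R by (intro eventually_at_in_open') auto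
  then have ev: "\<forall>\<^sub>F t in at (R\<^sup>2). (ext_diff_quot v t \<longlongrightarrow> v' t) (at t)"
    by eventually_elim (use d1 in auto)
  have d2: "(ext_diff_quot v' (R\<^sup>2) \<longlongrightarrow> v'' (R\<^sup>2)) (at (R\<^sup>2))"
    unfolding v'' by (rule ext_differentiable_tendsto[OF diff(2)[OF R2] R2])
  define m where "m = 2 * (- E.\<kappa> * (s + 4) / (32 * R ^ 4) + R powr (- s - 2) * c_const (s + 2) d / (8 * R\<^sup>2))"
  have m: "ereal m \<le> v'' (R\<^sup>2)"
    using E.second_derivative[OF v'[unfolded g_def] cont ev d2] unfolding DIM m_def .
  have vR: "v (R\<^sup>2) = ereal E.vR" by (rule E.v_R)
  have i: "ereal (R powr (s + 2)) * v' (R\<^sup>2) = ereal (c_const s d / 4)"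
  proof -
    have "R powr (s + 2) * R powr (- s) = R powr 2" by (simp flip: powr_add)
    then have "R powr (s + 2) * R powr (- s) = R\<^sup>2" using R by simp
    then have "R powr (s + 2) * g = c / 4"
      using R by (simp add: g_def \<kappa> field_simps)
    then show ?thesis by (simp add: v' c_def)
  qed
  have ii: "ereal (- ((s + 2) * (real d - s - 4) / (4 * (real d - s - 3)))) \<le> ereal (R\<^sup>2) * (v'' (R\<^sup>2) / v' (R\<^sup>2))"
  proof -
    define K where "K = R powr (- s)"
    have K: "K > 0" using R by (simp add: K_def)
    have "R powr (- s - 2) * R powr 2 = K" by (simp add: K_def flip: powr_add)
    then have K2: "R powr (- s - 2) = K / R\<^sup>2" using R by (simp add: field_simps)
    have c2: "c_const (s + 2) d = c * (2 * real d - s - 4) / (4 * (real d - s - 3))"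
      using c_const_add_2[of d s] d s by (simp add: c_def field_simps)
    \<comment> \<open>Dividing by the slope cancels \<kappa> and every power of R; only the quotient
      of the two constants is left, which \<open>c2\<close> evaluates.\<close>
    have "R\<^sup>2 * (m / g) = - (s + 4) / 4 + c_const (s + 2) d / c"
      using R K c unfolding m_def g_def \<kappa> K2 K_def[symmetric]
      by (simp add: field_simps power2_eq_square power4_eq_xxxx)
    also have "\<dots> = - (s + 4) / 4 + (2 * real d - s - 4) / (4 * (real d - s - 3))"
      unfolding c2 using c by simp
    also have "\<dots> = - ((s + 2) * (real d - s - 4) / (4 * (real d - s - 3)))"
      using s by (simp add: divide_simps) (simp add: algebra_simps)
    finally have e: "- ((s + 2) * (real d - s - 4) / (4 * (real d - s - 3))) = R\<^sup>2 * (m / g)" ..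
    \<comment> \<open>The second derivative may be infinite, so the quotient is compared by cases;
      \<open>g\<close> is positive and finite.\<close>
    have "ereal (m / g) \<le> v'' (R\<^sup>2) / ereal g"
      using m g by (cases "v'' (R\<^sup>2)") (auto simp: divide_right_mono)
    then have "ereal (R\<^sup>2) * ereal (m / g) \<le> ereal (R\<^sup>2) * (v'' (R\<^sup>2) / ereal g)"
      by (intro ereal_mult_left_mono) auto
    then show ?thesis unfolding e v' by simp
  qed
  have v0: "ereal (E.self_pot + E.vR - riesz_sq s (R\<^sup>2)) \<le> v 0" by (rule E.v_0_ge)
  have lim0: "((\<lambda>r. v (r\<^sup>2) - v (R\<^sup>2)) \<longlongrightarrow> v 0 - v (R\<^sup>2)) (at_right 0)"
    unfolding vR by (intro tendsto_diff_ereal_general E.v_tendsto_at_0 tendsto_const) auto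
  have v0': "ereal (E.self_pot - riesz_sq s (R\<^sup>2)) \<le> v 0 - v (R\<^sup>2)"
    using v0 unfolding vR by (cases "v 0") auto
  have iii: "\<exists>L. ((\<lambda>r. ereal (R powr s) * (v (r\<^sup>2) - v (R\<^sup>2))) \<longlongrightarrow> L) (at_right 0)
      \<and> L \<ge> ereal ((c_const s d - 1) / s)" if "s \<noteq> 0"
  proof (intro exI conjI)
    show "((\<lambda>r. ereal (R powr s) * (v (r\<^sup>2) - v (R\<^sup>2))) \<longlongrightarrow> ereal (R powr s) * (v 0 - v (R\<^sup>2))) (at_right 0)"
      by (intro tendsto_cmult_ereal lim0) auto
    have "R powr s * R powr (- s) = 1" using R by (simp flip: powr_add)
    then have "(c_const s d - 1) / s = R powr s * (E.self_pot - riesz_sq s (R\<^sup>2))"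
      using that unfolding E.self_pot_eq riesz_sq_def E.R_powr DIM
      by (simp add: field_simps)
    then have "ereal ((c_const s d - 1) / s) = ereal (R powr s) * ereal (E.self_pot - riesz_sq s (R\<^sup>2))"
      by simp
    also have "\<dots> \<le> ereal (R powr s) * (v 0 - v (R\<^sup>2))"
      by (intro ereal_mult_left_mono v0') auto
    finally show "ereal ((c_const s d - 1) / s) \<le> ereal (R powr s) * (v 0 - v (R\<^sup>2))" .
  qed
  have iii': "\<exists>L. ((\<lambda>r. v (r\<^sup>2) - v (R\<^sup>2)) \<longlongrightarrow> L) (at_right 0) \<and> L \<ge> ereal (b_const d)" if "s = 0"
  proof (intro exI conjI, rule lim0)
    have "E.self_pot - riesz_sq s (R\<^sup>2) = b_const d"
      using that R unfolding E.self_pot_eq riesz_sq_def DIM by (simp add: ln_realpow)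
    then show "ereal (b_const d) \<le> v 0 - v (R\<^sup>2)" using v0' by simp
  qed
  have rs: "riesz_sq s ((R + r)\<^sup>2) = (if s = 0 then - ln (R + r) else (R + r) powr (- s) / s)"
    if "r > 0" for r
  proof -
    have p: "R + r > 0" using that R by simp
    then have "(R + r) powr 2 = (R + r)\<^sup>2" by simp
    then have "((R + r)\<^sup>2) powr (- s / 2) = ((R + r) powr 2) powr (- s / 2)" by (simp only:)
    also have "\<dots> = (R + r) powr (- s)" unfolding powr_powr by simp
    finally show ?thesis using p by (simp add: riesz_sq_def ln_realpow)
  qed
  have Liminf_rs: "Liminf at_top (\<lambda>r. ereal (riesz_sq s ((R + r)\<^sup>2)) + v (r\<^sup>2)) =
      Liminf at_top (\<lambda>r. ereal (if s = 0 then - ln (R + r) else (R + r) powr (- s) / s) + v (r\<^sup>2))"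
  proof (rule Liminf_eq)
    show "\<forall>\<^sub>F r in at_top. ereal (riesz_sq s ((R + r)\<^sup>2)) + v (r\<^sup>2) =
        ereal (if s = 0 then - ln (R + r) else (R + r) powr (- s) / s) + v (r\<^sup>2)"
      using eventually_gt_at_top[of 0] by eventually_elim (simp only: rs)
  qed
  have far: "ereal (E.vR + E.self_pot) \<le> Liminf at_top
      (\<lambda>r. ereal (if s = 0 then - ln (R + r) else (R + r) powr (- s) / s) + v (r\<^sup>2))" if "s \<noteq> - 1"
    using E.liminf_at_infinity E.liminf_at_infinity_less_minus_one that
    unfolding Liminf_rs by (meson linorder_neqE)
  have self: "E.self_pot = R powr (- s) / s * c_const s d" if "s \<noteq> 0"
    using that unfolding E.self_pot_eq DIM by simp
  have iv: "v (R\<^sup>2) + ereal (R powr (- s) / s * c_const s d)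
      \<le> Liminf at_top (\<lambda>r::real. ereal ((R + r) powr (- s) / s) + v (r\<^sup>2))" if "s \<noteq> 0" "s \<noteq> - 1"
    using far[OF that(2)] that(1) unfolding vR self[OF that(1), symmetric] by simp
  have iv0: "ereal (- ln R + b_const d) + v (R\<^sup>2)
      \<le> Liminf at_top (\<lambda>r::real. ereal (- ln (R + r)) + v (r\<^sup>2))" if "s = 0"
  proof -
    have "E.self_pot = - ln R + b_const d" using that unfolding E.self_pot_eq DIM by simp
    then show ?thesis using far that unfolding vR by (simp add: add.commute)
  qed
  have iv1: "v (R\<^sup>2) + ereal (R powr (- s) / s * c_const s d)
      \<le> Liminf at_top (\<lambda>r::real. ereal (r powr (- s) / s) + v (r\<^sup>2))" if "s = - 1"
  proof -
    have "Liminf at_top (\<lambda>r::real. ereal (r powr (- s) / s) + v (r\<^sup>2)) =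
        Liminf at_top (\<lambda>r::real. ereal (- r) + v (r\<^sup>2))"
    proof (rule Liminf_eq)
      show "\<forall>\<^sub>F r in at_top. ereal (r powr (- s) / s) + v (r\<^sup>2) = ereal (- r) + v (r\<^sup>2)"
        using eventually_gt_at_top[of 0] by eventually_elim (simp add: that)
    qed
    moreover have "s \<noteq> 0" using that by simp
    ultimately show ?thesis
      using E.liminf_at_infinity_minus_one[OF that] unfolding vR self[OF \<open>s \<noteq> 0\<close>, symmetric] by simp
  qed
  show ?thesis
    by (intro conjI impI i ii iii iii' iv iv0 iv1; simp)
qed

end
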